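(* Let $Q$ be a probability distribution on $\mathbb{R}$ with $\int x\,Q(dx)=0$, $\int x^2\,Q(dx)=1/2$ and $\int x^4\,Q(dx)<\infty$, and let $X_N$ be the associated $N\times N$ Hermitian Wigner matrix. Let $\xi\in(-2,2)$ and $\mu,\nu\in\mathbb{R}$. For $\eta\in\mathbb{R}$ put $$\widetilde D_N(\xi,\eta):=\det\!\left(X_N-\Big(\sqrt{N}\,\xi+\frac{\eta}{\sqrt{N}\,\varrho(\xi)}\Big)I_N\right)-\mathbb{E}\det\!\left(X_N-\Big(\sqrt{N}\,\xi+\frac{\eta}{\sqrt{N}\,\varrho(\xi)}\Big)I_N\right),$$ where $\varrho(\xi):=\frac{1}{2\pi}\sqrt{4-\xi^2}$. Then $$\lim_{N\to\infty}\frac{\mathbb{E}\big(\widetilde D_N(\xi,\mu)\,\widetilde D_N(\xi,\nu)\big)}{\sqrt{\mathbb{E}\,\widetilde D_N(\xi,\mu)^2}\,\sqrt{\mathbb{E}\,\widetilde D_N(\xi,\nu)^2}}=\frac{\sin\pi(\mu-\nu)}{\pi(\mu-\nu)},$$ where $\sin 0/0:=1$.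
   Context: Wigner matrix associated with $Q$: let $(X_{ii}/\sqrt2)_{i\in\mathbb{N}}$, $(X^{\mathrm{Re}}_{ij})_{i<j}$ and $(X^{\mathrm{Im}}_{ij})_{i<j}$ ($i,j\in\mathbb{N}$) be independent families of independent real random variables, all with distribution $Q$, on some probability space $(\Omega,\mathcal{F},\mathbb{P})$ with expectation $\mathbb{E}$. For $i<j$ put $X_{ij}:=X^{\mathrm{Re}}_{ij}+\mathbf{i}X^{\mathrm{Im}}_{ij}$ and $X_{ji}:=X^{\mathrm{Re}}_{ij}-\mathbf{i}X^{\mathrm{Im}}_{ij}$, where $\mathbf{i}$ is the imaginary unit. Then $X_N:=(X_{ij})_{1\le i,j\le N}$. $I_N$ denotes the $N\times N$ identity matrix. *)

theory Defs
  imports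
    "HOL-Probability.Probability"
    "Jordan_Normal_Form.Determinant"
begin

text \<open>
  Matrices are those of Jordan_Normal_Form, whose indices start at 0; accordingly the
  index set of the random variables below is the naturals including 0. The names \<open>Matrix.mat\<close> and
  \<open>Determinant.det\<close> are qualified because HOL-Analysis has constants with the same base names.
\<close>

datatype wigner_index = Diag nat | RePart nat nat | ImPart nat nat

definition wigner_indices :: "wigner_index set" where
  "wigner_indices = range Diag \<union> {RePart i j |i j. i < j} \<union> {ImPart i j |i j. i < j}"

text \<open>
  In the following, \<open>d i\<close> is the diagonal entry with index \<open>(i, i)\<close>, and for \<open>i < j\<close> the variables
  \<open>re i j\<close> and \<open>im i j\<close> are the real and imaginary parts of the entry with index \<open>(i, j)\<close>.
  Their values for \<open>i \<ge> j\<close> play no role.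
\<close>

primrec wigner_coord ::
  "(nat \<Rightarrow> 'a \<Rightarrow> real) \<Rightarrow> (nat \<Rightarrow> nat \<Rightarrow> 'a \<Rightarrow> real) \<Rightarrow> (nat \<Rightarrow> nat \<Rightarrow> 'a \<Rightarrow> real)
    \<Rightarrow> wigner_index \<Rightarrow> 'a \<Rightarrow> real" where
  "wigner_coord d re im (Diag i) = (\<lambda>\<omega>. d i \<omega> / sqrt 2)"
| "wigner_coord d re im (RePart i j) = re i j"
| "wigner_coord d re im (ImPart i j) = im i j"

definition wigner_family ::
  "'a measure \<Rightarrow> real measure \<Rightarrow> (nat \<Rightarrow> 'a \<Rightarrow> real) \<Rightarrow> (nat \<Rightarrow> nat \<Rightarrow> 'a \<Rightarrow> real)
    \<Rightarrow> (nat \<Rightarrow> nat \<Rightarrow> 'a \<Rightarrow> real) \<Rightarrow> bool" where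
  "wigner_family M Q d re im \<longleftrightarrow>
     prob_space.indep_vars M (\<lambda>_. borel) (wigner_coord d re im) wigner_indices \<and>
     (\<forall>k\<in>wigner_indices. distr M borel (wigner_coord d re im k) = Q)"

definition wigner_entry ::
  "(nat \<Rightarrow> 'a \<Rightarrow> real) \<Rightarrow> (nat \<Rightarrow> nat \<Rightarrow> 'a \<Rightarrow> real) \<Rightarrow> (nat \<Rightarrow> nat \<Rightarrow> 'a \<Rightarrow> real)
    \<Rightarrow> 'a \<Rightarrow> nat \<Rightarrow> nat \<Rightarrow> complex" where
  "wigner_entry d re im \<omega> i j =
     (if i = j then of_real (d i \<omega>)
      else if i < j then of_real (re i j \<omega>) + \<i> * of_real (im i j \<omega>)
      else of_real (re j i \<omega>) - \<i> * of_real (im j i \<omega>))"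

definition wigner_matrix ::
  "(nat \<Rightarrow> 'a \<Rightarrow> real) \<Rightarrow> (nat \<Rightarrow> nat \<Rightarrow> 'a \<Rightarrow> real) \<Rightarrow> (nat \<Rightarrow> nat \<Rightarrow> 'a \<Rightarrow> real)
    \<Rightarrow> nat \<Rightarrow> 'a \<Rightarrow> complex mat" where
  "wigner_matrix d re im N \<omega> = Matrix.mat N N (\<lambda>(i, j). wigner_entry d re im \<omega> i j)"

text \<open>
  The determinant of the Hermitian matrix \<open>X\<^sub>N - x I\<^sub>N\<close> is real, so it is recorded as a real random
  variable; lemma \<open>of_real_shifted_det\<close> shows that taking the real part loses nothing.
\<close>

definition shifted_det ::
  "(nat \<Rightarrow> 'a \<Rightarrow> real) \<Rightarrow> (nat \<Rightarrow> nat \<Rightarrow> 'a \<Rightarrow> real) \<Rightarrow> (nat \<Rightarrow> nat \<Rightarrow> 'a \<Rightarrow> real)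
    \<Rightarrow> nat \<Rightarrow> real \<Rightarrow> 'a \<Rightarrow> real" where
  "shifted_det d re im N x \<omega> =
     Re (Determinant.det (wigner_matrix d re im N \<omega> - complex_of_real x \<cdot>\<^sub>m 1\<^sub>m N))"

lemma of_real_shifted_det:
  "complex_of_real (shifted_det d re im N x \<omega>) =
     Determinant.det (wigner_matrix d re im N \<omega> - complex_of_real x \<cdot>\<^sub>m 1\<^sub>m N)"
proof -
  let ?A = "wigner_matrix d re im N \<omega> - complex_of_real x \<cdot>\<^sub>m 1\<^sub>m N"
  interpret cnj: comm_ring_hom cnj
    by unfold_locales auto
  have A: "?A \<in> carrier_mat N N"
    by (intro minus_carrier_mat smult_carrier_mat one_carrier_mat)
  have "map_mat cnj ?A = transpose_mat ?A"
    by (rule eq_matI) (auto simp: wigner_matrix_def wigner_entry_def)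
  hence "cnj (Determinant.det ?A) = Determinant.det ?A"
    using cnj.hom_det[of ?A] Determinant.det_transpose[OF A] by simp
  thus ?thesis
    unfolding shifted_det_def by (metis Reals_cnj_iff of_real_Re)
qed

definition semicircle_density :: "real \<Rightarrow> real" where
  "semicircle_density \<xi> = 1 / (2 * pi) * sqrt (4 - \<xi>\<^sup>2)"

definition centered_det ::
  "'a measure \<Rightarrow> (nat \<Rightarrow> 'a \<Rightarrow> real) \<Rightarrow> (nat \<Rightarrow> nat \<Rightarrow> 'a \<Rightarrow> real) \<Rightarrow> (nat \<Rightarrow> nat \<Rightarrow> 'a \<Rightarrow> real)
    \<Rightarrow> nat \<Rightarrow> real \<Rightarrow> real \<Rightarrow> 'a \<Rightarrow> real" where
  "centered_det M d re im N \<xi> \<eta> \<omega> =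
     (let x = sqrt (real N) * \<xi> + \<eta> / (sqrt (real N) * semicircle_density \<xi>)
      in shifted_det d re im N x \<omega> - (\<integral>\<omega>'. shifted_det d re im N x \<omega>' \<partial>M))"

end

theory Submission
  imports Defs "Jordan_Normal_Form.Char_Poly"
begin

text \<open>
  Write \<open>P\<^sub>N(x) = det(x I - X\<^sub>N)\<close>, let \<open>He\<^sub>k\<close> be the monic Hermite polynomials for the standard Gaussian
  weight, and let \<open>K\<^sub>n(x, y) = \<Sum>k\<le>n. He\<^sub>k(x) He\<^sub>k(y) / k!\<close>. The proof has an exact part and an
  asymptotic part.

  Exact part. Expand \<open>P\<^sub>N\<^sub>+\<^sub>1\<close> along its last row and column, which are independent of \<open>X\<^sub>N\<close>. Averaging
  the product \<open>P\<^sub>N\<^sub>+\<^sub>1(x) P\<^sub>N\<^sub>+\<^sub>1(y)\<close> over them only involves second and fourth moments of the new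
  entries and leaves traces of adjugates of \<open>x I - X\<^sub>N\<close> and \<open>y I - X\<^sub>N\<close> and products of their
  principal minors, which are again characteristic polynomials of Wigner matrices
  (lemma \<open>second_moment_recursion\<close>). The trace of one adjugate is the derivative of \<open>P\<^sub>N\<close>, and the
  trace of the product of two adjugates is, by the resolvent identity, a divided difference of such
  terms. So \<open>f\<^sub>N(x, y) = E(P\<^sub>N(x) P\<^sub>N(y))\<close> satisfies the closed recursion
  \<open>f\<^sub>N\<^sub>+\<^sub>1 = (1 + (x - \<partial>\<^sub>x)(y - \<partial>\<^sub>y) - (\<partial>\<^sub>x - \<partial>\<^sub>y) / (x - y)) f\<^sub>N + 2 c N f\<^sub>N\<^sub>-\<^sub>1\<close>,
  where \<open>c\<close> is the fourth moment of \<open>Q\<close> minus its Gaussian value \<open>3/4\<close>. Since \<open>x - \<partial>\<^sub>x\<close> raises \<open>He\<^sub>k\<close>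
  to \<open>He\<^sub>k\<^sub>+\<^sub>1\<close> and the divided difference is evaluated by the Christoffel-Darboux formula, the
  solution is \<open>f\<^sub>N = N! (\<Sum>j\<le>N/2. c\<^sup>j / j! * K\<^sub>N\<^sub>-\<^sub>2\<^sub>j)\<close> (lemma \<open>second_moment\<close>). In the same way
  \<open>E P\<^sub>N = He\<^sub>N\<close> (lemma \<open>first_moment\<close>).

  Asymptotic part. The correlation is a ratio, so only the local shape of the Hermite functions
  matters. On the scale \<open>1 / sqrt N\<close> around
  \<open>sqrt N * \<xi>\<close> the Hermite equation is, up to a relative error \<open>O(1/N)\<close>, the oscillator equation with
  frequency \<open>\<pi> \<rho>(\<xi>) sqrt N\<close> (lemma \<open>bulk_wave_ratio\<close>). Inserted into the Christoffel-Darboux formula,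
  this gives \<open>K\<^sub>N(x, y) / sqrt(K\<^sub>N(x, x) K\<^sub>N(y, y)) \<rightarrow> sin(\<pi>(\<mu> - \<nu>)) / (\<pi>(\<mu> - \<nu>))\<close>
  (lemma \<open>sine_kernel_limit\<close>). A single Hermite function is negligible against \<open>K\<^sub>N\<close>, hence so is the
  product of the means, and \<open>K\<^sub>N\<^sub>-\<^sub>2\<^sub>j\<close> has the same limit for each fixed \<open>j\<close>. By dominated convergence
  the sum over \<open>j\<close> contributes the factor \<open>exp c\<close> to the covariance and to the variances alike, and
  it cancels (lemma \<open>cov_series_correlation_limit\<close>).
\<close>

section \<open>Hermite polynomials and the Christoffel-Darboux formula\<close>

text \<open>
  The recursion through \<open>x - d/dx\<close> makes sense over every integral domain; the characteristic
  polynomials below are complex, while the asymptotic analysis is real.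
\<close>
primrec hermite :: "nat \<Rightarrow> 'a::idom poly" where
  "hermite 0 = 1"
| "hermite (Suc n) = [:0, 1:] * hermite n - pderiv (hermite n)"

lemma pderiv_hermite: "pderiv (hermite (Suc n)) = Polynomial.smult (of_nat (Suc n)) (hermite n)"
proof (induction n)
  case (Suc n)
  let ?h = "hermite (Suc n) :: 'a poly"
  have "pderiv (hermite (Suc (Suc n)) :: 'a poly) = ?h + [:0, 1:] * pderiv ?h - pderiv (pderiv ?h)"
    by (simp only: hermite.simps(2)[of "Suc n"] pderiv_diff pderiv_mult)
      (simp add: pderiv_pCons del: hermite.simps)
  also have "\<dots> = ?h + Polynomial.smult (of_nat (Suc n)) ([:0, 1:] * hermite n - pderiv (hermite n))"
    unfolding Suc pderiv_smult by (simp add: smult_diff_right del: of_nat_Suc)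
  also have "\<dots> = Polynomial.smult (of_nat (Suc (Suc n))) ?h"
    unfolding hermite.simps(2)[symmetric] of_nat_Suc[of "Suc n"] smult_add_left by simp
  finally show ?case .
qed (simp add: pderiv_pCons)

lemma degree_hermite_le: "degree (hermite n) \<le> n"
proof (induction n)
  case (Suc n)
  have "degree ([:0, 1:] * hermite n :: 'a poly) \<le> Suc n"
    using degree_mult_le[of "[:0,1:]" "hermite n :: 'a poly"] Suc by simp
  moreover have "degree (pderiv (hermite n :: 'a poly)) \<le> Suc n"
    using Suc by (intro degree_le) (auto simp: coeff_pderiv coeff_eq_0)
  ultimately show ?case by (simp add: degree_diff_le)
qed simp

definition hermite_kernel :: "nat \<Rightarrow> 'a::real_normed_field \<Rightarrow> 'a \<Rightarrow> 'a" where
  "hermite_kernel n x y = (\<Sum>k\<le>n. poly (hermite k) x * poly (hermite k) y / fact k)"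

lemma poly_pderiv_hermite_Suc:
  "poly (pderiv (hermite (Suc n))) x = of_nat (Suc n) * poly (hermite n) x"
  by (simp only: pderiv_hermite poly_smult)

lemma poly_hermite_Suc:
  "poly (hermite (Suc n)) x = x * poly (hermite n) x - poly (pderiv (hermite n)) x"
  by simp

text \<open>
  Induction on \<open>n\<close>: the three-term recursion turns the numerator for \<open>n + 1\<close> into \<open>n + 1\<close> times the
  numerator for \<open>n\<close> plus the new term of the kernel.
\<close>
lemma christoffel_darboux:
  fixes x y :: "'a::real_normed_field"
  shows "(x - y) * hermite_kernel n x y =
    (poly (hermite (Suc n)) x * poly (hermite n) y - poly (hermite n) x * poly (hermite (Suc n)) y) / fact n"
proof (induction n)
  case (Suc n)
  let ?H = "\<lambda>n z. poly (hermite n :: 'a poly) z"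
  have r: "?H (Suc (Suc n)) z = z * ?H (Suc n) z - of_nat (Suc n) * ?H n z" for z
    by (simp only: poly_hermite_Suc[of "Suc n"] poly_pderiv_hermite_Suc)
  have k: "hermite_kernel (Suc n) x y = hermite_kernel n x y + ?H (Suc n) x * ?H (Suc n) y / fact (Suc n)"
    unfolding hermite_kernel_def by simp
  have f: "fact (Suc n) = of_nat (Suc n) * (fact n :: 'a)" by simp
  have "(x - y) * hermite_kernel (Suc n) x y
      = (of_nat (Suc n) * (?H (Suc n) x * ?H n y - ?H n x * ?H (Suc n) y)
          + (x - y) * ?H (Suc n) x * ?H (Suc n) y) / fact (Suc n)"
    unfolding k distrib_left Suc unfolding f
    by (simp add: field_simps del: of_nat_Suc hermite.simps)
  also have "of_nat (Suc n) * (?H (Suc n) x * ?H n y - ?H n x * ?H (Suc n) y) + (x - y) * ?H (Suc n) x * ?H (Suc n) y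
      = ?H (Suc (Suc n)) x * ?H (Suc n) y - ?H (Suc n) x * ?H (Suc (Suc n)) y"
    unfolding r by (simp add: algebra_simps del: of_nat_Suc hermite.simps)
  finally show ?case .
qed (simp add: hermite_kernel_def pderiv_1)

section \<open>The Hermite functions as solutions of a differential equation\<close>

text \<open>
  The Hermite functions are not normalised: the factor \<open>1 / k!\<close> is kept in the kernel, which avoids
  square roots.
\<close>
definition psi :: "nat \<Rightarrow> real \<Rightarrow> real" where
  "psi n t = poly (hermite n) t * exp (- t\<^sup>2 / 4)"

definition dpsi :: "nat \<Rightarrow> real \<Rightarrow> real" where
  "dpsi n t = (poly (pderiv (hermite n)) t - t / 2 * poly (hermite n) t) * exp (- t\<^sup>2 / 4)"

lemma has_real_derivative_psi: "(psi n has_real_derivative dpsi n t) (at t)"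
  unfolding psi_def[abs_def] dpsi_def
  by (rule derivative_eq_intros poly_DERIV refl | simp)+ (simp add: algebra_simps)

lemma psi_Suc: "psi (Suc n) t = t / 2 * psi n t - dpsi n t"
  unfolding psi_def dpsi_def poly_hermite_Suc by (simp add: algebra_simps)

lemma dpsi_Suc: "dpsi (Suc n) t = of_nat (Suc n) * psi n t - t / 2 * psi (Suc n) t"
  unfolding psi_def dpsi_def poly_pderiv_hermite_Suc by (simp only: algebra_simps)

lemma has_real_derivative_dpsi:
  "(dpsi n has_real_derivative - (real n + 1 / 2 - t\<^sup>2 / 4) * psi n t) (at t)"
proof -
  have "((\<lambda>t. t / 2 * psi n t - psi (Suc n) t) has_real_derivative
      1 / 2 * psi n t + t / 2 * dpsi n t - dpsi (Suc n) t) (at t)"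
    by (rule derivative_eq_intros has_real_derivative_psi refl | simp)+
  moreover have "(\<lambda>t. t / 2 * psi n t - psi (Suc n) t) = dpsi n"
    by (simp add: fun_eq_iff psi_Suc)
  moreover have "1 / 2 * psi n t + t / 2 * dpsi n t - dpsi (Suc n) t
      = - (real n + 1 / 2 - t\<^sup>2 / 4) * psi n t"
    unfolding dpsi_Suc psi_Suc by (simp add: algebra_simps power2_eq_square)
  ultimately show ?thesis by simp
qed

definition wkernel :: "nat \<Rightarrow> real \<Rightarrow> real \<Rightarrow> real" where
  "wkernel n x y = (\<Sum>k\<le>n. psi k x * psi k y / fact k)"

lemma wkernel_eq: "wkernel n x y = hermite_kernel n x y * exp (- (x\<^sup>2 + y\<^sup>2) / 4)"
  unfolding wkernel_def hermite_kernel_def psi_def sum_distrib_right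
  by (intro sum.cong refl) (simp add: exp_add[symmetric] field_simps)

text \<open>
  The diagonal of the kernel is an energy of the oscillator equation in
  \<open>has_real_derivative_dpsi\<close>, up to the shift from \<open>n + 1/2\<close> to \<open>n + 1\<close>. It bounds \<open>psi n\<close> by the kernel wherever \<open>x\<^sup>2 / 4 < n + 1\<close>.
\<close>
lemma wkernel_diag:
  "fact n * wkernel n x x = (dpsi n x)\<^sup>2 + (real n + 1 - x\<^sup>2 / 4) * (psi n x)\<^sup>2"
proof (induction n)
  case 0
  show ?case by (simp add: wkernel_def psi_def dpsi_def power2_eq_square algebra_simps)
next
  case (Suc n)
  have "fact (Suc n) * wkernel (Suc n) x x = of_nat (Suc n) * (fact n * wkernel n x x) + (psi (Suc n) x)\<^sup>2"
    unfolding wkernel_def fact_Suc[of n] by (simp add: distrib_left power2_eq_square del: of_nat_Suc)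
  also have "dpsi n x = x / 2 * psi n x - psi (Suc n) x" by (simp add: psi_Suc)
  ultimately show ?case unfolding Suc dpsi_Suc
    by (simp add: algebra_simps power2_eq_square)
qed

text \<open>
  The Christoffel-Darboux formula with \<open>psi (Suc n)\<close> eliminated in favour of the derivative of
  \<open>psi n\<close>, so that the main term is a Wronskian-like expression in one solution at two points.
\<close>
lemma wkernel_offdiag:
  "(x - y) * (fact n * wkernel n x y) =
    (x - y) / 2 * (psi n x * psi n y) + (psi n x * dpsi n y - dpsi n x * psi n y)"
proof -
  have e: "exp (- (x\<^sup>2 + y\<^sup>2) / 4) = exp (- x\<^sup>2 / 4) * exp (- y\<^sup>2 / 4)"
    by (simp add: exp_add[symmetric] add_divide_distrib)
  have "(x - y) * (fact n * wkernel n x y)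
      = fact n * ((x - y) * hermite_kernel n x y) * exp (- (x\<^sup>2 + y\<^sup>2) / 4)"
    unfolding wkernel_eq by simp
  also have "\<dots> = psi (Suc n) x * psi n y - psi n x * psi (Suc n) y"
    unfolding christoffel_darboux psi_def e
    by (simp del: hermite.simps) (simp add: algebra_simps del: hermite.simps)
  also have "\<dots> = (x - y) / 2 * (psi n x * psi n y) + (psi n x * dpsi n y - dpsi n x * psi n y)"
    unfolding psi_Suc by (simp add: field_simps)
  finally show ?thesis .
qed

text \<open>
  For an exact solution of \<open>h'' = - l\<^sup>2 h\<close> the quantity \<open>(h' + i l h) exp(- i l t)\<close> is constant in \<open>t\<close>:
  it records amplitude and phase of the oscillation. For \<open>psi n\<close> it drifts slowly.
\<close>
definition wave :: "real \<Rightarrow> nat \<Rightarrow> real \<Rightarrow> complex" where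
  "wave l n t = Complex (dpsi n t) (l * psi n t) * cis (- (l * t))"

lemma has_vector_derivative_wave:
  "(wave l n has_vector_derivative
      of_real ((l\<^sup>2 - (real n + 1 / 2 - t\<^sup>2 / 4)) * psi n t) * cis (- (l * t))) (at t)"
proof -
  have w: "wave l n = (\<lambda>t. (of_real (dpsi n t) + \<i> * of_real (l * psi n t)) * exp (\<i> * of_real (- (l * t))))"
    by (simp add: fun_eq_iff wave_def Complex_eq cis_conv_exp)
  have "((\<lambda>t. of_real (dpsi n t) + \<i> * of_real (l * psi n t) :: complex) has_vector_derivative
      of_real (- (real n + 1 / 2 - t\<^sup>2 / 4) * psi n t) + \<i> * of_real (l * dpsi n t)) (at t)"
    by (intro derivative_intros has_vector_derivative_of_real has_vector_derivative_mult_right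
        has_real_derivative_dpsi DERIV_cmult has_real_derivative_psi
        has_real_derivative_iff_has_vector_derivative[THEN iffD1])
  moreover have "((\<lambda>t. exp (\<i> * of_real (- (l * t)))) has_vector_derivative
      (- \<i> * of_real l) * exp (\<i> * of_real (- (l * t)))) (at t)"
  proof -
    have "((\<lambda>z. exp (\<i> * (- (of_real l * z)))) has_field_derivative
        (- \<i> * of_real l) * exp (\<i> * (- (of_real l * of_real t)))) (at (of_real t))"
      by (rule derivative_eq_intros refl | simp)+
    from has_vector_derivative_real_field[OF this] show ?thesis by simp
  qed
  ultimately have "((\<lambda>t. (of_real (dpsi n t) + \<i> * of_real (l * psi n t)) * exp (\<i> * of_real (- (l * t))))
     has_vector_derivative
     (of_real (dpsi n t) + \<i> * of_real (l * psi n t)) * ((- \<i> * of_real l) * exp (\<i> * of_real (- (l * t))))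
     + (of_real (- (real n + 1 / 2 - t\<^sup>2 / 4) * psi n t) + \<i> * of_real (l * dpsi n t)) * exp (\<i> * of_real (- (l * t)))) (at t)"
    by (rule has_vector_derivative_mult)
  moreover have "(of_real (dpsi n t) + \<i> * of_real (l * psi n t)) * ((- \<i> * of_real l) * exp (\<i> * of_real (- (l * t))))
     + (of_real (- (real n + 1 / 2 - t\<^sup>2 / 4) * psi n t) + \<i> * of_real (l * dpsi n t)) * exp (\<i> * of_real (- (l * t)))
     = of_real ((l\<^sup>2 - (real n + 1 / 2 - t\<^sup>2 / 4)) * psi n t) * cis (- (l * t))"
    unfolding cis_conv_exp by (simp add: algebra_simps power2_eq_square)
  ultimately show ?thesis unfolding w by simp
qed

lemma norm_wave: "(cmod (wave l n t))\<^sup>2 = (dpsi n t)\<^sup>2 + l\<^sup>2 * (psi n t)\<^sup>2"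
  by (simp add: wave_def norm_mult cmod_power2 power_mult_distrib)

lemma psi_le_wave: "l > 0 \<Longrightarrow> \<bar>psi n t\<bar> \<le> cmod (wave l n t) / l"
proof -
  assume l: "l > 0"
  have "(l * \<bar>psi n t\<bar>)\<^sup>2 \<le> (cmod (wave l n t))\<^sup>2"
    unfolding norm_wave by (simp add: power_mult_distrib)
  hence "l * \<bar>psi n t\<bar> \<le> cmod (wave l n t)"
    by (rule power2_le_imp_le) simp
  thus ?thesis using l by (simp add: field_simps)
qed

text \<open>
  The derivative of the wave is at most \<open>B / l\<close> times the wave itself, hence at most \<open>B / l\<close> times the
  maximum of its modulus over the segment; as the segment is short, that maximum is at most twice the
  modulus at \<open>y\<close>.
\<close>
lemma wave_close:
  assumes l: "l > 0"
    and B: "\<And>t. t \<in> closed_segment x y \<Longrightarrow> \<bar>l\<^sup>2 - (real n + 1 / 2 - t\<^sup>2 / 4)\<bar> \<le> B"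
    and small: "B * \<bar>x - y\<bar> / l \<le> 1 / 2"
  shows "cmod (wave l n x - wave l n y) \<le> 2 * (B * \<bar>x - y\<bar> / l) * cmod (wave l n y)"
proof -
  let ?S = "closed_segment x y" and ?w = "wave l n"
  define e where "e = B * \<bar>x - y\<bar> / l"
  have B0: "B \<ge> 0" using B[of x] by (meson abs_ge_zero ends_in_segment(1) order_trans)
  have cont: "continuous_on ?S (\<lambda>t. cmod (?w t))"
    using has_vector_derivative_continuous[OF has_vector_derivative_wave]
    by (intro continuous_on_norm continuous_at_imp_continuous_on) blast
  obtain m where m: "m \<in> ?S" "\<And>t. t \<in> ?S \<Longrightarrow> cmod (?w t) \<le> cmod (?w m)"
    using continuous_attains_sup[OF compact_segment _ cont] by force
  have lip: "cmod (?w s - ?w y) \<le> e * cmod (?w m)" if s: "s \<in> ?S" for s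
  proof -
    have "cmod (?w s - ?w y) \<le> B * (cmod (?w m) / l) * norm (s - y)"
    proof (rule differentiable_bound[OF convex_closed_segment])
      fix t assume t: "t \<in> ?S"
      show "(?w has_derivative (\<lambda>h. h *\<^sub>R (of_real ((l\<^sup>2 - (real n + 1 / 2 - t\<^sup>2 / 4)) * psi n t) * cis (- (l * t)))))
          (at t within ?S)"
        using has_vector_derivative_wave[of l n t] unfolding has_vector_derivative_def
        by (rule has_derivative_at_withinI)
      have "\<bar>psi n t\<bar> \<le> cmod (?w m) / l"
        using psi_le_wave[OF l, of n t] divide_right_mono[OF m(2)[OF t], of l] l by linarith
      hence "\<bar>l\<^sup>2 - (real n + 1 / 2 - t\<^sup>2 / 4)\<bar> * \<bar>psi n t\<bar> \<le> B * (cmod (?w m) / l)"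
        by (intro mult_mono B t B0) auto
      moreover have "onorm (\<lambda>h. h *\<^sub>R (of_real ((l\<^sup>2 - (real n + 1 / 2 - t\<^sup>2 / 4)) * psi n t) * cis (- (l * t))) :: complex)
          \<le> \<bar>l\<^sup>2 - (real n + 1 / 2 - t\<^sup>2 / 4)\<bar> * \<bar>psi n t\<bar>"
        by (rule onorm_le) (simp only: norm_scaleR norm_mult norm_of_real norm_cis abs_mult real_norm_def mult_ac mult_1 mult_1_right order_refl)
      ultimately show "onorm (\<lambda>h. h *\<^sub>R (of_real ((l\<^sup>2 - (real n + 1 / 2 - t\<^sup>2 / 4)) * psi n t) * cis (- (l * t))) :: complex)
          \<le> B * (cmod (?w m) / l)" by linarith
    qed (use s in auto)
    also have "\<dots> \<le> B * (cmod (?w m) / l) * \<bar>x - y\<bar>"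
      using s B0 l segment_bound(2)[of s x y]
      by (intro mult_left_mono) (auto simp: abs_minus_commute)
    finally show ?thesis by (simp add: e_def field_simps)
  qed
  have "cmod (?w m) \<le> cmod (?w y) + cmod (?w m - ?w y)"
    using norm_triangle_ineq[of "?w y" "?w m - ?w y"] by simp
  also have "\<dots> \<le> cmod (?w y) + 1 / 2 * cmod (?w m)"
  proof -
    have "e * cmod (?w m) \<le> 1 / 2 * cmod (?w m)"
      using small by (intro mult_right_mono) (simp_all add: e_def)
    with lip[OF m(1)] show ?thesis by linarith
  qed
  finally have "cmod (?w m) \<le> 2 * cmod (?w y)" by simp
  moreover have "e \<ge> 0" using B0 l by (simp add: e_def)
  ultimately have "e * cmod (?w m) \<le> 2 * e * cmod (?w y)"
    using mult_left_mono[of "cmod (?w m)" "2 * cmod (?w y)" e] by simp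
  with lip[of x] show ?thesis by (simp add: e_def)
qed

lemma wkernel_diag_wave:
  "fact n * wkernel n x x = (cmod (wave l n x))\<^sup>2 + (real n + 1 - x\<^sup>2 / 4 - l\<^sup>2) * (psi n x)\<^sup>2"
  unfolding wkernel_diag norm_wave by (simp add: algebra_simps)

text \<open>
  If the wave were the same at both points, the last summand would be
  \<open>sin(l (x - y)) / (l (x - y))\<close> times its squared modulus; this is where the sine kernel comes from.
\<close>
lemma wkernel_offdiag_wave:
  assumes "x \<noteq> y" "l \<noteq> 0"
  shows "fact n * wkernel n x y = psi n x * psi n y / 2
     + Im (wave l n x * cnj (wave l n y) * cis (l * (x - y))) / (l * (x - y))"
proof -
  have c: "cis (- (l * x)) * cnj (cis (- (l * y))) * cis (l * (x - y)) = 1"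
    by (simp add: cis_mult cis_cnj algebra_simps)
  have "wave l n x * cnj (wave l n y) * cis (l * (x - y))
      = Complex (dpsi n x) (l * psi n x) * cnj (Complex (dpsi n y) (l * psi n y))
        * (cis (- (l * x)) * cnj (cis (- (l * y))) * cis (l * (x - y)))"
    by (simp add: wave_def mult_ac)
  hence "Im (wave l n x * cnj (wave l n y) * cis (l * (x - y)))
      = l * (psi n x * dpsi n y - dpsi n x * psi n y)"
    unfolding c by (simp add: algebra_simps)
  moreover have "fact n * wkernel n x y = psi n x * psi n y / 2 + (psi n x * dpsi n y - dpsi n x * psi n y) / (x - y)"
    using wkernel_offdiag[of x y n] assms(1) by (simp add: field_simps)
  ultimately show ?thesis using assms by simp
qed

lemma wkernel_diag_pos: "wkernel n x x > 0"
proof -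
  have "0 < psi 0 x * psi 0 x / fact 0" by (simp add: psi_def)
  also have "\<dots> \<le> wkernel n x x" unfolding wkernel_def
    by (rule member_le_sum) (auto simp: zero_le_mult_iff)
  finally show ?thesis .
qed

lemma wave_nonzero:
  assumes "l \<noteq> 0" shows "wave l n x \<noteq> 0"
proof
  assume "wave l n x = 0"
  hence "(dpsi n x)\<^sup>2 + l\<^sup>2 * (psi n x)\<^sup>2 = 0" using norm_wave[of l n x] by simp
  hence "dpsi n x = 0" "psi n x = 0"
    using assms by (simp_all add: add_nonneg_eq_0_iff)
  thus False using wkernel_diag[of n x] wkernel_diag_pos[of n x] by simp
qed

lemma wkernel_le:
  assumes "m \<le> n" shows "\<bar>wkernel m x y\<bar> \<le> sqrt (wkernel n x x * wkernel n y y)"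
proof -
  have "wkernel m x y = (\<Sum>k\<le>m. (psi k x / sqrt (fact k)) * (psi k y / sqrt (fact k)))"
    unfolding wkernel_def by (intro sum.cong) (auto simp: field_simps)
  hence "(wkernel m x y)\<^sup>2 \<le> (\<Sum>k\<le>m. (psi k x / sqrt (fact k))\<^sup>2) * (\<Sum>k\<le>m. (psi k y / sqrt (fact k))\<^sup>2)"
    by (simp only: Cauchy_Schwarz_ineq_sum)
  moreover have "(\<Sum>k\<le>m. (psi k z / sqrt (fact k))\<^sup>2) = wkernel m z z" for z
    unfolding wkernel_def by (simp add: power_divide power2_eq_square)
  ultimately have "(wkernel m x y)\<^sup>2 \<le> wkernel m x x * wkernel m y y" by simp
  also have "\<dots> \<le> wkernel n x x * wkernel n y y"
    using assms by (intro mult_mono less_imp_le[OF wkernel_diag_pos])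
      (auto simp: wkernel_def zero_le_mult_iff intro!: sum_mono2)
  finally show ?thesis by (simp add: real_le_rsqrt)
qed

section \<open>The sine kernel in the bulk\<close>

text \<open>
  The argument at which \<open>centered_det\<close> evaluates the determinant: near \<open>sqrt N * \<xi>\<close> the eigenvalues of
  \<open>X\<^sub>N\<close> have mean spacing \<open>1 / (sqrt N * \<rho>(\<xi>))\<close>, so \<open>\<eta>\<close> counts mean spacings.
\<close>
definition bulk_point :: "real \<Rightarrow> real \<Rightarrow> nat \<Rightarrow> real" where
  "bulk_point \<xi> \<eta> N = sqrt (real N) * \<xi> + \<eta> / (sqrt (real N) * semicircle_density \<xi>)"

lemma semicircle_density_pos: "\<xi> \<in> {-2<..<2} \<Longrightarrow> semicircle_density \<xi> > 0"
proof -
  assume "\<xi> \<in> {-2<..<2}"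
  hence "\<xi>\<^sup>2 < 2\<^sup>2" by (intro power2_strict_mono) auto
  thus ?thesis by (simp add: semicircle_density_def)
qed

lemma semicircle_density_sq: "\<xi> \<in> {-2<..<2} \<Longrightarrow> (pi * semicircle_density \<xi>)\<^sup>2 = 1 - \<xi>\<^sup>2 / 4"
proof -
  assume "\<xi> \<in> {-2<..<2}"
  hence "\<xi>\<^sup>2 < 2\<^sup>2" by (intro power2_strict_mono) auto
  thus ?thesis by (simp add: semicircle_density_def power_mult_distrib power_divide)
qed

context
  fixes \<xi> :: real
  assumes \<xi>: "\<xi> \<in> {-2<..<2}"
begin

text \<open>
  The frequency of the oscillator that \<open>psi N\<close> approximates near \<open>sqrt N * \<xi>\<close>, as
  \<open>N - N \<xi>\<^sup>2 / 4 = (\<pi> \<rho>(\<xi>))\<^sup>2 N\<close>.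
\<close>
private definition "freq N = pi * semicircle_density \<xi> * sqrt (real N)"

lemma freq_pos: "N > 0 \<Longrightarrow> freq N > 0"
  using semicircle_density_pos[OF \<xi>] by (simp add: freq_def)

lemma freq_times_diff:
  "N > 0 \<Longrightarrow> freq N * (bulk_point \<xi> \<mu> N - bulk_point \<xi> \<nu> N) = pi * (\<mu> - \<nu>)"
  using semicircle_density_pos[OF \<xi>] by (simp add: freq_def bulk_point_def field_simps)

text \<open>
  The bound does not depend on \<open>N\<close>: between two bulk points \<open>t\<^sup>2\<close> differs from \<open>N \<xi>\<^sup>2\<close> by the product of
  a factor of order \<open>sqrt N\<close> and a factor of order \<open>1 / sqrt N\<close>.
\<close>
lemma freq_close:
  "\<exists>B. \<forall>N>0. \<forall>t\<in>closed_segment (bulk_point \<xi> \<mu> N) (bulk_point \<xi> \<nu> N).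
     \<bar>(freq N)\<^sup>2 - (real N + 1 / 2 - t\<^sup>2 / 4)\<bar> \<le> B"
proof -
  define s where "s = (\<bar>\<mu>\<bar> + \<bar>\<nu>\<bar>) / semicircle_density \<xi>"
  have s0: "s \<ge> 0" using semicircle_density_pos[OF \<xi>] by (simp add: s_def)
  have "\<bar>(freq N)\<^sup>2 - (real N + 1 / 2 - t\<^sup>2 / 4)\<bar> \<le> 1 / 2 + (s\<^sup>2 + 4 * s) / 4"
    if N: "N > 0" and t: "t \<in> closed_segment (bulk_point \<xi> \<mu> N) (bulk_point \<xi> \<nu> N)" for N t
  proof -
    define c where "c = sqrt (real N) * \<xi>"
    have "\<bar>\<eta> / (sqrt (real N) * semicircle_density \<xi>)\<bar> \<le> s / sqrt (real N)" if "\<bar>\<eta>\<bar> \<le> \<bar>\<mu>\<bar> + \<bar>\<nu>\<bar>" for \<eta>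
      using semicircle_density_pos[OF \<xi>] N that by (simp add: s_def field_simps abs_mult)
    hence "bulk_point \<xi> \<mu> N \<in> cball c (s / sqrt (real N))" "bulk_point \<xi> \<nu> N \<in> cball c (s / sqrt (real N))"
      by (simp_all add: bulk_point_def c_def dist_real_def)
    hence "closed_segment (bulk_point \<xi> \<mu> N) (bulk_point \<xi> \<nu> N) \<subseteq> cball c (s / sqrt (real N))"
      by (intro closed_segment_subset convex_cball)
    with t have u: "\<bar>t - c\<bar> \<le> s / sqrt (real N)" by (auto simp: dist_real_def)
    have "(t - c)\<^sup>2 \<le> (s / sqrt (real N))\<^sup>2"
      using u s0 by (intro power2_le_iff_abs_le[THEN iffD2]) auto
    also have "\<dots> \<le> s\<^sup>2"
      using N mult_right_mono[of 1 "real N" "s\<^sup>2"] by (simp add: power_divide field_simps)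
    finally have 1: "(t - c)\<^sup>2 \<le> s\<^sup>2" .
    have "\<bar>2 * c * (t - c)\<bar> \<le> 2 * (sqrt (real N) * 2) * (s / sqrt (real N))"
      unfolding abs_mult c_def using \<xi> u[unfolded c_def] by (intro mult_mono) auto
    hence 2: "\<bar>2 * c * (t - c)\<bar> \<le> 4 * s" using N by simp
    have 3: "(freq N)\<^sup>2 = real N - c\<^sup>2 / 4"
      unfolding freq_def power_mult_distrib[of "pi * _"] semicircle_density_sq[OF \<xi>]
      by (simp add: c_def power_mult_distrib algebra_simps)
    define p q where "p = (t - c)\<^sup>2" and "q = 2 * c * (t - c)"
    have "(freq N)\<^sup>2 - (real N + 1 / 2 - t\<^sup>2 / 4) = - 1 / 2 + (p + q) / 4"
      unfolding 3 p_def q_def by (simp add: power2_eq_square field_simps)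
    moreover have "0 \<le> p" "p \<le> s\<^sup>2" "\<bar>q\<bar> \<le> 4 * s"
      using 1 2 by (simp_all add: p_def q_def)
    moreover have "\<bar>v\<bar> \<le> 1 / 2 + (s\<^sup>2 + 4 * s) / 4"
      if "v = - 1 / 2 + (p + q) / 4" "0 \<le> p" "p \<le> s\<^sup>2" "\<bar>q\<bar> \<le> 4 * s" for v
      using that s0 zero_le_power2[of s] unfolding abs_le_iff by (simp add: field_simps)
    ultimately show ?thesis by blast
  qed
  thus ?thesis by blast
qed

private abbreviation "bulk_wave \<eta> N \<equiv> wave (freq N) N (bulk_point \<xi> \<eta> N)"

lemma freq_inverse_tendsto: "(\<lambda>N. c / (freq N)\<^sup>2) \<longlonglongrightarrow> 0"
proof -
  have "(\<lambda>N. c / (pi * semicircle_density \<xi>)\<^sup>2 * inverse (real N)) \<longlonglongrightarrow> c / (pi * semicircle_density \<xi>)\<^sup>2 * 0"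
    by (intro tendsto_intros LIMSEQ_inverse_real_of_nat lim_inverse_n)
  thus ?thesis by (simp add: freq_def power_mult_distrib field_simps)
qed

text \<open>
  Two bulk points are \<open>O(1 / sqrt N)\<close> apart, the frequency grows like \<open>sqrt N\<close>, and the error in the
  equation is bounded, so \<open>wave_close\<close> gives a relative error \<open>O(1/N)\<close>.
\<close>
lemma bulk_wave_ratio: "(\<lambda>N. bulk_wave \<mu> N / bulk_wave \<nu> N) \<longlonglongrightarrow> 1"
proof -
  obtain B where B: "\<And>N t. N > 0 \<Longrightarrow> t \<in> closed_segment (bulk_point \<xi> \<mu> N) (bulk_point \<xi> \<nu> N) \<Longrightarrow>
     \<bar>(freq N)\<^sup>2 - (real N + 1 / 2 - t\<^sup>2 / 4)\<bar> \<le> B"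
    using freq_close[of \<mu> \<nu>] by blast
  define e where "e N = B * (pi * \<bar>\<mu> - \<nu>\<bar>) / (freq N)\<^sup>2" for N
  have e: "e \<longlonglongrightarrow> 0" unfolding e_def[abs_def] by (rule freq_inverse_tendsto)
  have "(\<lambda>N. bulk_wave \<mu> N / bulk_wave \<nu> N - 1) \<longlonglongrightarrow> 0"
  proof (rule Lim_null_comparison)
    have "\<forall>\<^sub>F N in sequentially. e N < 1 / 2"
      using e by (rule order_tendstoD) simp
    thus "\<forall>\<^sub>F N in sequentially. norm (bulk_wave \<mu> N / bulk_wave \<nu> N - 1) \<le> 2 * e N"
      using eventually_gt_at_top[of 0]
    proof eventually_elim
      case (elim N)
      have "freq N * \<bar>bulk_point \<xi> \<mu> N - bulk_point \<xi> \<nu> N\<bar> = pi * \<bar>\<mu> - \<nu>\<bar>"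
        using arg_cong[OF freq_times_diff[OF elim(2), of \<mu> \<nu>], of abs] freq_pos[OF elim(2)]
        by (simp only: abs_mult abs_of_pos pi_gt_zero)
      hence d: "B * \<bar>bulk_point \<xi> \<mu> N - bulk_point \<xi> \<nu> N\<bar> / freq N = e N"
        using freq_pos[OF elim(2)] by (simp add: e_def power2_eq_square field_simps)
      have nz: "bulk_wave \<nu> N \<noteq> 0" using freq_pos[OF elim(2)] by (intro wave_nonzero) simp
      have "cmod (bulk_wave \<mu> N - bulk_wave \<nu> N) \<le> 2 * e N * cmod (bulk_wave \<nu> N)"
        using wave_close[where x = "bulk_point \<xi> \<mu> N" and y = "bulk_point \<xi> \<nu> N",
            OF freq_pos[OF elim(2)] B[OF elim(2)]] elim(1) unfolding d by simp
      moreover have "bulk_wave \<mu> N / bulk_wave \<nu> N - 1 = (bulk_wave \<mu> N - bulk_wave \<nu> N) / bulk_wave \<nu> N"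
        using nz by (simp add: diff_divide_distrib)
      ultimately show ?case using nz by (simp add: norm_divide divide_le_eq)
    qed
    show "(\<lambda>N. 2 * e N) \<longlonglongrightarrow> 0" using tendsto_mult_left[OF e, of 2] by simp
  qed
  thus ?thesis by (simp add: LIM_zero_iff)
qed

lemma psi_bulk_wave_tendsto:
  "(\<lambda>N. psi N (bulk_point \<xi> \<mu> N) * psi N (bulk_point \<xi> \<nu> N) / (cmod (bulk_wave \<mu> N) * cmod (bulk_wave \<nu> N)))
    \<longlonglongrightarrow> 0"
proof (rule Lim_null_comparison)
  show "\<forall>\<^sub>F N in sequentially. norm (psi N (bulk_point \<xi> \<mu> N) * psi N (bulk_point \<xi> \<nu> N)
      / (cmod (bulk_wave \<mu> N) * cmod (bulk_wave \<nu> N))) \<le> 1 / (freq N)\<^sup>2"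
    using eventually_gt_at_top[of 0]
  proof eventually_elim
    case (elim N)
    note l = freq_pos[OF elim]
    have "\<bar>psi N (bulk_point \<xi> \<mu> N)\<bar> * \<bar>psi N (bulk_point \<xi> \<nu> N)\<bar>
        \<le> (cmod (bulk_wave \<mu> N) / freq N) * (cmod (bulk_wave \<nu> N) / freq N)"
      using l by (intro mult_mono psi_le_wave) auto
    moreover have "cmod (bulk_wave \<mu> N) > 0" "cmod (bulk_wave \<nu> N) > 0"
      using l by (simp_all add: wave_nonzero)
    ultimately show ?case using l
      by (simp add: abs_mult field_simps power2_eq_square)
  qed
qed (rule freq_inverse_tendsto)

lemma wkernel_diag_asymp:
  "(\<lambda>N. fact N * wkernel N (bulk_point \<xi> \<mu> N) (bulk_point \<xi> \<mu> N) / (cmod (bulk_wave \<mu> N))\<^sup>2) \<longlonglongrightarrow> 1"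
proof -
  obtain B where B: "\<And>N. N > 0 \<Longrightarrow> \<bar>(freq N)\<^sup>2 - (real N + 1 / 2 - (bulk_point \<xi> \<mu> N)\<^sup>2 / 4)\<bar> \<le> B"
    using freq_close[of \<mu> \<mu>] by auto
  have "(\<lambda>N. fact N * wkernel N (bulk_point \<xi> \<mu> N) (bulk_point \<xi> \<mu> N) / (cmod (bulk_wave \<mu> N))\<^sup>2 - 1) \<longlonglongrightarrow> 0"
  proof (rule Lim_null_comparison)
    show "\<forall>\<^sub>F N in sequentially. norm (fact N * wkernel N (bulk_point \<xi> \<mu> N) (bulk_point \<xi> \<mu> N)
        / (cmod (bulk_wave \<mu> N))\<^sup>2 - 1) \<le> (B + 1 / 2) / (freq N)\<^sup>2"
      using eventually_gt_at_top[of 0]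
    proof eventually_elim
      case (elim N)
      note l = freq_pos[OF elim]
      let ?x = "bulk_point \<xi> \<mu> N" and ?w = "bulk_wave \<mu> N"
      have w: "cmod ?w > 0" using l by (simp add: wave_nonzero)
      have "\<bar>psi N ?x\<bar>\<^sup>2 \<le> (cmod ?w / freq N)\<^sup>2"
        using psi_le_wave[OF l] by (intro power_mono) auto
      moreover have "\<bar>real N + 1 - ?x\<^sup>2 / 4 - (freq N)\<^sup>2\<bar> \<le> B + 1 / 2"
        using B[OF elim] by linarith
      ultimately have "\<bar>real N + 1 - ?x\<^sup>2 / 4 - (freq N)\<^sup>2\<bar> * \<bar>psi N ?x\<bar>\<^sup>2 \<le> (B + 1 / 2) * (cmod ?w / freq N)\<^sup>2"
        by (intro mult_mono) auto
      moreover have "fact N * wkernel N ?x ?x / (cmod ?w)\<^sup>2 - 1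
          = (real N + 1 - ?x\<^sup>2 / 4 - (freq N)\<^sup>2) * (psi N ?x)\<^sup>2 / (cmod ?w)\<^sup>2"
        unfolding wkernel_diag_wave[of N ?x "freq N"] using w by (simp add: add_divide_distrib)
      ultimately show ?case using w by (simp add: abs_mult power_divide divide_le_eq)
    qed
  qed (rule freq_inverse_tendsto)
  thus ?thesis by (simp add: LIM_zero_iff)
qed

text \<open>
  Both the kernel off the diagonal and its two diagonal values are compared with the waves at the two
  points, whose quotient tends to 1. In the coincident case the quotient of kernels is exactly 1.
\<close>
lemma sine_kernel_limit:
  "(\<lambda>N. wkernel N (bulk_point \<xi> \<mu> N) (bulk_point \<xi> \<nu> N)
      / sqrt (wkernel N (bulk_point \<xi> \<mu> N) (bulk_point \<xi> \<mu> N) * wkernel N (bulk_point \<xi> \<nu> N) (bulk_point \<xi> \<nu> N)))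
    \<longlonglongrightarrow> sinc (pi * (\<mu> - \<nu>))"
proof (cases "\<mu> = \<nu>")
  case True
  have "wkernel N x x / sqrt (wkernel N x x * wkernel N x x) = 1" for N x
    using wkernel_diag_pos[of N x] by simp
  thus ?thesis using True by simp
next
  case False
  define \<theta> where "\<theta> = pi * (\<mu> - \<nu>)"
  have \<theta>: "\<theta> \<noteq> 0" using False by (simp add: \<theta>_def)
  let ?x = "\<lambda>N. bulk_point \<xi> \<mu> N" and ?y = "\<lambda>N. bulk_point \<xi> \<nu> N"
  let ?u = "bulk_wave \<mu>" and ?v = "bulk_wave \<nu>"
  define a where "a N = fact N * wkernel N (?x N) (?y N) / (cmod (?u N) * cmod (?v N))" for N
  have sgn: "(\<lambda>N. sgn (?u N / ?v N)) \<longlonglongrightarrow> 1"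
    using tendsto_sgn[OF bulk_wave_ratio[of \<mu> \<nu>]] by simp
  have "(\<lambda>N. psi N (?x N) * psi N (?y N) / (cmod (?u N) * cmod (?v N)) / 2
      + Im (sgn (?u N / ?v N) * cis \<theta>) / \<theta>) \<longlonglongrightarrow> 0 / 2 + Im (1 * cis \<theta>) / \<theta>"
    by (intro tendsto_intros psi_bulk_wave_tendsto sgn) (simp_all add: \<theta>)
  moreover have "\<forall>\<^sub>F N in sequentially. psi N (?x N) * psi N (?y N) / (cmod (?u N) * cmod (?v N)) / 2
      + Im (sgn (?u N / ?v N) * cis \<theta>) / \<theta> = a N"
    using eventually_gt_at_top[of 0]
  proof eventually_elim
    case (elim N)
    note l = freq_pos[OF elim]
    have w: "?u N \<noteq> 0" "?v N \<noteq> 0" using l by (simp_all add: wave_nonzero)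
    have Im_of_real_mult: "Im (of_real r * z) = r * Im z" for r z by simp
    have *: "p / (cmod (?u N) * cmod (?v N)) / 2 + q / \<theta>
        = (p / 2 + cmod (?u N) * cmod (?v N) * q / \<theta>) / (cmod (?u N) * cmod (?v N))" for p q
      using w \<theta> by (simp add: field_simps)
    have ne: "?x N \<noteq> ?y N" using freq_times_diff[OF elim, of \<mu> \<nu>] False by auto
    have "?u N * cnj (?v N) = of_real (cmod (?u N) * cmod (?v N)) * sgn (?u N / ?v N)"
      using w by (simp add: sgn_eq norm_divide field_simps complex_norm_square[symmetric] power2_eq_square)
    hence "Im (?u N * cnj (?v N) * cis \<theta>) = cmod (?u N) * cmod (?v N) * Im (sgn (?u N / ?v N) * cis \<theta>)"
      by (simp only: Im_of_real_mult mult.assoc[of "complex_of_real _"])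
    thus ?case
      unfolding a_def wkernel_offdiag_wave[OF ne, of "freq N" N, OF l[THEN less_imp_neq, symmetric]]
        freq_times_diff[OF elim] \<theta>_def[symmetric]
      by (simp only: *)
  qed
  ultimately have a: "a \<longlonglongrightarrow> sin \<theta> / \<theta>"
    using Lim_transform_eventually by fastforce
  have "(\<lambda>N. a N / sqrt ((fact N * wkernel N (?x N) (?x N) / (cmod (?u N))\<^sup>2)
      * (fact N * wkernel N (?y N) (?y N) / (cmod (?v N))\<^sup>2))) \<longlonglongrightarrow> sin \<theta> / \<theta> / sqrt (1 * 1)"
    by (intro tendsto_intros a wkernel_diag_asymp) simp
  moreover have "\<forall>\<^sub>F N in sequentially. a N / sqrt ((fact N * wkernel N (?x N) (?x N) / (cmod (?u N))\<^sup>2)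
      * (fact N * wkernel N (?y N) (?y N) / (cmod (?v N))\<^sup>2))
      = wkernel N (?x N) (?y N) / sqrt (wkernel N (?x N) (?x N) * wkernel N (?y N) (?y N))"
    using eventually_gt_at_top[of 0]
  proof eventually_elim
    case (elim N)
    have w: "cmod (?u N) > 0" "cmod (?v N) > 0" using freq_pos[OF elim] by (simp_all add: wave_nonzero)
    have "sqrt ((fact N * wkernel N (?x N) (?x N) / (cmod (?u N))\<^sup>2) * (fact N * wkernel N (?y N) (?y N) / (cmod (?v N))\<^sup>2))
        = fact N * sqrt (wkernel N (?x N) (?x N) * wkernel N (?y N) (?y N)) / (cmod (?u N) * cmod (?v N))"
      using w by (simp add: real_sqrt_mult real_sqrt_divide)
    thus ?case unfolding a_def using w by simp
  qed
  ultimately have "(\<lambda>N. wkernel N (?x N) (?y N) / sqrt (wkernel N (?x N) (?x N) * wkernel N (?y N) (?y N)))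
      \<longlonglongrightarrow> sin \<theta> / \<theta>"
    using Lim_transform_eventually by fastforce
  thus ?thesis using False unfolding \<theta>_def by simp
qed

text \<open>
  By \<open>wkernel_diag\<close> the quotient is at most \<open>1 / (N - i + 1 - x\<^sup>2 / 4)\<close>, and in the bulk this denominator
  grows like \<open>(\<pi> \<rho>(\<xi>))\<^sup>2 N\<close>.
\<close>
lemma psi_sq_div_wkernel_tendsto:
  "(\<lambda>N. (psi (N - i) (bulk_point \<xi> \<mu> N))\<^sup>2 / fact (N - i) / wkernel N (bulk_point \<xi> \<mu> N) (bulk_point \<xi> \<mu> N)) \<longlonglongrightarrow> 0"
proof -
  obtain B where B: "\<And>N. N > 0 \<Longrightarrow> \<bar>(freq N)\<^sup>2 - (real N + 1 / 2 - (bulk_point \<xi> \<mu> N)\<^sup>2 / 4)\<bar> \<le> B"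
    using freq_close[of \<mu> \<mu>] by auto
  have top: "filterlim (\<lambda>N. - (B + real i) + (freq N)\<^sup>2) at_top sequentially"
  proof (rule filterlim_tendsto_add_at_top[OF tendsto_const])
    have "filterlim (\<lambda>N. (pi * semicircle_density \<xi>)\<^sup>2 * real N) at_top sequentially"
      using semicircle_density_pos[OF \<xi>]
      by (intro filterlim_tendsto_pos_mult_at_top[OF tendsto_const] filterlim_real_sequentially) simp
    thus "filterlim (\<lambda>N. (freq N)\<^sup>2) at_top sequentially"
      by (simp add: freq_def power_mult_distrib)
  qed
  show ?thesis
  proof (rule Lim_null_comparison)
    show "(\<lambda>N. inverse (- (B + real i) + (freq N)\<^sup>2)) \<longlonglongrightarrow> 0"
      using tendsto_inverse_0_at_top[OF top] .
    have "\<forall>\<^sub>F N in sequentially. 0 < - (B + real i) + (freq N)\<^sup>2"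
      using top by (simp add: filterlim_at_top_dense)
    thus "\<forall>\<^sub>F N in sequentially. norm ((psi (N - i) (bulk_point \<xi> \<mu> N))\<^sup>2 / fact (N - i)
        / wkernel N (bulk_point \<xi> \<mu> N) (bulk_point \<xi> \<mu> N)) \<le> inverse (- (B + real i) + (freq N)\<^sup>2)"
      using eventually_gt_at_top[of i]
    proof eventually_elim
      case (elim N)
      let ?x = "bulk_point \<xi> \<mu> N"
      define c where "c = - (B + real i) + (freq N)\<^sup>2"
      have c: "0 < c" "c \<le> real (N - i) + 1 - ?x\<^sup>2 / 4"
        using B[of N] elim by (auto simp: c_def)
      have "c * (psi (N - i) ?x)\<^sup>2 \<le> fact (N - i) * wkernel (N - i) ?x ?x"
        unfolding wkernel_diag
        using mult_right_mono[OF c(2), of "(psi (N - i) ?x)\<^sup>2"] zero_le_power2[of "dpsi (N - i) ?x"]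
        by (metis add_increasing zero_le_power2)
      also have "\<dots> \<le> fact (N - i) * wkernel N ?x ?x"
        unfolding wkernel_def by (intro mult_left_mono sum_mono2) (auto simp: zero_le_mult_iff)
      finally have "c * ((psi (N - i) ?x)\<^sup>2 / fact (N - i)) \<le> wkernel N ?x ?x"
        by (simp add: field_simps)
      thus ?case using c(1) wkernel_diag_pos[of N ?x] unfolding c_def[symmetric]
        by (simp add: field_simps)
    qed
  qed
qed

lemma psi_prod_div_wkernel_tendsto:
  "(\<lambda>N. psi (N - i) (bulk_point \<xi> \<mu> N) * psi (N - i) (bulk_point \<xi> \<nu> N) / fact (N - i)
     / sqrt (wkernel N (bulk_point \<xi> \<mu> N) (bulk_point \<xi> \<mu> N) * wkernel N (bulk_point \<xi> \<nu> N) (bulk_point \<xi> \<nu> N))) \<longlonglongrightarrow> 0"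
proof (rule tendsto_rabs_zero_cancel)
  have "sqrt ((p\<^sup>2 / f / k) * (q\<^sup>2 / f / k')) = \<bar>p * q / f / sqrt (k * k')\<bar>" if "f > 0" "k > 0" "k' > 0" for p q f k k' :: real
    using that by (simp add: real_sqrt_mult real_sqrt_divide abs_mult)
  note * = this[OF fact_gt_zero wkernel_diag_pos wkernel_diag_pos]
  have "(\<lambda>N. sqrt (((psi (N - i) (bulk_point \<xi> \<mu> N))\<^sup>2 / fact (N - i) / wkernel N (bulk_point \<xi> \<mu> N) (bulk_point \<xi> \<mu> N))
      * ((psi (N - i) (bulk_point \<xi> \<nu> N))\<^sup>2 / fact (N - i) / wkernel N (bulk_point \<xi> \<nu> N) (bulk_point \<xi> \<nu> N)))) \<longlonglongrightarrow> sqrt (0 * 0)"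
    by (intro tendsto_intros psi_sq_div_wkernel_tendsto)
  thus "(\<lambda>N. \<bar>psi (N - i) (bulk_point \<xi> \<mu> N) * psi (N - i) (bulk_point \<xi> \<nu> N) / fact (N - i)
     / sqrt (wkernel N (bulk_point \<xi> \<mu> N) (bulk_point \<xi> \<mu> N) * wkernel N (bulk_point \<xi> \<nu> N) (bulk_point \<xi> \<nu> N))\<bar>) \<longlonglongrightarrow> 0"
    unfolding * by simp
qed

text \<open>
  Lowering the degree of the kernel by a fixed \<open>i\<close> removes \<open>i\<close> single terms, all negligible; the
  normalisation is still by the kernels of degree \<open>N\<close>.
\<close>
lemma sine_kernel_limit_shifted:
  "(\<lambda>N. wkernel (N - i) (bulk_point \<xi> \<mu> N) (bulk_point \<xi> \<nu> N)
      / sqrt (wkernel N (bulk_point \<xi> \<mu> N) (bulk_point \<xi> \<mu> N) * wkernel N (bulk_point \<xi> \<nu> N) (bulk_point \<xi> \<nu> N)))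
    \<longlonglongrightarrow> sinc (pi * (\<mu> - \<nu>))"
proof (induction i)
  case 0
  show ?case using sine_kernel_limit by simp
next
  case (Suc i)
  have "\<forall>\<^sub>F N in sequentially.
     wkernel (N - i) (bulk_point \<xi> \<mu> N) (bulk_point \<xi> \<nu> N)
      / sqrt (wkernel N (bulk_point \<xi> \<mu> N) (bulk_point \<xi> \<mu> N) * wkernel N (bulk_point \<xi> \<nu> N) (bulk_point \<xi> \<nu> N))
     - psi (N - i) (bulk_point \<xi> \<mu> N) * psi (N - i) (bulk_point \<xi> \<nu> N) / fact (N - i)
     / sqrt (wkernel N (bulk_point \<xi> \<mu> N) (bulk_point \<xi> \<mu> N) * wkernel N (bulk_point \<xi> \<nu> N) (bulk_point \<xi> \<nu> N))
     = wkernel (N - Suc i) (bulk_point \<xi> \<mu> N) (bulk_point \<xi> \<nu> N)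
      / sqrt (wkernel N (bulk_point \<xi> \<mu> N) (bulk_point \<xi> \<mu> N) * wkernel N (bulk_point \<xi> \<nu> N) (bulk_point \<xi> \<nu> N))"
    using eventually_gt_at_top[of i]
  proof eventually_elim
    case (elim N)
    hence N: "N - i = Suc (N - Suc i)" by simp
    have "wkernel (N - i) x y - psi (N - i) x * psi (N - i) y / fact (N - i) = wkernel (N - Suc i) x y" for x y
      unfolding N wkernel_def by simp
    thus ?case by (simp only: diff_divide_distrib[symmetric])
  qed
  with tendsto_diff[OF Suc psi_prod_div_wkernel_tendsto[of i \<mu> \<nu>]] show ?case
    by (simp add: filterlim_cong)
qed

end

section \<open>The limit of the correlation, given the covariance as a series\<close>

text \<open>
  \<open>N!\<close> times this will turn out to be the covariance of the determinants
  (lemma \<open>centered_det_covariance\<close>); the last term is the product of the means.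
\<close>
definition cov_series :: "real \<Rightarrow> nat \<Rightarrow> real \<Rightarrow> real \<Rightarrow> real" where
  "cov_series c N x y = (\<Sum>j\<le>N div 2. c ^ j / fact j * hermite_kernel (N - 2 * j) x y)
     - poly (hermite N) x * poly (hermite N) y / fact N"

lemma cov_series_wkernel:
  "cov_series c N x y * exp (- (x\<^sup>2 + y\<^sup>2) / 4)
   = (\<Sum>j\<le>N div 2. c ^ j / fact j * wkernel (N - 2 * j) x y) - psi N x * psi N y / fact N"
proof -
  have e: "exp (- (x\<^sup>2 + y\<^sup>2) / 4) = exp (- x\<^sup>2 / 4) * exp (- y\<^sup>2 / 4)"
    by (simp add: exp_add[symmetric] add_divide_distrib)
  show ?thesis
    unfolding cov_series_def wkernel_eq left_diff_distrib sum_distrib_right psi_def e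
    by (simp add: mult_ac)
qed

text \<open>
  Dominated convergence for series (Tannery): by \<open>wkernel_le\<close> the \<open>j\<close>-th term is at most
  \<open>\<bar>c\<bar>\<^sup>j / j!\<close>, and each term converges by \<open>sine_kernel_limit_shifted\<close>.
\<close>
lemma cov_series_limit:
  fixes c :: real
  assumes \<xi>: "\<xi> \<in> {-2<..<2}"
  shows "(\<lambda>N. cov_series c N (bulk_point \<xi> \<mu> N) (bulk_point \<xi> \<nu> N)
        * exp (- ((bulk_point \<xi> \<mu> N)\<^sup>2 + (bulk_point \<xi> \<nu> N)\<^sup>2) / 4)
      / sqrt (wkernel N (bulk_point \<xi> \<mu> N) (bulk_point \<xi> \<mu> N) * wkernel N (bulk_point \<xi> \<nu> N) (bulk_point \<xi> \<nu> N)))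
    \<longlonglongrightarrow> exp c * sinc (pi * (\<mu> - \<nu>))"
proof -
  define d where "d N = sqrt (wkernel N (bulk_point \<xi> \<mu> N) (bulk_point \<xi> \<mu> N) * wkernel N (bulk_point \<xi> \<nu> N) (bulk_point \<xi> \<nu> N))" for N
  have d: "d N > 0" for N by (simp add: d_def wkernel_diag_pos)
  define a where "a j N = (if j \<le> N div 2 then c ^ j / fact j
    * (wkernel (N - 2 * j) (bulk_point \<xi> \<mu> N) (bulk_point \<xi> \<nu> N) / d N) else 0)" for j N
  have lim: "(\<lambda>N. a j N) \<longlonglongrightarrow> c ^ j / fact j * sinc (pi * (\<mu> - \<nu>))" for j
  proof (rule Lim_transform_eventually)
    show "(\<lambda>N. c ^ j / fact j * (wkernel (N - 2 * j) (bulk_point \<xi> \<mu> N) (bulk_point \<xi> \<nu> N) / d N))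
        \<longlonglongrightarrow> c ^ j / fact j * sinc (pi * (\<mu> - \<nu>))"
      unfolding d_def by (intro tendsto_mult tendsto_const sine_kernel_limit_shifted \<xi>)
    show "\<forall>\<^sub>F N in sequentially. c ^ j / fact j * (wkernel (N - 2 * j) (bulk_point \<xi> \<mu> N) (bulk_point \<xi> \<nu> N) / d N) = a j N"
      using eventually_ge_at_top[of "2 * j"] by eventually_elim (simp add: a_def)
  qed
  have bound: "norm (a j N) \<le> \<bar>c\<bar> ^ j / fact j" for j N
  proof -
    have "\<bar>wkernel (N - 2 * j) (bulk_point \<xi> \<mu> N) (bulk_point \<xi> \<nu> N) / d N\<bar> \<le> 1"
      using wkernel_le[of "N - 2 * j" N "bulk_point \<xi> \<mu> N" "bulk_point \<xi> \<nu> N"] d[of N]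
      unfolding d_def by (simp add: divide_le_eq)
    from mult_left_mono[OF this, of "\<bar>c\<bar> ^ j / fact j"]
    show ?thesis by (simp add: a_def abs_mult power_abs)
  qed
  have sums: "(\<lambda>j. x ^ j / fact j) sums exp x" for x :: real
    using exp_converges[of x] by (simp add: field_simps)
  have "(\<lambda>N. \<Sum>j. a j N) \<longlonglongrightarrow> (\<Sum>j. c ^ j / fact j * sinc (pi * (\<mu> - \<nu>)))"
    using tannerys_theorem[of a, OF lim, of "\<lambda>j. \<bar>c\<bar> ^ j / fact j"] bound sums_summable[OF sums]
    by (simp add: case_prod_unfold)
  also have "(\<Sum>j. c ^ j / fact j * sinc (pi * (\<mu> - \<nu>))) = exp c * sinc (pi * (\<mu> - \<nu>))"
    using sums_mult2[OF sums] by (simp only: sums_iff)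
  also have "(\<lambda>N. \<Sum>j. a j N) = (\<lambda>N. \<Sum>j\<le>N div 2. c ^ j / fact j * wkernel (N - 2 * j) (bulk_point \<xi> \<mu> N) (bulk_point \<xi> \<nu> N) / d N)"
  proof
    fix N
    show "(\<Sum>j. a j N) = (\<Sum>j\<le>N div 2. c ^ j / fact j * wkernel (N - 2 * j) (bulk_point \<xi> \<mu> N) (bulk_point \<xi> \<nu> N) / d N)"
      by (subst suminf_finite[of "{..N div 2}"]) (auto simp: a_def)
  qed
  finally have "(\<lambda>N. (\<Sum>j\<le>N div 2. c ^ j / fact j * wkernel (N - 2 * j) (bulk_point \<xi> \<mu> N) (bulk_point \<xi> \<nu> N) / d N)
      - psi (N - 0) (bulk_point \<xi> \<mu> N) * psi (N - 0) (bulk_point \<xi> \<nu> N) / fact (N - 0) / d N)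
      \<longlonglongrightarrow> exp c * sinc (pi * (\<mu> - \<nu>)) - 0"
    unfolding d_def by (intro tendsto_diff psi_prod_div_wkernel_tendsto \<xi>)
  thus ?thesis unfolding cov_series_wkernel d_def[symmetric]
    by (simp add: diff_divide_distrib sum_divide_distrib)
qed

lemma cov_series_correlation_limit:
  fixes c :: real
  assumes \<xi>: "\<xi> \<in> {-2<..<2}"
  shows "(\<lambda>N. cov_series c N (bulk_point \<xi> \<mu> N) (bulk_point \<xi> \<nu> N)
      / (sqrt (cov_series c N (bulk_point \<xi> \<mu> N) (bulk_point \<xi> \<mu> N))
         * sqrt (cov_series c N (bulk_point \<xi> \<nu> N) (bulk_point \<xi> \<nu> N)))) \<longlonglongrightarrow> sinc (pi * (\<mu> - \<nu>))"
proof -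
  define R where "R \<mu> \<nu> N = cov_series c N (bulk_point \<xi> \<mu> N) (bulk_point \<xi> \<nu> N)
        * exp (- ((bulk_point \<xi> \<mu> N)\<^sup>2 + (bulk_point \<xi> \<nu> N)\<^sup>2) / 4)
      / sqrt (wkernel N (bulk_point \<xi> \<mu> N) (bulk_point \<xi> \<mu> N) * wkernel N (bulk_point \<xi> \<nu> N) (bulk_point \<xi> \<nu> N))" for \<mu> \<nu> N
  note R = cov_series_limit[OF \<xi>, of c, folded R_def]
  have "(\<lambda>N. R \<mu> \<nu> N / (sqrt (R \<mu> \<mu> N) * sqrt (R \<nu> \<nu> N)))
      \<longlonglongrightarrow> exp c * sinc (pi * (\<mu> - \<nu>)) / (sqrt (exp c * sinc (pi * (\<mu> - \<mu>))) * sqrt (exp c * sinc (pi * (\<nu> - \<nu>))))"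
    by (intro tendsto_divide tendsto_mult tendsto_real_sqrt R) simp
  also have "exp c * sinc (pi * (\<mu> - \<nu>)) / (sqrt (exp c * sinc (pi * (\<mu> - \<mu>))) * sqrt (exp c * sinc (pi * (\<nu> - \<nu>)))) = sinc (pi * (\<mu> - \<nu>))"
    by (simp flip: real_sqrt_mult)
  also have "(\<lambda>N. R \<mu> \<nu> N / (sqrt (R \<mu> \<mu> N) * sqrt (R \<nu> \<nu> N))) = (\<lambda>N. cov_series c N (bulk_point \<xi> \<mu> N) (bulk_point \<xi> \<nu> N)
      / (sqrt (cov_series c N (bulk_point \<xi> \<mu> N) (bulk_point \<xi> \<mu> N))
         * sqrt (cov_series c N (bulk_point \<xi> \<nu> N) (bulk_point \<xi> \<nu> N))))"
  proof
    fix N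
    let ?x = "bulk_point \<xi> \<mu> N" and ?y = "bulk_point \<xi> \<nu> N"
    define e where "e z = exp (- z\<^sup>2 / 4)" for z :: real
    have e: "e z > 0" for z by (simp add: e_def)
    have ee: "exp (- (z\<^sup>2 + w\<^sup>2) / 4) = e z * e w" for z w
      by (simp add: e_def exp_add[symmetric] add_divide_distrib)
    have s: "sqrt (p * (u * u) / sqrt (k * k)) = sqrt p * u / sqrt k" if "u > 0" "k > 0" for p u k :: real
      using that by (simp add: real_sqrt_mult real_sqrt_divide)
    have g: "p * (u * v) / (sqrt k * sqrt k') / ((q * u / sqrt k) * (q' * v / sqrt k')) = p / (q * q')"
      if "u > 0" "v > 0" "k > 0" "k' > 0" for p u v k k' q q' :: real
      using that by simp
    show "R \<mu> \<nu> N / (sqrt (R \<mu> \<mu> N) * sqrt (R \<nu> \<nu> N)) = cov_series c N ?x ?y / (sqrt (cov_series c N ?x ?x) * sqrt (cov_series c N ?y ?y))"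
      unfolding R_def ee s[OF e wkernel_diag_pos] real_sqrt_mult[of "wkernel N ?x ?x" "wkernel N ?y ?y"]
      by (rule g[OF e e wkernel_diag_pos wkernel_diag_pos])
  qed
  finally show ?thesis .
qed

section \<open>Determinant identities\<close>

text \<open>
  Laplace expansion along the last row and then along the last column. The sign is negative because
  an expansion at \<open>(n, j)\<close> and then at \<open>(i, n - 1)\<close> has total parity \<open>i + j + 1\<close>.
\<close>
lemma det_bordered:
  fixes A :: "'a::comm_ring_1 mat"
  assumes A: "A \<in> carrier_mat (Suc n) (Suc n)"
  defines "B \<equiv> mat_delete A n n"
  shows "Determinant.det A = A $$ (n, n) * Determinant.det B
     - (\<Sum>i<n. \<Sum>j<n. A $$ (i, n) * A $$ (n, j) * cofactor B i j)"
proof -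
  have row: "A $$ (n, j) * cofactor A n j = - (\<Sum>i<n. A $$ (i, n) * A $$ (n, j) * cofactor B i j)" if j: "j < n" for j
  proof -
    let ?C = "mat_delete A n j"
    have C: "?C \<in> carrier_mat n n" using mat_delete_carrier[OF A, of n j] by simp
    have n: "n - 1 < n" "Suc (n - 1) = n" using j by auto
    have "Determinant.det ?C = (\<Sum>i<n. ?C $$ (i, n - 1) * cofactor ?C i (n - 1))"
      by (rule laplace_expansion_column[OF C n(1)])
    also have "\<dots> = (\<Sum>i<n. A $$ (i, n) * ((-1) ^ (i + (n - 1)) * Determinant.det (mat_delete B i j)))"
    proof (rule sum.cong[OF refl])
      fix i assume "i \<in> {..<n}"
      hence i: "i < n" by simp
      have "?C $$ (i, n - 1) = A $$ (i, n)"
        using i j n A unfolding mat_delete_def by auto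
      moreover have "mat_delete ?C i (n - 1) = mat_delete B i j"
        using A i j by (intro eq_matI) (auto simp: mat_delete_def B_def)
      ultimately show "?C $$ (i, n - 1) * cofactor ?C i (n - 1)
          = A $$ (i, n) * ((-1) ^ (i + (n - 1)) * Determinant.det (mat_delete B i j))"
        by (simp add: cofactor_def)
    qed
    finally have "A $$ (n, j) * cofactor A n j
        = (\<Sum>i<n. A $$ (i, n) * A $$ (n, j) * (((-1) ^ (n + j) * (-1) ^ (i + (n - 1))) * Determinant.det (mat_delete B i j)))"
      unfolding cofactor_def[of A] by (simp add: sum_distrib_left mult_ac)
    moreover have sign: "(-1) ^ (n + j) * (-1) ^ (i + (n - 1)) = - ((-1) ^ (i + j) :: 'a)" for i
    proof -
      obtain m where "n = Suc m" using n by metis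
      thus ?thesis by (simp add: power_add mult_ac)
    qed
    ultimately show ?thesis unfolding sign cofactor_def[of B] by (simp add: sum_negf)
  qed
  have "Determinant.det A = (\<Sum>j<Suc n. A $$ (n, j) * cofactor A n j)"
    by (rule laplace_expansion_row[OF A]) simp
  also have "\<dots> = A $$ (n, n) * Determinant.det B + (\<Sum>j<n. A $$ (n, j) * cofactor A n j)"
    by (simp add: cofactor_def B_def power_add[symmetric] mult_2[symmetric])
  also have "(\<Sum>j<n. A $$ (n, j) * cofactor A n j) = - (\<Sum>i<n. \<Sum>j<n. A $$ (i, n) * A $$ (n, j) * cofactor B i j)"
    by (subst sum.swap) (simp add: row sum_negf)
  finally show ?thesis by simp
qed

text \<open>
  Working with \<open>x I - X\<close> instead of \<open>X - x I\<close> makes the determinant the characteristic polynomial; the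
  two differ by the sign \<open>(-1)\<^sup>N\<close>, which drops out of second moments.
\<close>
definition charmat :: "'a::comm_ring_1 mat \<Rightarrow> 'a \<Rightarrow> 'a mat" where
  "charmat X x = x \<cdot>\<^sub>m 1\<^sub>m (dim_row X) - X"

lemma charmat_carrier [simp, intro]: "X \<in> carrier_mat n n \<Longrightarrow> charmat X x \<in> carrier_mat n n"
  by (auto simp: charmat_def)

lemma charmat_index: "X \<in> carrier_mat n n \<Longrightarrow> i < n \<Longrightarrow> j < n \<Longrightarrow>
    charmat X x $$ (i, j) = (if i = j then x else 0) - X $$ (i, j)"
  by (auto simp: charmat_def)

lemma det_charmat: "X \<in> carrier_mat n n \<Longrightarrow> Determinant.det (charmat X x) = poly (char_poly X) x"
  unfolding char_poly_def
  by (rule poly_det_cong[symmetric]) (auto simp: char_poly_matrix_def charmat_index)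

lemma cofactor_diag_charmat:
  assumes X: "X \<in> carrier_mat n n" and i: "i < n"
  shows "cofactor (charmat X x) i i = poly (char_poly (mat_delete X i i)) x"
proof -
  have "mat_delete (charmat X x) i i = charmat (mat_delete X i i) x"
    using X i by (intro eq_matI) (auto simp: mat_delete_def charmat_def)
  thus ?thesis using det_charmat[OF mat_delete_carrier[OF X], of i i x]
    by (simp add: cofactor_def power_add[symmetric] mult_2[symmetric])
qed

lemma trace_cofactor_charmat:
  fixes X :: "'a::idom mat"
  assumes X: "X \<in> carrier_mat n n"
  shows "(\<Sum>i<n. cofactor (charmat X x) i i) = poly (pderiv (char_poly X)) x"
  unfolding pderiv_char_poly[OF X] poly_sum
  by (intro sum.cong refl) (simp add: cofactor_diag_charmat[OF X])

text \<open>
  The resolvent identity without inverses: with \<open>U\<close> and \<open>V\<close> the adjugates of \<open>A = x I - X\<close> and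
  \<open>B = y I - X\<close>, the matrix \<open>U A V\<close> equals \<open>det A\<close> times \<open>V\<close>, and replacing \<open>A\<close> by \<open>B + (x - y) I\<close> it
  also equals \<open>det B\<close> times \<open>U\<close> plus \<open>(x - y) U V\<close>. Take traces.
\<close>
lemma trace_adj_charmat:
  fixes X :: "'a::idom mat"
  assumes X: "X \<in> carrier_mat n n"
  shows "(x - y) * (\<Sum>i<n. \<Sum>j<n. cofactor (charmat X x) i j * cofactor (charmat X y) j i) =
     poly (char_poly X) x * poly (pderiv (char_poly X)) y - poly (char_poly X) y * poly (pderiv (char_poly X)) x"
proof -
  let ?A = "charmat X x" and ?B = "charmat X y"
  define U V where "U = adj_mat ?A" and "V = adj_mat ?B"
  have A: "?A \<in> carrier_mat n n" and B: "?B \<in> carrier_mat n n" using X by auto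
  note U = adj_mat[OF A, folded U_def] and V = adj_mat[OF B, folded V_def]
  have AB: "?A = ?B + (x - y) \<cdot>\<^sub>m 1\<^sub>m n"
    using X carrier_matD[OF A] carrier_matD[OF B] by (intro eq_matI) (auto simp: charmat_index)
  have "U * (?A * V) = Determinant.det ?A \<cdot>\<^sub>m V"
    using U V A by (subst assoc_mult_mat[symmetric, of _ n n _ n _ n]) auto
  moreover have "U * (?A * V) = Determinant.det ?B \<cdot>\<^sub>m U + (x - y) \<cdot>\<^sub>m (U * V)"
  proof -
    have "?A * V = ?B * V + (x - y) \<cdot>\<^sub>m V"
      unfolding AB using V(1) B by (subst add_mult_distrib_mat[of _ n n _ _ n]) auto
    also have "\<dots> = Determinant.det ?B \<cdot>\<^sub>m 1\<^sub>m n + (x - y) \<cdot>\<^sub>m V" unfolding V(2) ..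
    finally show ?thesis using U(1) V(1)
      by (simp add: mult_add_distrib_mat[of _ n n _ n] mult_smult_distrib[of _ n n _ n])
  qed
  ultimately have eq: "Determinant.det ?A \<cdot>\<^sub>m V = Determinant.det ?B \<cdot>\<^sub>m U + (x - y) \<cdot>\<^sub>m (U * V)" by simp
  have "Determinant.det ?A * V $$ (i, i) = Determinant.det ?B * U $$ (i, i) + (x - y) * (\<Sum>j<n. U $$ (i, j) * V $$ (j, i))"
    if "i < n" for i
    using arg_cong[OF eq, of "\<lambda>M. M $$ (i, i)"] that U(1) V(1)
    by (simp add: scalar_prod_def atLeast0LessThan)
  hence "Determinant.det ?A * (\<Sum>i<n. V $$ (i, i)) = Determinant.det ?B * (\<Sum>i<n. U $$ (i, i))
      + (x - y) * (\<Sum>i<n. \<Sum>j<n. U $$ (i, j) * V $$ (j, i))"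
    by (simp add: sum_distrib_left sum.distrib[symmetric])
  moreover have "U $$ (i, j) = cofactor ?A j i" "V $$ (i, j) = cofactor ?B j i" if "i < n" "j < n" for i j
    using that A B unfolding U_def V_def adj_mat_def by auto
  hence "(\<Sum>i<n. V $$ (i, i)) = (\<Sum>i<n. cofactor ?B i i)" "(\<Sum>i<n. U $$ (i, i)) = (\<Sum>i<n. cofactor ?A i i)"
    "(\<Sum>i<n. \<Sum>j<n. U $$ (i, j) * V $$ (j, i)) = (\<Sum>i<n. \<Sum>j<n. cofactor ?A j i * cofactor ?B i j)"
    by simp_all
  ultimately show ?thesis
    unfolding det_charmat[OF X] trace_cofactor_charmat[OF X]
    by (subst sum.swap) (simp add: algebra_simps)
qed

section \<open>Exact numerical differentiation\<close>

text \<open>The nodes are \<open>1, \<dots>, n + 1\<close>, so that interpolation at 0 only uses other points.\<close>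
definition lagrange_basis :: "nat \<Rightarrow> nat \<Rightarrow> 'a::field_char_0 poly" where
  "lagrange_basis n m = (\<Prod>k\<in>{..n} - {m}.
     Polynomial.smult (1 / (of_nat (Suc m) - of_nat (Suc k))) [:- of_nat (Suc k), 1:])"

lemma lagrange_interpolation:
  fixes p :: "'a::field_char_0 poly"
  assumes "degree p \<le> n"
  shows "p = (\<Sum>m\<le>n. Polynomial.smult (poly p (of_nat (Suc m))) (lagrange_basis n m))"
proof (rule poly_eqI_degree)
  let ?A = "(\<lambda>m. of_nat (Suc m) :: 'a) ` {..n}"
  have card: "card ?A = Suc n"
    by (subst card_image) (auto simp: inj_on_def)
  show "card ?A > degree p" using assms card by simp
  have deg: "degree (lagrange_basis n m :: 'a poly) \<le> n" if "m \<le> n" for m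
  proof -
    have "degree (lagrange_basis n m :: 'a poly) \<le> (\<Sum>k\<in>{..n} - {m}.
        degree (Polynomial.smult (1 / (of_nat (Suc m) - of_nat (Suc k))) [:- of_nat (Suc k), 1 :: 'a:]))"
      unfolding lagrange_basis_def by (rule degree_prod_sum_le[unfolded o_def]) simp
    also have "\<dots> \<le> (\<Sum>k\<in>{..n} - {m}. 1)" by (intro sum_mono) simp
    also have "\<dots> = n" using that by simp
    finally show ?thesis .
  qed
  have "degree (\<Sum>m\<le>n. Polynomial.smult (poly p (of_nat (Suc m))) (lagrange_basis n m)) \<le> n"
    by (intro degree_sum_le) (auto intro: order_trans[OF degree_smult_le] deg)
  thus "card ?A > degree (\<Sum>m\<le>n. Polynomial.smult (poly p (of_nat (Suc m))) (lagrange_basis n m))"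
    using card by simp
  fix x assume "x \<in> ?A"
  then obtain l where l: "l \<le> n" "x = of_nat (Suc l)" by auto
  have basis: "poly (lagrange_basis n m) (of_nat (Suc l) :: 'a) = (if m = l then 1 else 0)" if "m \<le> n" for m
  proof (cases "m = l")
    case True
    have "poly (Polynomial.smult (1 / (a - b)) [:- b, 1:]) a = 1" if "a \<noteq> b" for a b :: 'a
    proof -
      have *: "poly (Polynomial.smult e [:- b, 1:]) a = e * (a - b)" for e :: 'a
        by (simp add: algebra_simps)
      show ?thesis unfolding * using that by simp
    qed
    thus ?thesis using True unfolding lagrange_basis_def poly_prod
      by (auto intro!: prod.neutral simp del: of_nat_Suc poly_smult poly_pCons)
  next
    case False
    have "poly (Polynomial.smult e [:- b, 1:]) b = 0" for e b :: 'a by simp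
    hence "\<exists>k\<in>{..n} - {m}. poly (Polynomial.smult (1 / (of_nat (Suc m) - of_nat (Suc k)))
        [:- of_nat (Suc k), 1:]) (of_nat (Suc l) :: 'a) = 0"
      using False l(1) by (blast intro: bexI[of _ l])
    thus ?thesis using False unfolding lagrange_basis_def poly_prod
      by (simp add: prod_zero del: of_nat_Suc poly_smult poly_pCons)
  qed
  show "poly p x = poly (\<Sum>m\<le>n. Polynomial.smult (poly p (of_nat (Suc m))) (lagrange_basis n m)) x"
    unfolding l(2) poly_sum poly_smult using l(1)
    by (simp add: basis if_distrib cong: if_cong del: of_nat_Suc)
qed

text \<open>
  Weights that express the value and the derivative of every polynomial of degree at most \<open>n\<close> at \<open>x\<close>
  through its values at \<open>x + 1, \<dots>, x + n + 1\<close>. They let derivatives with respect to \<open>x\<close> and limits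
  \<open>y \<rightarrow> x\<close> pass through an expectation by linearity alone.
\<close>
lemma lagrange_interpolation_shifted:
  fixes p :: "'a::field_char_0 poly"
  assumes "degree p \<le> n"
  shows "poly p x = (\<Sum>m\<le>n. poly (lagrange_basis n m) 0 * poly p (x + of_nat (Suc m)))"
    and "poly (pderiv p) x = (\<Sum>m\<le>n. poly (pderiv (lagrange_basis n m)) 0 * poly p (x + of_nat (Suc m)))"
proof -
  let ?q = "pcompose p [:x, 1:]"
  have q: "?q = (\<Sum>m\<le>n. Polynomial.smult (poly p (x + of_nat (Suc m))) (lagrange_basis n m))"
    using lagrange_interpolation[of ?q n] assms by (simp add: poly_pcompose)
  have "poly ?q 0 = (\<Sum>m\<le>n. poly (lagrange_basis n m) 0 * poly p (x + of_nat (Suc m)))"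
    unfolding q by (simp add: poly_sum mult_ac)
  thus "poly p x = (\<Sum>m\<le>n. poly (lagrange_basis n m) 0 * poly p (x + of_nat (Suc m)))"
    by (simp add: poly_pcompose)
  have "poly (pderiv ?q) 0 = (\<Sum>m\<le>n. poly (pderiv (lagrange_basis n m)) 0 * poly p (x + of_nat (Suc m)))"
    unfolding q by (simp add: poly_sum pderiv_sum pderiv_smult mult_ac)
  thus "poly (pderiv p) x = (\<Sum>m\<le>n. poly (pderiv (lagrange_basis n m)) 0 * poly p (x + of_nat (Suc m)))"
    by (simp add: pderiv_pcompose poly_pcompose pderiv_pCons)
qed

section \<open>The recursion solved by the Hermite kernels\<close>

text \<open>
  With \<open>hermite\<close> or its derivatives as \<open>f\<close> and \<open>g\<close> these are the kernel and its partial derivatives.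
\<close>
definition kernel_of :: "(nat \<Rightarrow> 'a poly) \<Rightarrow> (nat \<Rightarrow> 'a poly) \<Rightarrow> nat \<Rightarrow> 'a \<Rightarrow> 'a \<Rightarrow> 'a::real_normed_field" where
  "kernel_of f g n x y = (\<Sum>k\<le>n. poly (f k) x * poly (g k) y / fact k)"

abbreviation "dhermite n \<equiv> pderiv (hermite n)"

text \<open>
  Apart from the kernel itself and the divided difference, the terms combine to \<open>(x - \<partial>\<^sub>x)(y - \<partial>\<^sub>y)\<close>, which sends the \<open>k\<close>-th term
  of the kernel to \<open>k + 1\<close> times the next one. By Christoffel-Darboux the divided difference is the
  sum of the kernels of smaller degree. Together every term of the kernel of degree \<open>n + 1\<close> occurs
  \<open>n + 1\<close> times.
\<close>
lemma hermite_kernel_recursion: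
  fixes x y :: "'a::real_normed_field"
  assumes "x \<noteq> y"
  shows "of_nat (Suc n) * hermite_kernel (Suc n) x y =
     (1 + x * y) * hermite_kernel n x y - x * kernel_of hermite dhermite n x y
     - y * kernel_of dhermite hermite n x y + kernel_of dhermite dhermite n x y
     + (kernel_of hermite dhermite n x y - kernel_of dhermite hermite n x y) / (x - y)"
proof -
  let ?h = "\<lambda>k. poly (hermite k :: 'a poly)" and ?d = "\<lambda>k. poly (dhermite k :: 'a poly)"
  define p where "p k = ?h k x * ?h k y / fact k" for k
  have T: "(\<Sum>l\<le>n. hermite_kernel l x y) + (\<Sum>k\<le>n. of_nat (Suc k) * p (Suc k))
      = of_nat (Suc n) * hermite_kernel (Suc n) x y" for n
  proof (induction n)
    case (Suc n)
    have "hermite_kernel (Suc (Suc n)) x y = hermite_kernel (Suc n) x y + p (Suc (Suc n))"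
      by (simp only: hermite_kernel_def p_def sum.atMost_Suc)
    with Suc show ?case by (simp add: algebra_simps)
  qed (simp add: hermite_kernel_def p_def)
  have "kernel_of hermite dhermite n x y - kernel_of dhermite hermite n x y = (x - y) * (\<Sum>l<n. hermite_kernel l x y)"
  proof (induction n)
    case (Suc n)
    have "?h (Suc n) x * ?d (Suc n) y / fact (Suc n) - ?d (Suc n) x * ?h (Suc n) y / fact (Suc n)
        = (x - y) * hermite_kernel n x y"
      unfolding christoffel_darboux poly_pderiv_hermite_Suc fact_Suc of_nat_mult of_nat_fact
      by (simp add: field_simps del: hermite.simps of_nat_Suc)
    with Suc show ?case unfolding kernel_of_def
      by (simp only: sum.atMost_Suc sum.lessThan_Suc distrib_left add_diff_add)
  qed (simp add: kernel_of_def pderiv_1)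
  hence 1: "(kernel_of hermite dhermite n x y - kernel_of dhermite hermite n x y) / (x - y) = (\<Sum>l<n. hermite_kernel l x y)"
    using assms by simp
  have 2: "(1 + x * y) * hermite_kernel n x y - x * kernel_of hermite dhermite n x y
     - y * kernel_of dhermite hermite n x y + kernel_of dhermite dhermite n x y
     = hermite_kernel n x y + (\<Sum>k\<le>n. of_nat (Suc k) * p (Suc k))"
  proof -
    have "of_nat (Suc k) * p (Suc k) = x * y * (?h k x * ?h k y / fact k) - x * (?h k x * ?d k y / fact k)
        - y * (?d k x * ?h k y / fact k) + ?d k x * ?d k y / fact k" for k
    proof -
      have "of_nat (Suc k) * p (Suc k) = ?h (Suc k) x * ?h (Suc k) y / fact k"
        unfolding p_def fact_Suc of_nat_mult of_nat_fact by (simp del: hermite.simps of_nat_Suc)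
      also have "\<dots> = (x * ?h k x - ?d k x) * (y * ?h k y - ?d k y) / fact k"
        unfolding poly_hermite_Suc ..
      finally show ?thesis by (simp add: algebra_simps diff_divide_distrib add_divide_distrib del: of_nat_Suc)
    qed
    thus ?thesis unfolding hermite_kernel_def kernel_of_def
      by (simp only: sum.distrib sum_subtractf sum_distrib_left[symmetric]) (simp add: algebra_simps)
  qed
  show ?thesis unfolding 1 2 T[symmetric]
    by (simp add: lessThan_Suc_atMost[symmetric])
qed

text \<open>
  The coefficient of \<open>t\<^sup>N\<close> in \<open>exp(c t\<^sup>2) (\<Sum>n. \<phi>\<^sub>n t\<^sup>n)\<close>. The factor \<open>exp(c t\<^sup>2)\<close> carries the whole
  dependence on the fourth moment.
\<close>
definition quartic_series :: "'a::real_normed_field \<Rightarrow> (nat \<Rightarrow> 'a) \<Rightarrow> nat \<Rightarrow> 'a" where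
  "quartic_series c \<phi> N = (\<Sum>j\<le>N div 2. c ^ j / fact j * \<phi> (N - 2 * j))"

text \<open>
  Compare the coefficients of \<open>t\<^sup>N\<close> in the derivative of the generating function: differentiating
  \<open>exp(c t\<^sup>2)\<close> multiplies the series by \<open>2 c t\<close>.
\<close>
lemma quartic_series_Suc:
  assumes "\<And>n. of_nat (Suc n) * \<phi> (Suc n) = \<psi> n"
  shows "of_nat (Suc N) * quartic_series c \<phi> (Suc N)
     = quartic_series c \<psi> N + (if N = 0 then 0 else 2 * c * quartic_series c \<phi> (N - 1))"
proof -
  let ?J = "{..Suc N div 2}"
  have "of_nat (Suc N) * quartic_series c \<phi> (Suc N)
      = (\<Sum>j\<in>?J. c ^ j / fact j * (of_nat (Suc N - 2 * j) * \<phi> (Suc N - 2 * j)))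
        + (\<Sum>j\<in>?J. of_nat (2 * j) * (c ^ j / fact j) * \<phi> (Suc N - 2 * j))"
    unfolding quartic_series_def sum_distrib_left sum.distrib[symmetric]
  proof (intro sum.cong refl)
    fix j assume "j \<in> ?J"
    hence "of_nat (Suc N) = of_nat (Suc N - 2 * j) + (of_nat (2 * j) :: 'a)"
      by (subst of_nat_add[symmetric]) simp
    thus "of_nat (Suc N) * (c ^ j / fact j * \<phi> (Suc N - 2 * j))
        = c ^ j / fact j * (of_nat (Suc N - 2 * j) * \<phi> (Suc N - 2 * j)) + of_nat (2 * j) * (c ^ j / fact j) * \<phi> (Suc N - 2 * j)"
      by (simp only: algebra_simps)
  qed
  also have "(\<Sum>j\<in>?J. c ^ j / fact j * (of_nat (Suc N - 2 * j) * \<phi> (Suc N - 2 * j)))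
      = (\<Sum>j\<in>{..N div 2}. c ^ j / fact j * (of_nat (Suc N - 2 * j) * \<phi> (Suc N - 2 * j)))"
  proof (intro sum.mono_neutral_right ballI)
    fix j assume "j \<in> ?J - {..N div 2}"
    hence "Suc N - 2 * j = 0" by auto
    thus "c ^ j / fact j * (of_nat (Suc N - 2 * j) * \<phi> (Suc N - 2 * j)) = 0" by simp
  qed auto
  also have "\<dots> = quartic_series c \<psi> N"
    unfolding quartic_series_def
  proof (intro sum.cong refl)
    fix j assume "j \<in> {..N div 2}"
    hence "Suc N - 2 * j = Suc (N - 2 * j)" by auto
    thus "c ^ j / fact j * (of_nat (Suc N - 2 * j) * \<phi> (Suc N - 2 * j)) = c ^ j / fact j * \<psi> (N - 2 * j)"
      by (simp only: assms)
  qed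
  also have "(\<Sum>j\<in>?J. of_nat (2 * j) * (c ^ j / fact j) * \<phi> (Suc N - 2 * j))
      = (if N = 0 then 0 else 2 * c * quartic_series c \<phi> (N - 1))"
  proof (cases "N = 0")
    case False
    hence J: "Suc N div 2 = Suc ((N - 1) div 2)" by (cases N) auto
    have "of_nat (2 * Suc j) * (c ^ Suc j / fact (Suc j)) * \<phi> (Suc N - 2 * Suc j)
        = 2 * c * (c ^ j / fact j * \<phi> (N - 1 - 2 * j))" for j
    proof -
      have "of_nat (Suc j) \<noteq> (0 :: 'a)" by (simp del: of_nat_Suc)
      hence "of_nat (2 * Suc j) * (c ^ Suc j / fact (Suc j)) = 2 * c * (c ^ j / fact j)"
        unfolding fact_Suc of_nat_mult by (simp del: of_nat_Suc)
      moreover have "Suc N - 2 * Suc j = N - 1 - 2 * j" by simp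
      ultimately show ?thesis by (simp only: mult.assoc)
    qed
    thus ?thesis using False unfolding quartic_series_def J sum_distrib_left
      by (subst sum.atMost_Suc_shift) (simp del: of_nat_Suc)
  qed simp
  finally show ?thesis .
qed

section \<open>Functions of finitely many coordinates\<close>

locale wigner_ensemble = prob_space M for M :: "'a measure" +
  fixes Q :: "real measure" and d :: "nat \<Rightarrow> 'a \<Rightarrow> real" and re im :: "nat \<Rightarrow> nat \<Rightarrow> 'a \<Rightarrow> real"
  assumes Q: "real_distribution Q"
    and Q4: "integrable Q (\<lambda>x. x ^ 4)"
    and Q_mean: "(\<integral>x. x \<partial>Q) = 0"
    and Q_var: "(\<integral>x. x\<^sup>2 \<partial>Q) = 1 / 2"
    and family: "wigner_family M Q d re im"
begin

abbreviation coord :: "wigner_index \<Rightarrow> 'a \<Rightarrow> real" where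
  "coord \<equiv> wigner_coord d re im"

lemma indep_coord: "indep_vars (\<lambda>_. borel) coord wigner_indices"
  and distr_coord: "k \<in> wigner_indices \<Longrightarrow> distr M borel (coord k) = Q"
  using family by (auto simp: wigner_family_def)

lemma coord_measurable [measurable]: "k \<in> wigner_indices \<Longrightarrow> coord k \<in> borel_measurable M"
  using indep_coord by (auto simp: indep_vars_def)

lemma Q_power_integrable:
  assumes "p \<le> 4" shows "integrable Q (\<lambda>x. x ^ p)"
proof -
  interpret Q: real_distribution Q by (rule Q)
  have le: "\<bar>x\<bar> ^ p \<le> 1 + x ^ 4" for x :: real
  proof (cases "\<bar>x\<bar> \<le> 1")
    case True
    have "\<bar>x\<bar> ^ p \<le> 1" using True by (intro power_le_one) auto
    moreover have "0 \<le> x ^ 4" by simp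
    ultimately show ?thesis by linarith
  next
    case False
    hence "\<bar>x\<bar> ^ p \<le> \<bar>x\<bar> ^ 4" using assms by (intro power_increasing) auto
    thus ?thesis by simp
  qed
  show ?thesis
  proof (rule Bochner_Integration.integrable_bound)
    show "integrable Q (\<lambda>x. 1 + x ^ 4)" using Q4 by simp
    show "AE x in Q. norm (x ^ p) \<le> norm (1 + x ^ 4)"
    proof (rule AE_I2)
      fix x :: real
      show "norm (x ^ p) \<le> norm (1 + x ^ 4)"
        using le[of x] abs_ge_self[of "1 + x ^ 4"] unfolding real_norm_def power_abs by linarith
    qed
  qed simp
qed

lemma coord_moment:
  assumes "k \<in> wigner_indices"
  shows "p \<le> 4 \<Longrightarrow> integrable M (\<lambda>\<omega>. coord k \<omega> ^ p)"
    and "expectation (\<lambda>\<omega>. coord k \<omega> ^ p) = (\<integral>x. x ^ p \<partial>Q)"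
proof -
  assume "p \<le> 4"
  hence "integrable (distr M borel (coord k)) (\<lambda>x. x ^ p)"
    unfolding distr_coord[OF assms] by (rule Q_power_integrable)
  thus "integrable M (\<lambda>\<omega>. coord k \<omega> ^ p)"
    by (subst (asm) integrable_distr_eq) (use assms in auto)
next
  show "expectation (\<lambda>\<omega>. coord k \<omega> ^ p) = (\<integral>x. x ^ p \<partial>Q)"
    unfolding distr_coord[OF assms, symmetric] by (subst integral_distr) (use assms in auto)
qed

text \<open>
  Being a measurable function of the coordinates in \<open>S\<close>. Functions of disjoint sets of coordinates
  are independent, and the predicate is stable under the algebraic operations used to build minors.
\<close>
definition coord_fun :: "wigner_index set \<Rightarrow> ('a \<Rightarrow> 'b::real_normed_field) \<Rightarrow> bool" where
  "coord_fun S F \<longleftrightarrow> (\<exists>g \<in> borel_measurable (PiM S (\<lambda>_. borel)). \<forall>\<omega>. F \<omega> = g (\<lambda>k\<in>S. coord k \<omega>))"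

lemma coord_fun_const [intro, simp]: "coord_fun S (\<lambda>_. a)"
  unfolding coord_fun_def by (rule bexI[of _ "\<lambda>_. a"]) auto

lemma coord_fun_coord [intro]: "k \<in> S \<Longrightarrow> coord_fun S (coord k)"
  unfolding coord_fun_def by (rule bexI[of _ "\<lambda>f. f k"]) auto

lemma coord_fun_compose:
  assumes "coord_fun S F" "h \<in> borel_measurable borel"
  shows "coord_fun S (\<lambda>\<omega>. h (F \<omega>))"
proof -
  obtain g where g: "g \<in> borel_measurable (PiM S (\<lambda>_. borel))" "\<And>\<omega>. F \<omega> = g (\<lambda>k\<in>S. coord k \<omega>)"
    using assms(1) unfolding coord_fun_def by blast
  show ?thesis unfolding coord_fun_def
    by (rule bexI[of _ "\<lambda>f. h (g f)"]) (use g assms(2) in auto)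
qed

lemma coord_fun_compose2:
  assumes "coord_fun S F" "coord_fun S G" "(\<lambda>(u, v). h u v) \<in> borel_measurable (borel \<Otimes>\<^sub>M borel)"
  shows "coord_fun S (\<lambda>\<omega>. h (F \<omega>) (G \<omega>))"
proof -
  obtain f where f: "f \<in> borel_measurable (PiM S (\<lambda>_. borel))" "\<And>\<omega>. F \<omega> = f (\<lambda>k\<in>S. coord k \<omega>)"
    using assms(1) unfolding coord_fun_def by blast
  obtain g where g: "g \<in> borel_measurable (PiM S (\<lambda>_. borel))" "\<And>\<omega>. G \<omega> = g (\<lambda>k\<in>S. coord k \<omega>)"
    using assms(2) unfolding coord_fun_def by blast
  have "(\<lambda>z. (\<lambda>(u, v). h u v) (f z, g z)) \<in> borel_measurable (PiM S (\<lambda>_. borel))"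
    by (rule measurable_compose[OF _ assms(3)]) (use f g in auto)
  thus ?thesis unfolding coord_fun_def
    by (intro bexI[of _ "\<lambda>z. h (f z) (g z)"]) (use f g in auto)
qed

lemma coord_fun_add: 
  fixes F G :: "'a \<Rightarrow> 'b::{real_normed_field, second_countable_topology}"
  shows "coord_fun S F \<Longrightarrow> coord_fun S G \<Longrightarrow> coord_fun S (\<lambda>\<omega>. F \<omega> + G \<omega>)"
  and coord_fun_diff: "coord_fun S F \<Longrightarrow> coord_fun S G \<Longrightarrow> coord_fun S (\<lambda>\<omega>. F \<omega> - G \<omega>)"
  and coord_fun_mult: "coord_fun S F \<Longrightarrow> coord_fun S G \<Longrightarrow> coord_fun S (\<lambda>\<omega>. F \<omega> * G \<omega>)"
  by (erule (1) coord_fun_compose2; measurable)+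

lemma coord_fun_power:
  fixes F :: "'a \<Rightarrow> 'b::{real_normed_field, second_countable_topology}"
  shows "coord_fun S F \<Longrightarrow> coord_fun S (\<lambda>\<omega>. F \<omega> ^ p)"
  by (erule coord_fun_compose) measurable

lemma coord_fun_of_real: "coord_fun S F \<Longrightarrow> coord_fun S (\<lambda>\<omega>. complex_of_real (F \<omega>))"
  by (erule coord_fun_compose) measurable

lemma coord_fun_cnj: "coord_fun S F \<Longrightarrow> coord_fun S (\<lambda>\<omega>. cnj (F \<omega>))"
  by (erule coord_fun_compose) (intro borel_measurable_continuous_onI continuous_intros)

lemma coord_fun_prod:
  fixes F :: "'i \<Rightarrow> 'a \<Rightarrow> 'b::{real_normed_field, second_countable_topology}"
  shows "(\<And>i. i \<in> A \<Longrightarrow> coord_fun S (F i)) \<Longrightarrow> coord_fun S (\<lambda>\<omega>. \<Prod>i\<in>A. F i \<omega>)"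
  by (induction A rule: infinite_finite_induct) (auto intro: coord_fun_mult)

lemma coord_fun_mono:
  assumes "coord_fun S F" "S \<subseteq> T" shows "coord_fun T F"
proof -
  obtain f where f: "f \<in> borel_measurable (PiM S (\<lambda>_. borel))" "\<And>\<omega>. F \<omega> = f (\<lambda>k\<in>S. coord k \<omega>)"
    using assms(1) unfolding coord_fun_def by blast
  have "(\<lambda>z. f (restrict z S)) \<in> borel_measurable (PiM T (\<lambda>_. borel))"
    by (rule measurable_compose[OF measurable_restrict_subset[OF assms(2)] f(1)])
  moreover have "restrict (\<lambda>k\<in>T. coord k \<omega>) S = (\<lambda>k\<in>S. coord k \<omega>)" for \<omega>
    using assms(2) by (auto simp: restrict_def fun_eq_iff)
  ultimately show ?thesis unfolding coord_fun_def
    by (intro bexI[of _ "\<lambda>z. f (restrict z S)"]) (use f in auto)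
qed

lemma coord_fun_measurable:
  assumes "coord_fun S F" "S \<subseteq> wigner_indices" shows "F \<in> borel_measurable M"
proof -
  obtain f where f: "f \<in> borel_measurable (PiM S (\<lambda>_. borel))" "\<And>\<omega>. F \<omega> = f (\<lambda>k\<in>S. coord k \<omega>)"
    using assms(1) unfolding coord_fun_def by blast
  have "(\<lambda>\<omega>. \<lambda>k\<in>S. coord k \<omega>) \<in> measurable M (PiM S (\<lambda>_. borel))"
    using assms(2) by (intro measurable_restrict) auto
  from measurable_compose[OF this f(1)] show ?thesis by (simp add: f(2)[abs_def])
qed

lemma
  fixes F G :: "'a \<Rightarrow> 'b::{real_normed_field, banach, second_countable_topology}"
  assumes "coord_fun S F" "coord_fun T G" "S \<inter> T = {}" "S \<subseteq> wigner_indices" "T \<subseteq> wigner_indices"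
    and int: "integrable M F" "integrable M G"
  shows expectation_mult: "expectation (\<lambda>\<omega>. F \<omega> * G \<omega>) = expectation F * expectation G"
    and integrable_mult: "integrable M (\<lambda>\<omega>. F \<omega> * G \<omega>)"
proof -
  obtain f where f: "f \<in> borel_measurable (PiM S (\<lambda>_. borel))" "\<And>\<omega>. F \<omega> = f (\<lambda>k\<in>S. coord k \<omega>)"
    using assms(1) unfolding coord_fun_def by blast
  obtain g where g: "g \<in> borel_measurable (PiM T (\<lambda>_. borel))" "\<And>\<omega>. G \<omega> = g (\<lambda>k\<in>T. coord k \<omega>)"
    using assms(2) unfolding coord_fun_def by blast
  have "indep_var borel (f \<circ> (\<lambda>\<omega>. \<lambda>k\<in>S. coord k \<omega>)) borel (g \<circ> (\<lambda>\<omega>. \<lambda>k\<in>T. coord k \<omega>))"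
    by (rule indep_var_compose[OF indep_var_restrict[OF indep_coord assms(3-5)] f(1) g(1)])
  also have "f \<circ> (\<lambda>\<omega>. \<lambda>k\<in>S. coord k \<omega>) = F" by (simp add: fun_eq_iff f(2))
  also have "g \<circ> (\<lambda>\<omega>. \<lambda>k\<in>T. coord k \<omega>) = G" by (simp add: fun_eq_iff g(2))
  finally have ind: "indep_var borel F borel G" .
  show "expectation (\<lambda>\<omega>. F \<omega> * G \<omega>) = expectation F * expectation G"
    by (rule indep_var_lebesgue_integral[OF ind int])
  show "integrable M (\<lambda>\<omega>. F \<omega> * G \<omega>)"
    by (rule indep_var_integrable[OF ind int])
qed

end

section \<open>Moments of a column of the matrix\<close>

lemma prod4_le_sum_fourth_powers:
  fixes a b c e :: real
  shows "a * b * c * e \<le> a ^ 4 + b ^ 4 + c ^ 4 + e ^ 4"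
proof -
  have *: "u * v \<le> (u\<^sup>2 + v\<^sup>2) / 2" for u v :: real
    using sum_squares_bound[of u v] by (simp add: power2_eq_square)
  have "a * b * c * e \<le> ((a * b)\<^sup>2 + (c * e)\<^sup>2) / 2"
    using *[of "a * b" "c * e"] by (simp only: mult.assoc)
  also have "\<dots> \<le> ((a ^ 4 + b ^ 4) / 2 + (c ^ 4 + e ^ 4) / 2) / 2"
    using *[of "a\<^sup>2" "b\<^sup>2"] *[of "c\<^sup>2" "e\<^sup>2"]
    by (intro divide_right_mono add_mono) (simp_all add: power_mult_distrib flip: power_mult)
  also have "\<dots> \<le> a ^ 4 + b ^ 4 + c ^ 4 + e ^ 4"
    by (simp add: field_simps)
  finally show ?thesis .
qed

definition cell :: "nat \<Rightarrow> nat \<Rightarrow> wigner_index set" where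
  "cell i j = {RePart i j, ImPart i j}"

lemma cell_subset: "i < j \<Longrightarrow> cell i j \<subseteq> wigner_indices"
  by (auto simp: cell_def wigner_indices_def)

lemma Diag_index: "Diag i \<in> wigner_indices"
  by (auto simp: wigner_indices_def)

context wigner_ensemble
begin

abbreviation entry :: "nat \<Rightarrow> nat \<Rightarrow> 'a \<Rightarrow> complex" where
  "entry i j \<omega> \<equiv> wigner_entry d re im \<omega> i j"

definition mom :: "nat \<Rightarrow> real" where "mom p = (\<integral>x. x ^ p \<partial>Q)"

lemma mom_values: "mom 0 = 1" "mom (Suc 0) = 0" "mom 2 = 1 / 2"
proof -
  interpret Q: real_distribution Q by (rule Q)
  show "mom 0 = 1" using Q.prob_space by (simp add: mom_def)
  show "mom (Suc 0) = 0" "mom 2 = 1 / 2" using Q_mean Q_var by (simp_all add: mom_def)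
qed

lemma cell_moment:
  assumes "i < j"
  shows "p \<le> 4 \<Longrightarrow> q \<le> 4 \<Longrightarrow> integrable M (\<lambda>\<omega>. complex_of_real (re i j \<omega>) ^ p * of_real (im i j \<omega>) ^ q)" (is "_ \<Longrightarrow> _ \<Longrightarrow> ?int")
    and "p \<le> 4 \<Longrightarrow> q \<le> 4 \<Longrightarrow> expectation (\<lambda>\<omega>. complex_of_real (re i j \<omega>) ^ p * of_real (im i j \<omega>) ^ q) = of_real (mom p * mom q)"
proof -
  assume pq: "p \<le> 4" "q \<le> 4"
  have k: "RePart i j \<in> wigner_indices" "ImPart i j \<in> wigner_indices"
    using assms by (auto simp: wigner_indices_def)
  have c: "coord_fun {RePart i j} (\<lambda>\<omega>. re i j \<omega> ^ p)" "coord_fun {ImPart i j} (\<lambda>\<omega>. im i j \<omega> ^ q)"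
    using coord_fun_power[OF coord_fun_coord[of "RePart i j" "{RePart i j}"], of p]
      coord_fun_power[OF coord_fun_coord[of "ImPart i j" "{ImPart i j}"], of q] by simp_all
  have int: "integrable M (\<lambda>\<omega>. re i j \<omega> ^ p)" "integrable M (\<lambda>\<omega>. im i j \<omega> ^ q)"
    using coord_moment(1)[OF k(1) pq(1)] coord_moment(1)[OF k(2) pq(2)] by simp_all
  have eq: "(\<lambda>\<omega>. complex_of_real (re i j \<omega>) ^ p * of_real (im i j \<omega>) ^ q) = (\<lambda>\<omega>. of_real (re i j \<omega> ^ p * im i j \<omega> ^ q))"
    by simp
  show ?int unfolding eq
    by (intro integrable_of_real integrable_mult[OF c _ _ _ int]) (use k in auto)
  have "expectation (\<lambda>\<omega>. re i j \<omega> ^ p * im i j \<omega> ^ q) = mom p * mom q"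
    using expectation_mult[OF c _ _ _ int] k coord_moment(2)[OF k(1), of p] coord_moment(2)[OF k(2), of q]
    by (simp add: mom_def)
  thus "expectation (\<lambda>\<omega>. complex_of_real (re i j \<omega>) ^ p * of_real (im i j \<omega>) ^ q) = of_real (mom p * mom q)"
    unfolding eq by (subst integral_complex_of_real) simp
qed

lemma entry_upper: "i < j \<Longrightarrow> entry i j \<omega> = of_real (re i j \<omega>) + \<i> * of_real (im i j \<omega>)"
  by (simp add: wigner_entry_def)

lemma entry_lower: "i < j \<Longrightarrow> entry j i \<omega> = cnj (entry i j \<omega>)"
  by (simp add: wigner_entry_def)

lemma coord_fun_entry: "i < j \<Longrightarrow> cell i j \<subseteq> S \<Longrightarrow> coord_fun S (entry i j)"
proof -
  assume ij: "i < j" "cell i j \<subseteq> S"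
  have "entry i j = (\<lambda>\<omega>. of_real (coord (RePart i j) \<omega>) + \<i> * of_real (coord (ImPart i j) \<omega>))"
    using ij by (simp add: fun_eq_iff entry_upper)
  moreover have "coord_fun S (\<lambda>\<omega>. complex_of_real (coord (RePart i j) \<omega>) + \<i> * of_real (coord (ImPart i j) \<omega>))"
    using ij by (intro coord_fun_add coord_fun_mult coord_fun_const coord_fun_of_real coord_fun_coord) (auto simp: cell_def)
  ultimately show ?thesis by simp
qed

text \<open>
  The square of an entry has mean zero because its real and imaginary parts are independent, centred
  and of the same variance.
\<close>
lemma entry_moment:
  assumes ij: "i < j"
  shows "expectation (entry i j) = 0"
    and "expectation (\<lambda>\<omega>. entry i j \<omega> * entry i j \<omega>) = 0"
    and "expectation (\<lambda>\<omega>. entry i j \<omega> * cnj (entry i j \<omega>)) = 1"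
    and "expectation (\<lambda>\<omega>. entry i j \<omega> * cnj (entry i j \<omega>) * (entry i j \<omega> * cnj (entry i j \<omega>))) = of_real (2 * mom 4 + 1 / 2)"
proof -
  define m where "m p q \<omega> = complex_of_real (re i j \<omega>) ^ p * of_real (im i j \<omega>) ^ q" for p q \<omega>
  have int: "integrable M (m p q)" if "p \<le> 4" "q \<le> 4" for p q
    unfolding m_def using cell_moment(1)[OF ij that] .
  have E: "expectation (m p q) = of_real (mom p * mom q)" if "p \<le> 4" "q \<le> 4" for p q
    unfolding m_def using cell_moment(2)[OF ij that] .
  have "entry i j = (\<lambda>\<omega>. m 1 0 \<omega> + \<i> * m 0 1 \<omega>)"
    by (simp add: fun_eq_iff entry_upper[OF ij] m_def)
  thus "expectation (entry i j) = 0" by (simp add: int E mom_values)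
  have "(\<lambda>\<omega>. entry i j \<omega> * entry i j \<omega>) = (\<lambda>\<omega>. m 2 0 \<omega> - m 0 2 \<omega> + 2 * \<i> * m 1 1 \<omega>)"
    by (simp add: fun_eq_iff entry_upper[OF ij] m_def power2_eq_square algebra_simps)
  thus "expectation (\<lambda>\<omega>. entry i j \<omega> * entry i j \<omega>) = 0" by (simp add: int E mom_values)
  have "(\<lambda>\<omega>. entry i j \<omega> * cnj (entry i j \<omega>)) = (\<lambda>\<omega>. m 2 0 \<omega> + m 0 2 \<omega>)"
    by (simp add: fun_eq_iff entry_upper[OF ij] m_def power2_eq_square algebra_simps)
  thus "expectation (\<lambda>\<omega>. entry i j \<omega> * cnj (entry i j \<omega>)) = 1" by (simp add: int E mom_values)
  have "(\<lambda>\<omega>. entry i j \<omega> * cnj (entry i j \<omega>) * (entry i j \<omega> * cnj (entry i j \<omega>)))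
      = (\<lambda>\<omega>. m 4 0 \<omega> + 2 * m 2 2 \<omega> + m 0 4 \<omega>)"
    by (simp add: fun_eq_iff entry_upper[OF ij] m_def power2_eq_square power4_eq_xxxx algebra_simps)
  thus "expectation (\<lambda>\<omega>. entry i j \<omega> * cnj (entry i j \<omega>) * (entry i j \<omega> * cnj (entry i j \<omega>))) = of_real (2 * mom 4 + 1 / 2)"
    by (simp add: int E mom_values)
qed

lemma entry_fourth_integrable:
  assumes ij: "i < j" shows "integrable M (\<lambda>\<omega>. cmod (entry i j \<omega>) ^ 4)"
proof -
  define m where "m p q \<omega> = complex_of_real (re i j \<omega>) ^ p * of_real (im i j \<omega>) ^ q" for p q \<omega>
  have int: "integrable M (m p q)" if "p \<le> 4" "q \<le> 4" for p q
    unfolding m_def using cell_moment(1)[OF ij that] .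
  have "integrable M (\<lambda>\<omega>. Re (m 4 0 \<omega> + 2 * m 2 2 \<omega> + m 0 4 \<omega>))"
    by (intro integrable_Re Bochner_Integration.integrable_add integrable_mult_right int) auto
  moreover have "Re (m 4 0 \<omega> + 2 * m 2 2 \<omega> + m 0 4 \<omega>) = cmod (entry i j \<omega>) ^ 4" for \<omega>
  proof -
    have "cmod (entry i j \<omega>) ^ 4 = ((cmod (entry i j \<omega>))\<^sup>2)\<^sup>2" by simp
    also have "\<dots> = ((re i j \<omega>)\<^sup>2 + (im i j \<omega>)\<^sup>2)\<^sup>2"
      unfolding cmod_power2 entry_upper[OF ij] by simp
    finally show ?thesis by (simp add: m_def power2_sum algebra_simps flip: of_real_power of_real_mult)
  qed
  ultimately show ?thesis by simp
qed

lemma integrable_prod4: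
  fixes A B C D :: "'a \<Rightarrow> complex"
  assumes [measurable]: "A \<in> borel_measurable M" "B \<in> borel_measurable M" "C \<in> borel_measurable M" "D \<in> borel_measurable M"
    and "integrable M (\<lambda>\<omega>. cmod (A \<omega>) ^ 4)" "integrable M (\<lambda>\<omega>. cmod (B \<omega>) ^ 4)"
      "integrable M (\<lambda>\<omega>. cmod (C \<omega>) ^ 4)" "integrable M (\<lambda>\<omega>. cmod (D \<omega>) ^ 4)"
  shows "integrable M (\<lambda>\<omega>. A \<omega> * B \<omega> * C \<omega> * D \<omega>)"
proof (rule Bochner_Integration.integrable_bound)
  show "integrable M (\<lambda>\<omega>. cmod (A \<omega>) ^ 4 + cmod (B \<omega>) ^ 4 + cmod (C \<omega>) ^ 4 + cmod (D \<omega>) ^ 4)"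
    by (intro Bochner_Integration.integrable_add assms)
  show "AE \<omega> in M. norm (A \<omega> * B \<omega> * C \<omega> * D \<omega>) \<le> norm (cmod (A \<omega>) ^ 4 + cmod (B \<omega>) ^ 4 + cmod (C \<omega>) ^ 4 + cmod (D \<omega>) ^ 4)"
    using prod4_le_sum_fourth_powers by (intro AE_I2) (auto simp: norm_mult intro: order_trans[OF _ abs_ge_self])
qed measurable

text \<open>
  A Gaussian variable of variance \<open>1/2\<close> has fourth moment \<open>3/4\<close>; then the fourth absolute moment of an
  entry is 2, and in general it is \<open>2 + 2 * excess\<close>.
\<close>
definition excess :: real where "excess = mom 4 - 3 / 4"

text \<open>
  If one of the four indices differs from the three others, the mean of that entry factors out and is
  0. This leaves the three pairings and the case of four equal indices. The pairing of
  \<open>i\<close> with \<open>k\<close> vanishes because it contains the mean of a square of an entry.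
\<close>
lemma column_moment4:
  assumes "i < N" "j < N" "k < N" "l < N"
  shows "integrable M (\<lambda>\<omega>. entry i N \<omega> * cnj (entry j N \<omega>) * entry k N \<omega> * cnj (entry l N \<omega>))" (is ?int)
    and "expectation (\<lambda>\<omega>. entry i N \<omega> * cnj (entry j N \<omega>) * entry k N \<omega> * cnj (entry l N \<omega>)) =
       (if i = j \<and> k = l then 1 else 0) + (if i = l \<and> j = k then 1 else 0)
       + (if i = j \<and> j = k \<and> k = l then 2 * of_real excess else 0)" (is ?E)
    and "integrable M (\<lambda>\<omega>. entry i N \<omega> * cnj (entry j N \<omega>))" (is ?int2)
    and "expectation (\<lambda>\<omega>. entry i N \<omega> * cnj (entry j N \<omega>)) = (if i = j then 1 else 0)" (is ?E2)
proof -
  have meas [measurable]: "entry m N \<in> borel_measurable M" if "m < N" for m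
    by (rule coord_fun_measurable[OF coord_fun_entry[OF that order_refl] cell_subset[OF that]])
  have cmeas: "(\<lambda>\<omega>. cnj (entry m N \<omega>)) \<in> borel_measurable M" if "m < N" for m
    by (rule coord_fun_measurable[OF coord_fun_cnj[OF coord_fun_entry[OF that order_refl]] cell_subset[OF that]])
  define good where "good A m \<longleftrightarrow> m < N \<and> (A = entry m N \<or> A = (\<lambda>\<omega>. cnj (entry m N \<omega>)))" for A m
  have g4: "A \<in> borel_measurable M" "integrable M (\<lambda>\<omega>. cmod (A \<omega>) ^ 4)" if "good A m" for A m
    using that meas cmeas entry_fourth_integrable by (auto simp: good_def)
  have int4: "integrable M (\<lambda>\<omega>. A \<omega> * B \<omega> * C \<omega> * D \<omega>)" if "good A a" "good B b" "good C c" "good D e" for A B C D a b c e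
    using that g4 by (intro integrable_prod4) blast+
  have int3: "integrable M (\<lambda>\<omega>. A \<omega> * B \<omega> * C \<omega>)" if "good A a" "good B b" "good C c" for A B C a b c
    using integrable_prod4[of A B C "\<lambda>_. 1"] that g4 by simp
  have int2: "integrable M (\<lambda>\<omega>. A \<omega> * B \<omega>)" if "good A a" "good B b" for A B a b
    using integrable_prod4[of A B "\<lambda>_. 1" "\<lambda>_. 1"] that g4 by simp
  have int1: "integrable M A" if "good A a" for A a
    using integrable_prod4[of A "\<lambda>_. 1" "\<lambda>_. 1" "\<lambda>_. 1"] that g4 by simp
  have cf: "coord_fun S A" if "good A a" "cell a N \<subseteq> S" for A a S
    using that coord_fun_entry coord_fun_cnj by (auto simp: good_def)
  have E1: "expectation A = 0" if "good A a" for A a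
    using that entry_moment(1)[of a N] by (auto simp: good_def)
  have good: "good (entry m N) m" "good (\<lambda>\<omega>. cnj (entry m N \<omega>)) m" if "m < N" for m
    using that by (auto simp: good_def)
  have disj: "cell a N \<inter> cell b N = {}" if "a \<noteq> b" for a b using that by (auto simp: cell_def)
  have lone: "expectation (\<lambda>\<omega>. A \<omega> * (B \<omega> * C \<omega> * D \<omega>)) = 0"
    if "good A a" "good B b" "good C c" "good D e" "a \<noteq> b" "a \<noteq> c" "a \<noteq> e" for A B C D a b c e
  proof -
    have "expectation (\<lambda>\<omega>. A \<omega> * (B \<omega> * C \<omega> * D \<omega>)) = expectation A * expectation (\<lambda>\<omega>. B \<omega> * C \<omega> * D \<omega>)"
    proof (rule expectation_mult)
      show "coord_fun (cell a N) A" using that by (auto intro: cf)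
      show "coord_fun (cell b N \<union> cell c N \<union> cell e N) (\<lambda>\<omega>. B \<omega> * C \<omega> * D \<omega>)"
        using that by (intro coord_fun_mult cf) auto
      show "cell a N \<inter> (cell b N \<union> cell c N \<union> cell e N) = {}" using that disj by blast
      show "cell a N \<subseteq> wigner_indices" "cell b N \<union> cell c N \<union> cell e N \<subseteq> wigner_indices"
        using that cell_subset by (auto simp: good_def)
    qed (use that int1 int3 in blast)+
    thus ?thesis using E1 that by simp
  qed
  have pair: "expectation (\<lambda>\<omega>. (A \<omega> * B \<omega>) * (C \<omega> * D \<omega>)) = expectation (\<lambda>\<omega>. A \<omega> * B \<omega>) * expectation (\<lambda>\<omega>. C \<omega> * D \<omega>)"
    if "good A a" "good B a" "good C c" "good D c" "a \<noteq> c" for A B C D a c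
  proof (rule expectation_mult)
    show "coord_fun (cell a N) (\<lambda>\<omega>. A \<omega> * B \<omega>)" "coord_fun (cell c N) (\<lambda>\<omega>. C \<omega> * D \<omega>)"
      using that by (intro coord_fun_mult cf; auto)+
    show "cell a N \<inter> cell c N = {}" using that disj by blast
    show "cell a N \<subseteq> wigner_indices" "cell c N \<subseteq> wigner_indices"
      using that cell_subset by (auto simp: good_def)
  qed (use that int2 in blast)+
  show ?int using assms by (intro int4[OF good(1) good(2) good(1) good(2)])
  show ?int2 using assms by (intro int2[OF good(1) good(2)])
  show ?E2
  proof (cases "i = j")
    case True
    thus ?thesis using entry_moment(3)[OF assms(1)] by simp
  next
    case False
    have "expectation (\<lambda>\<omega>. entry i N \<omega> * cnj (entry j N \<omega>)) = expectation (entry i N) * expectation (\<lambda>\<omega>. cnj (entry j N \<omega>))"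
      by (rule expectation_mult[of "cell i N" _ "cell j N"])
        (use assms False in \<open>auto intro!: cf good disj cell_subset int1[OF good(1)] int1[OF good(2)]\<close>)
    thus ?thesis using False entry_moment(1)[OF assms(1)] by simp
  qed
  let ?v = "\<lambda>m. entry m N" and ?w = "\<lambda>m \<omega>. cnj (entry m N \<omega>)"
  have sq: "expectation (\<lambda>\<omega>. ?v i \<omega> * ?v i \<omega>) = 0" using entry_moment(2)[OF assms(1)] .
  have nrm: "expectation (\<lambda>\<omega>. ?v m \<omega> * ?w m \<omega>) = 1" if "m < N" for m using entry_moment(3)[OF that] .
  consider "i \<noteq> j" "i \<noteq> k" "i \<noteq> l" | "j \<noteq> i" "j \<noteq> k" "j \<noteq> l" | "k \<noteq> i" "k \<noteq> j" "k \<noteq> l" | "l \<noteq> i" "l \<noteq> j" "l \<noteq> k"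
    | "i = j" "k = l" "i \<noteq> k" | "i = k" "j = l" "i \<noteq> j" | "i = l" "j = k" "i \<noteq> j" | "i = j" "j = k" "k = l"
    by metis
  thus ?E
  proof cases
    case 1
    have "expectation (\<lambda>\<omega>. ?v i \<omega> * (?w j \<omega> * ?v k \<omega> * ?w l \<omega>)) = 0"
      by (rule lone[OF good(1) good(2) good(1) good(2)]) (use 1 assms in auto)
    thus ?thesis using 1 by (simp add: mult_ac)
  next
    case 2
    have "expectation (\<lambda>\<omega>. ?w j \<omega> * (?v i \<omega> * ?v k \<omega> * ?w l \<omega>)) = 0"
      by (rule lone[OF good(2) good(1) good(1) good(2)]) (use 2 assms in auto)
    thus ?thesis using 2 by (simp add: mult_ac)
  next
    case 3
    have "expectation (\<lambda>\<omega>. ?v k \<omega> * (?v i \<omega> * ?w j \<omega> * ?w l \<omega>)) = 0"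
      by (rule lone[OF good(1) good(1) good(2) good(2)]) (use 3 assms in auto)
    thus ?thesis using 3 by (simp add: mult_ac)
  next
    case 4
    have "expectation (\<lambda>\<omega>. ?w l \<omega> * (?v i \<omega> * ?w j \<omega> * ?v k \<omega>)) = 0"
      by (rule lone[OF good(2) good(1) good(2) good(1)]) (use 4 assms in auto)
    thus ?thesis using 4 by (simp add: mult_ac)
  next
    case 5
    have "expectation (\<lambda>\<omega>. (?v i \<omega> * ?w i \<omega>) * (?v k \<omega> * ?w k \<omega>)) = 1 * 1"
      using nrm assms by (subst pair[OF good(1) good(2) good(1) good(2)]) (use 5 in auto)
    thus ?thesis using 5 by (simp add: mult_ac)
  next
    case 6
    have "expectation (\<lambda>\<omega>. (?v i \<omega> * ?v i \<omega>) * (?w j \<omega> * ?w j \<omega>)) = 0"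
      using sq assms by (subst pair[OF good(1) good(1) good(2) good(2)]) (use 6 in auto)
    thus ?thesis using 6 by (simp add: mult_ac)
  next
    case 7
    have "expectation (\<lambda>\<omega>. (?v i \<omega> * ?w i \<omega>) * (?v j \<omega> * ?w j \<omega>)) = 1 * 1"
      using nrm assms by (subst pair[OF good(1) good(2) good(1) good(2)]) (use 7 in auto)
    thus ?thesis using 7 by (simp add: mult_ac)
  next
    case 8
    thus ?thesis using entry_moment(4)[OF assms(1)] by (simp add: mult_ac excess_def)
  qed
qed

end

section \<open>Integrability of products of two minors\<close>

text \<open>
  A pair \<open>{i, j}\<close> occurs at most twice in the product, once as \<open>(i, j)\<close> and once as \<open>(j, i)\<close>; factors
  that do not occur are at least 1.
\<close>
lemma permutation_prod_le:
  fixes f :: "nat \<Rightarrow> nat \<Rightarrow> real"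
  assumes p: "p permutes {0..<N}" and sym: "\<And>i j. f i j = f j i" and ge1: "\<And>i j. f i j \<ge> 1"
  shows "(\<Prod>i = 0..<N. f i (p i)) \<le> (\<Prod>(i, j)\<in>{(i, j). i \<le> j \<and> j < N}. (f i j)\<^sup>2)"
proof -
  let ?P = "{(i, j). i \<le> j \<and> j < N}" and ?A = "{i \<in> {0..<N}. i \<le> p i}" and ?B = "{i \<in> {0..<N}. p i < i}"
  have fin: "finite ?P" by (rule finite_subset[of _ "{..<N} \<times> {..<N}"]) auto
  have in_range: "p i < N" if "i < N" for i using permutes_in_image[OF p, of i] that by simp
  have inj: "inj p" using p by (rule permutes_inj)
  have "(\<Prod>i = 0..<N. f i (p i)) = (\<Prod>i\<in>?A. f i (p i)) * (\<Prod>i\<in>?B. f i (p i))"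
    by (subst prod.union_disjoint[symmetric]) (auto intro!: prod.cong)
  also have "(\<Prod>i\<in>?A. f i (p i)) = (\<Prod>(i, j)\<in>(\<lambda>i. (i, p i)) ` ?A. f i j)"
    by (subst prod.reindex) (auto simp: inj_on_def)
  also have "(\<Prod>i\<in>?B. f i (p i)) = (\<Prod>(i, j)\<in>(\<lambda>i. (p i, i)) ` ?B. f i j)"
    by (subst prod.reindex) (auto simp: inj_on_def sym)
  also have "(\<Prod>(i, j)\<in>(\<lambda>i. (i, p i)) ` ?A. f i j) * (\<Prod>(i, j)\<in>(\<lambda>i. (p i, i)) ` ?B. f i j)
      \<le> (\<Prod>(i, j)\<in>?P. f i j) * (\<Prod>(i, j)\<in>?P. f i j)"
    using ge1 order_trans[OF zero_le_one ge1] in_range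
    by (intro mult_mono prod_mono2 prod_nonneg fin) (auto simp: case_prod_unfold)
  also have "\<dots> = (\<Prod>(i, j)\<in>?P. (f i j)\<^sup>2)"
    by (simp add: power2_eq_square case_prod_unfold prod.distrib)
  finally show ?thesis .
qed

text \<open>
  A cofactor is a determinant of the full size whose entries are still bounded by the weights below,
  so one estimate of determinants covers both.
\<close>
lemma cofactor_eq_det_unit_row:
  fixes A :: "'a::comm_ring_1 mat"
  assumes A: "A \<in> carrier_mat n n" and ij: "i < n" "j < n"
  shows "cofactor A i j = Determinant.det (Matrix.mat n n (\<lambda>(k, l). if k = i then if l = j then 1 else 0 else A $$ (k, l)))"
proof -
  let ?B = "Matrix.mat n n (\<lambda>(k, l). if k = i then if l = j then 1 else 0 else A $$ (k, l))"
  have "Determinant.det ?B = (\<Sum>l<n. ?B $$ (i, l) * cofactor ?B i l)"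
    by (rule laplace_expansion_row[OF _ ij(1)]) simp
  also have "\<dots> = (\<Sum>l<n. if l = j then cofactor ?B i l else 0)"
    using ij by (intro sum.cong) auto
  also have "\<dots> = cofactor ?B i j" using ij by simp
  also have "mat_delete ?B i j = mat_delete A i j"
    using A ij by (intro eq_matI) (auto simp: mat_delete_def)
  hence "cofactor ?B i j = cofactor A i j" by (simp add: cofactor_def)
  finally show ?thesis ..
qed

definition old_indices :: "nat \<Rightarrow> wigner_index set" where
  "old_indices N = Diag ` {..<N} \<union> (\<Union>(i, j)\<in>{(i, j). i < j \<and> j < N}. cell i j)"

definition new_indices :: "nat \<Rightarrow> wigner_index set" where
  "new_indices N = insert (Diag N) (\<Union>i<N. cell i N)"

lemma old_new_disjoint: "new_indices N \<inter> old_indices N = {}"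
  by (auto simp: old_indices_def new_indices_def cell_def)

lemma old_indices_subset: "old_indices N \<subseteq> wigner_indices"
  and new_indices_subset: "new_indices N \<subseteq> wigner_indices"
  by (auto simp: old_indices_def new_indices_def cell_def wigner_indices_def)

context wigner_ensemble
begin

text \<open>
  A bound for the squared modulus of the entry \<open>(i, j)\<close>, up to a factor 2, that is a product over
  independent coordinates and at least 1.
\<close>
definition weight :: "nat \<Rightarrow> nat \<Rightarrow> 'a \<Rightarrow> real" where
  "weight i j \<omega> = (if i = j then 1 + (coord (Diag i) \<omega>)\<^sup>2
     else (1 + (re (min i j) (max i j) \<omega>)\<^sup>2) * (1 + (im (min i j) (max i j) \<omega>)\<^sup>2))"

lemma weight_sym: "weight i j \<omega> = weight j i \<omega>"
  by (simp add: weight_def min.commute max.commute)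

lemma weight_ge_1: "weight i j \<omega> \<ge> 1"
  by (auto simp: weight_def intro!: mult_ge1_I)

lemma entry_le_weight: "cmod (entry i j \<omega>) \<le> sqrt 2 * sqrt (weight i j \<omega>)"
proof -
  have off: "u\<^sup>2 + v\<^sup>2 \<le> 2 * ((1 + u\<^sup>2) * (1 + v\<^sup>2))" for u v :: real
    by (simp add: algebra_simps add_increasing)
  consider "i = j" | "i < j" | "j < i" by linarith
  hence "(cmod (entry i j \<omega>))\<^sup>2 \<le> 2 * weight i j \<omega>"
  proof cases
    case 1 thus ?thesis by (simp add: wigner_entry_def weight_def power_divide)
  next
    case 2 thus ?thesis using off[of "re i j \<omega>" "im i j \<omega>"]
      unfolding cmod_power2 by (simp add: wigner_entry_def weight_def)
  next
    case 3 thus ?thesis using off[of "re j i \<omega>" "im j i \<omega>"]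
      unfolding cmod_power2 by (simp add: wigner_entry_def weight_def)
  qed
  hence "cmod (entry i j \<omega>) \<le> sqrt (2 * weight i j \<omega>)" by (rule real_le_rsqrt)
  thus ?thesis by (simp add: real_sqrt_mult)
qed

definition weight_indices :: "nat \<times> nat \<Rightarrow> wigner_index set" where
  "weight_indices = (\<lambda>(i, j). if i = j then {Diag i} else cell i j)"

lemma one_plus_sq_integrable:
  "k \<in> wigner_indices \<Longrightarrow> integrable M (\<lambda>\<omega>. (1 + (coord k \<omega>)\<^sup>2)\<^sup>2)"
proof -
  assume k: "k \<in> wigner_indices"
  have "integrable M (\<lambda>\<omega>. 1 + 2 * coord k \<omega> ^ 2 + coord k \<omega> ^ 4)"
    by (intro Bochner_Integration.integrable_add integrable_mult_right coord_moment(1)[OF k]) auto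
  moreover have "(1 + t\<^sup>2)\<^sup>2 = 1 + 2 * t ^ 2 + t ^ 4" for t :: real
    by (simp add: power2_sum flip: power_mult)
  ultimately show ?thesis by simp
qed

lemma coord_fun_one_plus_sq:
  "k \<in> S \<Longrightarrow> coord_fun S (\<lambda>\<omega>. (1 + (coord k \<omega>)\<^sup>2)\<^sup>2)"
  by (intro coord_fun_power coord_fun_add coord_fun_const coord_fun_coord)

lemma weight_sq:
  assumes "i \<le> j"
  shows "integrable M (\<lambda>\<omega>. (weight i j \<omega>)\<^sup>2)" "coord_fun (weight_indices (i, j)) (\<lambda>\<omega>. (weight i j \<omega>)\<^sup>2)"
    "weight_indices (i, j) \<subseteq> wigner_indices"
proof -
  show "weight_indices (i, j) \<subseteq> wigner_indices"
    using assms by (auto simp: weight_indices_def cell_def wigner_indices_def)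
  show "coord_fun (weight_indices (i, j)) (\<lambda>\<omega>. (weight i j \<omega>)\<^sup>2)"
  proof (cases "i = j")
    case True thus ?thesis
      using coord_fun_one_plus_sq[of "Diag i" "{Diag i}"] by (simp add: weight_def weight_indices_def)
  next
    case False
    have "coord_fun (cell i j) (\<lambda>\<omega>. (1 + (coord (RePart i j) \<omega>)\<^sup>2)\<^sup>2 * (1 + (coord (ImPart i j) \<omega>)\<^sup>2)\<^sup>2)"
      by (intro coord_fun_mult coord_fun_one_plus_sq) (auto simp: cell_def)
    thus ?thesis using assms False by (simp add: weight_def weight_indices_def power_mult_distrib)
  qed
  show "integrable M (\<lambda>\<omega>. (weight i j \<omega>)\<^sup>2)"
  proof (cases "i = j")
    case True thus ?thesis using one_plus_sq_integrable[OF Diag_index[of i]] by (simp add: weight_def)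
  next
    case False
    hence k: "RePart i j \<in> wigner_indices" "ImPart i j \<in> wigner_indices"
      using cell_subset[of i j] assms by (auto simp: cell_def)
    have "integrable M (\<lambda>\<omega>. (1 + (coord (RePart i j) \<omega>)\<^sup>2)\<^sup>2 * (1 + (coord (ImPart i j) \<omega>)\<^sup>2)\<^sup>2)"
      by (rule integrable_mult[OF coord_fun_one_plus_sq[of _ "{RePart i j}"] coord_fun_one_plus_sq[of _ "{ImPart i j}"]])
        (use k one_plus_sq_integrable[OF k(1)] one_plus_sq_integrable[OF k(2)] in auto)
    thus ?thesis using assms False by (simp add: weight_def power_mult_distrib)
  qed
qed

lemma weight_indices_disjoint: "p \<noteq> q \<Longrightarrow> weight_indices p \<inter> weight_indices q = {}"
  by (cases p; cases q) (auto simp: weight_indices_def cell_def)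

text \<open>
  The determinant and the cofactors of \<open>x I - X\<^sub>N\<close> are bounded by constants times this product of
  independent factors. Its square contains each coordinate to the power four at most, so it is integrable under the
  fourth-moment hypothesis, and with it every product of two such minors.
\<close>
definition majorant :: "nat \<Rightarrow> 'a \<Rightarrow> real" where
  "majorant N \<omega> = (\<Prod>(i, j)\<in>{(i, j). i \<le> j \<and> j < N}. weight i j \<omega>)"

lemma majorant_sq_integrable: "integrable M (\<lambda>\<omega>. (majorant N \<omega>)\<^sup>2)"
proof -
  have main: "integrable M (\<lambda>\<omega>. \<Prod>(i, j)\<in>P. (weight i j \<omega>)\<^sup>2) \<and>
      coord_fun (\<Union>p\<in>P. weight_indices p) (\<lambda>\<omega>. \<Prod>(i, j)\<in>P. (weight i j \<omega>)\<^sup>2)"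
    if "finite P" "P \<subseteq> {(i, j). i \<le> j}" for P
    using that
  proof (induction P rule: finite_induct)
    case (insert p P)
    obtain i j where p: "p = (i, j)" by force
    have ij: "i \<le> j" using insert.prems p by simp
    note IH = insert.IH[OF subset_trans[OF subset_insertI insert.prems]]
    have sub: "(\<Union>p\<in>P. weight_indices p) \<subseteq> wigner_indices"
    proof (rule UN_least)
      fix q assume q: "q \<in> P"
      obtain k l where "q = (k, l)" by force
      thus "weight_indices q \<subseteq> wigner_indices"
        using weight_sq(3)[of k l] insert.prems q by auto
    qed
    have peq: "(\<Prod>(i, j)\<in>insert p P. (weight i j \<omega>)\<^sup>2) = (weight i j \<omega>)\<^sup>2 * (\<Prod>(i, j)\<in>P. (weight i j \<omega>)\<^sup>2)" for \<omega>
      unfolding prod.insert[OF insert.hyps] unfolding p prod.case ..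
    have disj: "weight_indices (i, j) \<inter> (\<Union>p\<in>P. weight_indices p) = {}"
    proof -
      have "weight_indices (i, j) \<inter> weight_indices q = {}" if "q \<in> P" for q
        using insert.hyps(2) p that by (intro weight_indices_disjoint) auto
      thus ?thesis by blast
    qed
    have "integrable M (\<lambda>\<omega>. (weight i j \<omega>)\<^sup>2 * (\<Prod>(i, j)\<in>P. (weight i j \<omega>)\<^sup>2))"
      by (rule integrable_mult[OF weight_sq(2)[OF ij] IH[THEN conjunct2] disj weight_sq(3)[OF ij] sub
          weight_sq(1)[OF ij] IH[THEN conjunct1]])
    moreover have "coord_fun (\<Union>p\<in>insert p P. weight_indices p) (\<lambda>\<omega>. (weight i j \<omega>)\<^sup>2 * (\<Prod>(i, j)\<in>P. (weight i j \<omega>)\<^sup>2))"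
      by (rule coord_fun_mult[OF coord_fun_mono[OF weight_sq(2)[OF ij]] coord_fun_mono[OF IH[THEN conjunct2]]])
        (auto simp: p)
    ultimately show ?case unfolding peq by (rule conjI)
  qed simp
  have "finite {(i, j). i \<le> j \<and> j < N}"
    by (rule finite_subset[of _ "{..<N} \<times> {..<N}"]) auto
  hence "integrable M (\<lambda>\<omega>. \<Prod>(i, j)\<in>{(i, j). i \<le> j \<and> j < N}. (weight i j \<omega>)\<^sup>2)"
    by (rule main[THEN conjunct1]) auto
  thus ?thesis unfolding majorant_def prod_power_distrib by (simp only: case_prod_unfold)
qed

lemma majorant_ge_1: "majorant N \<omega> \<ge> 1"
  unfolding majorant_def by (rule prod_ge_1) (auto simp: weight_ge_1)

text \<open>The class of functions of \<open>X\<^sub>N\<close> any two of which have an integrable product.\<close>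
definition tame :: "nat \<Rightarrow> ('a \<Rightarrow> complex) \<Rightarrow> bool" where
  "tame N F \<longleftrightarrow> coord_fun (old_indices N) F \<and> (\<exists>C. \<forall>\<omega>. cmod (F \<omega>) \<le> C * majorant N \<omega>)"

lemma tame_const: "tame N (\<lambda>_. a)"
  unfolding tame_def
proof (intro conjI exI[of _ "cmod a"] allI)
  show "cmod a \<le> cmod a * majorant N \<omega>" for \<omega>
    using mult_left_mono[OF majorant_ge_1[of N \<omega>], of "cmod a"] by simp
qed simp

lemma tame_add: "tame N F \<Longrightarrow> tame N G \<Longrightarrow> tame N (\<lambda>\<omega>. F \<omega> + G \<omega>)"
  unfolding tame_def
proof (elim conjE exE, intro conjI coord_fun_add)
  fix C D assume "\<forall>\<omega>. cmod (F \<omega>) \<le> C * majorant N \<omega>" "\<forall>\<omega>. cmod (G \<omega>) \<le> D * majorant N \<omega>"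
  hence "cmod (F \<omega> + G \<omega>) \<le> (C + D) * majorant N \<omega>" for \<omega>
    unfolding distrib_right by (intro norm_triangle_mono) auto
  thus "\<exists>C. \<forall>\<omega>. cmod (F \<omega> + G \<omega>) \<le> C * majorant N \<omega>" by blast
qed

lemma tame_sum: "(\<And>i. i \<in> A \<Longrightarrow> tame N (F i)) \<Longrightarrow> tame N (\<lambda>\<omega>. \<Sum>i\<in>A. F i \<omega>)"
  by (induction A rule: infinite_finite_induct) (auto intro: tame_add tame_const)

lemma tame_mult_integrable:
  assumes "tame N F" "tame N G"
  shows "integrable M (\<lambda>\<omega>. F \<omega> * G \<omega>)"
proof -
  obtain C where C: "\<And>\<omega>. cmod (F \<omega>) \<le> C * majorant N \<omega>" using assms(1) by (auto simp: tame_def)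
  obtain D where D: "\<And>\<omega>. cmod (G \<omega>) \<le> D * majorant N \<omega>" using assms(2) by (auto simp: tame_def)
  show ?thesis
  proof (rule Bochner_Integration.integrable_bound)
    show "integrable M (\<lambda>\<omega>. (C * D) * (majorant N \<omega>)\<^sup>2)"
      by (intro integrable_mult_right majorant_sq_integrable)
    show "(\<lambda>\<omega>. F \<omega> * G \<omega>) \<in> borel_measurable M"
      using assms by (intro coord_fun_measurable[OF _ old_indices_subset[of N]] coord_fun_mult) (auto simp: tame_def)
    have "cmod (F \<omega>) * cmod (G \<omega>) \<le> (C * majorant N \<omega>) * (D * majorant N \<omega>)" for \<omega>
      by (intro mult_mono C D order_trans[OF norm_ge_zero C]) auto
    hence "cmod (F \<omega> * G \<omega>) \<le> (C * D) * (majorant N \<omega>)\<^sup>2" for \<omega>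
      by (simp add: norm_mult power2_eq_square mult_ac)
    thus "AE \<omega> in M. norm (F \<omega> * G \<omega>) \<le> norm ((C * D) * (majorant N \<omega>)\<^sup>2)"
      by (intro AE_I2) (auto intro: order_trans[OF _ abs_ge_self])
  qed
qed

lemma tame_integrable: "tame N F \<Longrightarrow> integrable M F"
  using tame_mult_integrable[OF _ tame_const[of N 1]] by simp

lemma tame_det:
  assumes B: "\<And>\<omega>. B \<omega> \<in> carrier_mat N N"
    and meas: "\<And>i j. i < N \<Longrightarrow> j < N \<Longrightarrow> coord_fun (old_indices N) (\<lambda>\<omega>. B \<omega> $$ (i, j))"
    and bound: "\<And>\<omega> i j. i < N \<Longrightarrow> j < N \<Longrightarrow> cmod (B \<omega> $$ (i, j)) \<le> C * sqrt (weight i j \<omega>)"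
  shows "tame N (\<lambda>\<omega>. Determinant.det (B \<omega>))"
  unfolding det_def'[OF B]
proof (rule tame_sum)
  fix p assume "p \<in> {p. p permutes {0..<N}}"
  hence p: "p permutes {0..<N}" by simp
  have in_range: "p i < N" if "i < N" for i using permutes_in_image[OF p, of i] that by simp
  have sgn: "cmod (signof p) = 1" by (simp add: sign_def)
  show "tame N (\<lambda>\<omega>. signof p * (\<Prod>i = 0..<N. B \<omega> $$ (i, p i)))"
    unfolding tame_def
  proof (intro conjI exI[of _ "C ^ N"] allI)
    show "coord_fun (old_indices N) (\<lambda>\<omega>. signof p * (\<Prod>i = 0..<N. B \<omega> $$ (i, p i)))"
      using in_range by (intro coord_fun_mult coord_fun_const coord_fun_prod meas) auto
    fix \<omega>
    have "cmod (signof p * (\<Prod>i = 0..<N. B \<omega> $$ (i, p i))) = (\<Prod>i = 0..<N. cmod (B \<omega> $$ (i, p i)))"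
      unfolding norm_mult sgn prod_norm by simp
    also have "\<dots> \<le> (\<Prod>i = 0..<N. C * sqrt (weight i (p i) \<omega>))"
      using in_range by (intro prod_mono conjI bound) auto
    also have "\<dots> = C ^ N * (\<Prod>i = 0..<N. sqrt (weight i (p i) \<omega>))"
      by (simp add: prod.distrib)
    also have "\<dots> \<le> C ^ N * majorant N \<omega>"
    proof (cases "N = 0")
      case False
      have "0 \<le> C * sqrt (weight 0 0 \<omega>)" using bound[of 0 0 \<omega>] False norm_ge_zero order_trans by blast
      hence "C \<ge> 0" using weight_ge_1[of 0 0 \<omega>] by (simp add: zero_le_mult_iff)
      moreover have "(\<Prod>i = 0..<N. sqrt (weight i (p i) \<omega>)) \<le> majorant N \<omega>"
        using permutation_prod_le[OF p, of "\<lambda>i j. sqrt (weight i j \<omega>)"] weight_sym weight_ge_1 order_trans[OF zero_le_one weight_ge_1]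
        by (simp add: majorant_def)
      ultimately show ?thesis by (intro mult_left_mono) auto
    qed (simp add: majorant_def)
    finally show "cmod (signof p * (\<Prod>i = 0..<N. B \<omega> $$ (i, p i))) \<le> C ^ N * majorant N \<omega>" .
  qed
qed

abbreviation X :: "nat \<Rightarrow> 'a \<Rightarrow> complex mat" where
  "X N \<omega> \<equiv> wigner_matrix d re im N \<omega>"

lemma X_carrier: "X N \<omega> \<in> carrier_mat N N"
  by (simp add: wigner_matrix_def)

lemma X_index: "i < N \<Longrightarrow> j < N \<Longrightarrow> X N \<omega> $$ (i, j) = entry i j \<omega>"
  by (simp add: wigner_matrix_def)

lemma coord_fun_entry_old:
  assumes "i < N" "j < N" shows "coord_fun (old_indices N) (entry i j)"
proof -
  consider "i = j" | "i < j" | "j < i" by linarith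
  thus ?thesis
  proof cases
    case 1
    have "coord_fun (old_indices N) (\<lambda>\<omega>. complex_of_real (sqrt 2) * of_real (coord (Diag i) \<omega>))"
      using assms by (intro coord_fun_mult coord_fun_const coord_fun_of_real coord_fun_coord) (auto simp: old_indices_def)
    moreover have "entry i j = (\<lambda>\<omega>. complex_of_real (sqrt 2) * of_real (coord (Diag i) \<omega>))"
      using 1 by (auto simp: wigner_entry_def fun_eq_iff)
    ultimately show ?thesis by simp
  next
    case 2
    thus ?thesis using assms by (intro coord_fun_entry) (auto simp: old_indices_def)
  next
    case 3
    hence "coord_fun (old_indices N) (\<lambda>\<omega>. cnj (entry j i \<omega>))"
      using assms by (intro coord_fun_cnj coord_fun_entry) (auto simp: old_indices_def)
    thus ?thesis using 3 by (simp add: entry_lower)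
  qed
qed

lemma charmat_entry_bound:
  assumes "i < N" "j < N"
  shows "cmod (charmat (X N \<omega>) x $$ (i, j)) \<le> (cmod x + sqrt 2) * sqrt (weight i j \<omega>)"
proof -
  have "cmod (charmat (X N \<omega>) x $$ (i, j)) \<le> cmod x + cmod (entry i j \<omega>)"
    unfolding charmat_index[OF X_carrier assms] X_index[OF assms]
    using norm_triangle_ineq4[of x "entry i j \<omega>"] by auto
  also have "\<dots> \<le> cmod x * sqrt (weight i j \<omega>) + sqrt 2 * sqrt (weight i j \<omega>)"
    using mult_left_mono[of 1 "sqrt (weight i j \<omega>)" "cmod x"] weight_ge_1[of i j \<omega>]
    by (intro add_mono entry_le_weight) auto
  finally show ?thesis by (simp add: distrib_right)
qed

lemma coord_fun_charmat:
  assumes "i < N" "j < N"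
  shows "coord_fun (old_indices N) (\<lambda>\<omega>. charmat (X N \<omega>) x $$ (i, j))"
  unfolding charmat_index[OF X_carrier assms] X_index[OF assms]
  by (intro coord_fun_diff coord_fun_const coord_fun_entry_old assms)

lemma tame_char_poly: "tame N (\<lambda>\<omega>. poly (char_poly (X N \<omega>)) x)"
  unfolding det_charmat[OF X_carrier, symmetric]
  by (rule tame_det[OF charmat_carrier[OF X_carrier] coord_fun_charmat charmat_entry_bound])

lemma tame_cofactor:
  assumes "i < N" "j < N"
  shows "tame N (\<lambda>\<omega>. cofactor (charmat (X N \<omega>) x) i j)"
  unfolding cofactor_eq_det_unit_row[OF charmat_carrier[OF X_carrier] assms]
proof (rule tame_det)
  fix k l assume kl: "k < N" "l < N"
  show "coord_fun (old_indices N) (\<lambda>\<omega>. Matrix.mat N N (\<lambda>(k, l). if k = i then if l = j then 1 else 0 else charmat (X N \<omega>) x $$ (k, l)) $$ (k, l))"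
    using kl coord_fun_charmat[OF kl] by (cases "k = i"; cases "l = j") simp_all
  fix \<omega>
  have "1 \<le> (1 + cmod x + sqrt 2) * sqrt (weight k l \<omega>)"
    using weight_ge_1[of k l \<omega>] by (intro mult_ge1_I) auto
  moreover have "(cmod x + sqrt 2) * sqrt (weight k l \<omega>) \<le> (1 + cmod x + sqrt 2) * sqrt (weight k l \<omega>)"
    using weight_ge_1[of k l \<omega>] by (intro mult_right_mono) auto
  ultimately show "cmod (Matrix.mat N N (\<lambda>(k, l). if k = i then if l = j then 1 else 0 else charmat (X N \<omega>) x $$ (k, l)) $$ (k, l))
      \<le> (1 + cmod x + sqrt 2) * sqrt (weight k l \<omega>)"
    using kl charmat_entry_bound[OF kl, of \<omega> x] by auto
qed simp

lemma tame_pderiv_char_poly: "tame N (\<lambda>\<omega>. poly (pderiv (char_poly (X N \<omega>))) x)"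
  unfolding trace_cofactor_charmat[OF X_carrier, symmetric] by (intro tame_sum tame_cofactor) auto

end

lemma quartic_series_cong: "(\<And>n. n \<le> N \<Longrightarrow> \<phi> n = \<psi> n) \<Longrightarrow> quartic_series c \<phi> N = quartic_series c \<psi> N"
  by (simp add: quartic_series_def)

lemma quartic_series_lincomb:
  "quartic_series c (\<lambda>n. \<Sum>m\<in>A. w m * \<phi> m n) N = (\<Sum>m\<in>A. w m * quartic_series c (\<phi> m) N)"
  unfolding quartic_series_def sum_distrib_left by (subst sum.swap) (simp add: mult_ac)

section \<open>The recursion for the second moments\<close>

text \<open>Enumerates the indices other than \<open>i\<close> in increasing order.\<close>
definition skip :: "nat \<Rightarrow> nat \<Rightarrow> nat" where "skip i k = (if k < i then k else Suc k)"

lemma skip_less_iff: "skip i k < skip i l \<longleftrightarrow> k < l"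
  and skip_eq_iff: "skip i k = skip i l \<longleftrightarrow> k = l"
  by (auto simp: skip_def)

context wigner_ensemble
begin

text \<open>
  Deleting row and column \<open>i\<close> gives a Wigner matrix again, because \<open>skip i\<close> is increasing: entries above
  the diagonal stay above it, so no imaginary part changes its sign and the coordinates keep the distribution \<open>Q\<close>.
\<close>
lemma wigner_ensemble_skip:
  "wigner_ensemble M Q (\<lambda>k. d (skip i k)) (\<lambda>k l. re (skip i k) (skip i l)) (\<lambda>k l. im (skip i k) (skip i l))"
proof -
  define \<phi> where "\<phi> k = (case k of Diag k \<Rightarrow> Diag (skip i k) | RePart k l \<Rightarrow> RePart (skip i k) (skip i l)
      | ImPart k l \<Rightarrow> ImPart (skip i k) (skip i l))" for k
  let ?coord = "wigner_coord (\<lambda>k. d (skip i k)) (\<lambda>k l. re (skip i k) (skip i l)) (\<lambda>k l. im (skip i k) (skip i l))"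
  have eq: "?coord k = coord (\<phi> k)" for k by (cases k) (auto simp: \<phi>_def)
  have \<phi>: "\<phi> k \<in> wigner_indices" if "k \<in> wigner_indices" for k
    using that by (auto simp: wigner_indices_def \<phi>_def skip_less_iff)
  have inj: "\<phi> k = \<phi> l \<Longrightarrow> k = l" for k l
    by (cases k; cases l) (auto simp: \<phi>_def skip_eq_iff)
  have "indep_vars (\<lambda>k. PiM {\<phi> k} (\<lambda>_. borel)) (\<lambda>k \<omega>. restrict (\<lambda>m. coord m \<omega>) {\<phi> k}) wigner_indices"
    using \<phi> inj by (intro indep_vars_restrict[OF indep_coord]) (auto simp: disjoint_family_on_def)
  hence "indep_vars (\<lambda>_. borel) (\<lambda>k \<omega>. (\<lambda>f. f (\<phi> k)) (restrict (\<lambda>m. coord m \<omega>) {\<phi> k})) wigner_indices"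
    by (rule indep_vars_compose2) measurable
  hence "indep_vars (\<lambda>_. borel) ?coord wigner_indices"
    by (simp add: eq[abs_def])
  moreover have "\<forall>k\<in>wigner_indices. distr M borel (?coord k) = Q"
    using \<phi> distr_coord by (simp add: eq)
  ultimately have "wigner_family M Q (\<lambda>k. d (skip i k)) (\<lambda>k l. re (skip i k) (skip i l)) (\<lambda>k l. im (skip i k) (skip i l))"
    unfolding wigner_family_def by (rule conjI)
  with prob_space_axioms Q Q4 Q_mean Q_var show ?thesis
    by (intro wigner_ensemble.intro wigner_ensemble_axioms.intro)
qed

lemma mat_delete_X:
  assumes "i < N"
  shows "mat_delete (X N \<omega>) i i = wigner_matrix (\<lambda>k. d (skip i k)) (\<lambda>k l. re (skip i k) (skip i l))
     (\<lambda>k l. im (skip i k) (skip i l)) (N - 1) \<omega>"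
  using assms by (intro eq_matI) (auto simp: mat_delete_def wigner_matrix_def wigner_entry_def skip_def)

abbreviation P :: "nat \<Rightarrow> complex \<Rightarrow> 'a \<Rightarrow> complex" where
  "P N x \<omega> \<equiv> poly (char_poly (X N \<omega>)) x"

abbreviation P' :: "nat \<Rightarrow> complex \<Rightarrow> 'a \<Rightarrow> complex" where
  "P' N x \<omega> \<equiv> poly (pderiv (char_poly (X N \<omega>))) x"

abbreviation cof :: "nat \<Rightarrow> complex \<Rightarrow> nat \<Rightarrow> nat \<Rightarrow> 'a \<Rightarrow> complex" where
  "cof N x i j \<omega> \<equiv> cofactor (charmat (X N \<omega>) x) i j"

lemma P_Suc:
  "P (Suc N) x \<omega> = (x - of_real (d N \<omega>)) * P N x \<omega>
     - (\<Sum>i<N. \<Sum>j<N. entry i N \<omega> * cnj (entry j N \<omega>) * cof N x i j \<omega>)"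
proof -
  let ?A = "charmat (X (Suc N) \<omega>) x"
  have A: "?A \<in> carrier_mat (Suc N) (Suc N)" by (rule charmat_carrier[OF X_carrier])
  have del: "mat_delete ?A N N = charmat (X N \<omega>) x"
    by (intro eq_matI) (auto simp: mat_delete_def charmat_def wigner_matrix_def)
  have "P (Suc N) x \<omega> = ?A $$ (N, N) * Determinant.det (charmat (X N \<omega>) x)
     - (\<Sum>i<N. \<Sum>j<N. ?A $$ (i, N) * ?A $$ (N, j) * cof N x i j \<omega>)"
    unfolding det_charmat[OF X_carrier, symmetric] det_bordered[OF A] del ..
  also have "?A $$ (N, N) = x - of_real (d N \<omega>)"
    by (simp add: charmat_index[OF X_carrier] X_index wigner_entry_def)
  also have "Determinant.det (charmat (X N \<omega>) x) = P N x \<omega>" by (rule det_charmat[OF X_carrier])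
  also have "(\<Sum>i<N. \<Sum>j<N. ?A $$ (i, N) * ?A $$ (N, j) * cof N x i j \<omega>)
      = (\<Sum>i<N. \<Sum>j<N. entry i N \<omega> * cnj (entry j N \<omega>) * cof N x i j \<omega>)"
    by (intro sum.cong refl) (simp add: charmat_index[OF X_carrier] X_index entry_lower)
  finally show ?thesis .
qed

text \<open>
  \<open>R\<close> is a function of the new row and column, \<open>F\<close> and \<open>G\<close> are functions of \<open>X\<^sub>N\<close>. Stated with
  \<open>has_bochner_integral\<close>, so that integrability and value of a long sum are obtained at once.
\<close>
lemma has_expectation_new_old:
  assumes R: "coord_fun (new_indices N) R" "integrable M R" "expectation R = r" and FG: "tame N F" "tame N G"
  shows "has_bochner_integral M (\<lambda>\<omega>. R \<omega> * (F \<omega> * G \<omega>)) (r * expectation (\<lambda>\<omega>. F \<omega> * G \<omega>))"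
proof -
  have c: "coord_fun (old_indices N) (\<lambda>\<omega>. F \<omega> * G \<omega>)"
    using FG by (intro coord_fun_mult) (auto simp: tame_def)
  note i = R(1) c old_new_disjoint new_indices_subset old_indices_subset R(2) tame_mult_integrable[OF FG]
  show ?thesis
    using has_bochner_integral_integrable[OF integrable_mult[OF i]] unfolding expectation_mult[OF i] R(3) .
qed

lemma coord_fun_diag: "coord_fun (new_indices N) (\<lambda>\<omega>. complex_of_real (d N \<omega>))"
proof -
  have "coord_fun (new_indices N) (\<lambda>\<omega>. complex_of_real (sqrt 2) * of_real (coord (Diag N) \<omega>))"
    by (intro coord_fun_mult coord_fun_const coord_fun_of_real coord_fun_coord) (auto simp: new_indices_def)
  thus ?thesis by simp
qed

lemma diag_moment:
  shows "integrable M (\<lambda>\<omega>. complex_of_real (d N \<omega>))" "expectation (\<lambda>\<omega>. complex_of_real (d N \<omega>)) = 0"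
    and "integrable M (\<lambda>\<omega>. (complex_of_real (d N \<omega>))\<^sup>2)" "expectation (\<lambda>\<omega>. (complex_of_real (d N \<omega>))\<^sup>2) = 1"
proof -
  note k = Diag_index[of N]
  have 1: "(\<lambda>\<omega>. complex_of_real (d N \<omega>)) = (\<lambda>\<omega>. of_real (sqrt 2 * coord (Diag N) \<omega> ^ 1))"
    by simp
  have 2: "(\<lambda>\<omega>. (complex_of_real (d N \<omega>))\<^sup>2) = (\<lambda>\<omega>. of_real (2 * coord (Diag N) \<omega> ^ 2))"
    by (simp add: power_divide)
  show "integrable M (\<lambda>\<omega>. complex_of_real (d N \<omega>))"
    unfolding 1 by (intro integrable_of_real integrable_mult_right coord_moment(1)[OF k]) simp
  show "integrable M (\<lambda>\<omega>. (complex_of_real (d N \<omega>))\<^sup>2)"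
    unfolding 2 by (intro integrable_of_real integrable_mult_right coord_moment(1)[OF k]) simp
  show "expectation (\<lambda>\<omega>. complex_of_real (d N \<omega>)) = 0"
    unfolding 1 integral_complex_of_real integral_mult_right_zero coord_moment(2)[OF k] by (simp add: Q_mean)
  show "expectation (\<lambda>\<omega>. (complex_of_real (d N \<omega>))\<^sup>2) = 1"
    unfolding 2 integral_complex_of_real integral_mult_right_zero coord_moment(2)[OF k] by (simp add: Q_var)
qed

lemma coord_fun_column: "i < N \<Longrightarrow> coord_fun (new_indices N) (entry i N)"
  by (rule coord_fun_entry) (auto simp: new_indices_def)

lemma coord_fun_column2:
  "i < N \<Longrightarrow> j < N \<Longrightarrow> coord_fun (new_indices N) (\<lambda>\<omega>. entry i N \<omega> * cnj (entry j N \<omega>))"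
  by (intro coord_fun_mult coord_fun_cnj coord_fun_column)

lemma diag_column_moment:
  assumes "i < N" "j < N"
  shows "integrable M (\<lambda>\<omega>. (x - of_real (d N \<omega>)) * (entry i N \<omega> * cnj (entry j N \<omega>)))"
    and "expectation (\<lambda>\<omega>. (x - of_real (d N \<omega>)) * (entry i N \<omega> * cnj (entry j N \<omega>))) = (if i = j then x else 0)"
proof -
  have c: "coord_fun {Diag N} (\<lambda>\<omega>. x - of_real (d N \<omega>))"
  proof -
    have "coord_fun {Diag N} (\<lambda>\<omega>. x - of_real (sqrt 2) * of_real (coord (Diag N) \<omega>))"
      by (intro coord_fun_diff coord_fun_mult coord_fun_const coord_fun_of_real coord_fun_coord) simp
    thus ?thesis by simp
  qed
  have c2: "coord_fun (cell i N \<union> cell j N) (\<lambda>\<omega>. entry i N \<omega> * cnj (entry j N \<omega>))"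
    using assms by (intro coord_fun_mult coord_fun_cnj coord_fun_entry) auto
  have disj: "{Diag N} \<inter> (cell i N \<union> cell j N) = {}" "{Diag N} \<subseteq> wigner_indices" "cell i N \<union> cell j N \<subseteq> wigner_indices"
    using cell_subset[OF assms(1)] cell_subset[OF assms(2)] Diag_index by (auto simp: cell_def)
  have int: "integrable M (\<lambda>\<omega>. x - of_real (d N \<omega>))" "expectation (\<lambda>\<omega>. x - of_real (d N \<omega>)) = x"
    using diag_moment[of N] by (simp_all add: prob_space)
  note i = c c2 disj int(1) column_moment4(3)[OF assms assms]
  show "integrable M (\<lambda>\<omega>. (x - of_real (d N \<omega>)) * (entry i N \<omega> * cnj (entry j N \<omega>)))"
    by (rule integrable_mult[OF i])
  show "expectation (\<lambda>\<omega>. (x - of_real (d N \<omega>)) * (entry i N \<omega> * cnj (entry j N \<omega>))) = (if i = j then x else 0)"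
    unfolding expectation_mult[OF i] int(2) column_moment4(4)[OF assms assms] by simp
qed

lemma diag_diag_moment:
  shows "integrable M (\<lambda>\<omega>. (x - of_real (d N \<omega>)) * (y - complex_of_real (d N \<omega>)))"
    and "expectation (\<lambda>\<omega>. (x - of_real (d N \<omega>)) * (y - complex_of_real (d N \<omega>))) = 1 + x * y"
proof -
  have eq: "(\<lambda>\<omega>. (x - of_real (d N \<omega>)) * (y - complex_of_real (d N \<omega>)))
      = (\<lambda>\<omega>. x * y - (x + y) * of_real (d N \<omega>) + (of_real (d N \<omega>))\<^sup>2)"
    by (simp add: algebra_simps power2_eq_square)
  show "integrable M (\<lambda>\<omega>. (x - of_real (d N \<omega>)) * (y - complex_of_real (d N \<omega>)))"
    unfolding eq using diag_moment[of N] by simp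
  show "expectation (\<lambda>\<omega>. (x - of_real (d N \<omega>)) * (y - complex_of_real (d N \<omega>))) = 1 + x * y"
    unfolding eq using diag_moment[of N] by (simp add: prob_space)
qed

lemma delta_sum4:
  fixes T :: "nat \<Rightarrow> nat \<Rightarrow> nat \<Rightarrow> nat \<Rightarrow> complex"
  shows "(\<Sum>i<N. \<Sum>j<N. \<Sum>k<N. \<Sum>l<N. ((if i = j \<and> k = l then 1 else 0) + (if i = l \<and> j = k then 1 else 0)
       + (if i = j \<and> j = k \<and> k = l then b else 0)) * T i j k l)
    = (\<Sum>i<N. \<Sum>k<N. T i i k k) + (\<Sum>i<N. \<Sum>j<N. T i j j i) + b * (\<Sum>i<N. T i i i i)"
proof -
  have split: "((if i = j \<and> k = l then 1 else 0) + (if i = l \<and> j = k then 1 else 0)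
       + (if i = j \<and> j = k \<and> k = l then b else 0)) * T i j k l
     = (if j = i then if l = k then T i j k l else 0 else 0) + (if k = j then if l = i then T i j k l else 0 else 0)
       + (if j = i then if k = j then if l = k then b * T i j k l else 0 else 0 else 0)" for i j k l
    by (auto simp: algebra_simps)
  have in_sum: "(\<Sum>l<N. if c then f l else 0) = (if c then \<Sum>l<N. f l else 0)" for c and f :: "nat \<Rightarrow> complex"
    by simp
  show ?thesis unfolding split sum.distrib in_sum
    by (simp add: in_sum sum_distrib_left)
qed

text \<open>
  Average the product of two copies of \<open>P_Suc\<close> over the new row and column. The three summands of
  \<open>column_moment4\<close> produce, in this order, the product of the two traces of cofactors, the trace of
  the product of the two adjugates, and the sum over the principal minors.
\<close>
lemma second_moment_recursion:
  "expectation (\<lambda>\<omega>. P (Suc N) x \<omega> * P (Suc N) y \<omega>) =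
     (1 + x * y) * expectation (\<lambda>\<omega>. P N x \<omega> * P N y \<omega>)
     - x * expectation (\<lambda>\<omega>. P N x \<omega> * P' N y \<omega>) - y * expectation (\<lambda>\<omega>. P' N x \<omega> * P N y \<omega>)
     + expectation (\<lambda>\<omega>. P' N x \<omega> * P' N y \<omega>)
     + (\<Sum>i<N. \<Sum>j<N. expectation (\<lambda>\<omega>. cof N x i j \<omega> * cof N y j i \<omega>))
     + 2 * of_real excess * (\<Sum>i<N. expectation (\<lambda>\<omega>. cof N x i i \<omega> * cof N y i i \<omega>))"
proof -
  define a where "a \<omega> = complex_of_real (d N \<omega>)" for \<omega>
  define v where "v i j \<omega> = entry i N \<omega> * cnj (entry j N \<omega>)" for i j \<omega>
  have expand: "P (Suc N) x \<omega> * P (Suc N) y \<omega> = ((x - a \<omega>) * (y - a \<omega>)) * (P N x \<omega> * P N y \<omega>)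
      - (\<Sum>k<N. \<Sum>l<N. ((x - a \<omega>) * v k l \<omega>) * (P N x \<omega> * cof N y k l \<omega>))
      - (\<Sum>i<N. \<Sum>j<N. ((y - a \<omega>) * v i j \<omega>) * (P N y \<omega> * cof N x i j \<omega>))
      + (\<Sum>i<N. \<Sum>j<N. \<Sum>k<N. \<Sum>l<N. (entry i N \<omega> * cnj (entry j N \<omega>) * entry k N \<omega> * cnj (entry l N \<omega>)) * (cof N x i j \<omega> * cof N y k l \<omega>))" for \<omega>
  proof -
    let ?S = "\<Sum>i<N. \<Sum>j<N. v i j \<omega> * cof N x i j \<omega>" and ?T = "\<Sum>k<N. \<Sum>l<N. v k l \<omega> * cof N y k l \<omega>"
    have "P (Suc N) x \<omega> * P (Suc N) y \<omega> = ((x - a \<omega>) * P N x \<omega> - ?S) * ((y - a \<omega>) * P N y \<omega> - ?T)"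
      unfolding P_Suc a_def v_def ..
    also have "\<dots> = ((x - a \<omega>) * (y - a \<omega>)) * (P N x \<omega> * P N y \<omega>) - ((x - a \<omega>) * P N x \<omega>) * ?T
        - ((y - a \<omega>) * P N y \<omega>) * ?S + ?S * ?T"
      by (simp add: algebra_simps)
    also have "((x - a \<omega>) * P N x \<omega>) * ?T = (\<Sum>k<N. \<Sum>l<N. ((x - a \<omega>) * v k l \<omega>) * (P N x \<omega> * cof N y k l \<omega>))"
      unfolding sum_distrib_left by (intro sum.cong refl) (simp only: mult_ac)
    also have "((y - a \<omega>) * P N y \<omega>) * ?S = (\<Sum>i<N. \<Sum>j<N. ((y - a \<omega>) * v i j \<omega>) * (P N y \<omega> * cof N x i j \<omega>))"
      unfolding sum_distrib_left by (intro sum.cong refl) (simp only: mult_ac)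
    also have "?S * ?T = (\<Sum>i<N. \<Sum>j<N. \<Sum>k<N. \<Sum>l<N. (entry i N \<omega> * cnj (entry j N \<omega>) * entry k N \<omega> * cnj (entry l N \<omega>)) * (cof N x i j \<omega> * cof N y k l \<omega>))"
      unfolding sum_distrib_right unfolding sum_distrib_left by (intro sum.cong refl) (simp only: v_def mult_ac)
    finally show ?thesis .
  qed
  have hb: "has_bochner_integral M (\<lambda>\<omega>. P (Suc N) x \<omega> * P (Suc N) y \<omega>)
     ((1 + x * y) * expectation (\<lambda>\<omega>. P N x \<omega> * P N y \<omega>)
      - (\<Sum>k<N. \<Sum>l<N. (if k = l then x else 0) * expectation (\<lambda>\<omega>. P N x \<omega> * cof N y k l \<omega>))
      - (\<Sum>i<N. \<Sum>j<N. (if i = j then y else 0) * expectation (\<lambda>\<omega>. P N y \<omega> * cof N x i j \<omega>))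
      + (\<Sum>i<N. \<Sum>j<N. \<Sum>k<N. \<Sum>l<N. ((if i = j \<and> k = l then 1 else 0) + (if i = l \<and> j = k then 1 else 0)
           + (if i = j \<and> j = k \<and> k = l then 2 * of_real excess else 0)) * expectation (\<lambda>\<omega>. cof N x i j \<omega> * cof N y k l \<omega>)))"
    unfolding expand a_def v_def
    by (intro has_bochner_integral_add has_bochner_integral_diff has_bochner_integral_sum has_expectation_new_old
        diag_diag_moment diag_column_moment column_moment4(1,2))
      (auto intro!: tame_char_poly tame_cofactor coord_fun_mult coord_fun_diff coord_fun_const coord_fun_diag coord_fun_column coord_fun_cnj)
  have "(\<Sum>k<N. \<Sum>l<N. (if k = l then x else 0) * expectation (\<lambda>\<omega>. P N x \<omega> * cof N y k l \<omega>))
      = x * (\<Sum>k<N. expectation (\<lambda>\<omega>. P N x \<omega> * cof N y k k \<omega>))"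
    by (simp add: if_distrib[of "\<lambda>c. c * _"] sum_distrib_left cong: if_cong)
  also have "(\<Sum>k<N. expectation (\<lambda>\<omega>. P N x \<omega> * cof N y k k \<omega>)) = expectation (\<lambda>\<omega>. P N x \<omega> * P' N y \<omega>)"
    unfolding trace_cofactor_charmat[OF X_carrier, symmetric] sum_distrib_left
    by (subst Bochner_Integration.integral_sum) (auto intro!: tame_mult_integrable tame_char_poly tame_cofactor)
  finally have 1: "(\<Sum>k<N. \<Sum>l<N. (if k = l then x else 0) * expectation (\<lambda>\<omega>. P N x \<omega> * cof N y k l \<omega>))
      = x * expectation (\<lambda>\<omega>. P N x \<omega> * P' N y \<omega>)" .
  have "(\<Sum>k<N. \<Sum>l<N. (if k = l then y else 0) * expectation (\<lambda>\<omega>. P N y \<omega> * cof N x k l \<omega>))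
      = y * (\<Sum>k<N. expectation (\<lambda>\<omega>. P N y \<omega> * cof N x k k \<omega>))"
    by (simp add: if_distrib[of "\<lambda>c. c * _"] sum_distrib_left cong: if_cong)
  also have "(\<Sum>k<N. expectation (\<lambda>\<omega>. P N y \<omega> * cof N x k k \<omega>)) = expectation (\<lambda>\<omega>. P N y \<omega> * P' N x \<omega>)"
    unfolding trace_cofactor_charmat[OF X_carrier, symmetric] sum_distrib_left
    by (subst Bochner_Integration.integral_sum) (auto intro!: tame_mult_integrable tame_char_poly tame_cofactor)
  also have "\<dots> = expectation (\<lambda>\<omega>. P' N x \<omega> * P N y \<omega>)" by (simp only: mult.commute)
  finally have 2: "(\<Sum>k<N. \<Sum>l<N. (if k = l then y else 0) * expectation (\<lambda>\<omega>. P N y \<omega> * cof N x k l \<omega>))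
      = y * expectation (\<lambda>\<omega>. P' N x \<omega> * P N y \<omega>)" .
  have 3: "(\<Sum>i<N. \<Sum>k<N. expectation (\<lambda>\<omega>. cof N x i i \<omega> * cof N y k k \<omega>)) = expectation (\<lambda>\<omega>. P' N x \<omega> * P' N y \<omega>)"
  proof -
    have "expectation (\<lambda>\<omega>. P' N x \<omega> * P' N y \<omega>) = expectation (\<lambda>\<omega>. \<Sum>i<N. \<Sum>k<N. cof N x i i \<omega> * cof N y k k \<omega>)"
      unfolding trace_cofactor_charmat[OF X_carrier, symmetric] sum_product ..
    also have "\<dots> = (\<Sum>i<N. expectation (\<lambda>\<omega>. \<Sum>k<N. cof N x i i \<omega> * cof N y k k \<omega>))"
      by (rule Bochner_Integration.integral_sum) (auto intro!: tame_mult_integrable tame_cofactor)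
    also have "\<dots> = (\<Sum>i<N. \<Sum>k<N. expectation (\<lambda>\<omega>. cof N x i i \<omega> * cof N y k k \<omega>))"
      by (intro sum.cong refl Bochner_Integration.integral_sum) (auto intro!: tame_mult_integrable tame_cofactor)
    finally show ?thesis ..
  qed
  show ?thesis
    unfolding has_bochner_integral_integral_eq[OF hb] 1 2 delta_sum4 3 by (simp add: algebra_simps)
qed

end

section \<open>The first and second moments\<close>

lemma kernel_of_hermite: "kernel_of hermite hermite = hermite_kernel"
  by (simp add: fun_eq_iff kernel_of_def hermite_kernel_def)

lemma kernel_of_lincomb_right:
  assumes "\<And>k. k \<le> n \<Longrightarrow> (\<Sum>m\<in>A. w m * poly (g k) (z m)) = poly (g' k) y"
  shows "(\<Sum>m\<in>A. w m * kernel_of f g n x (z m)) = kernel_of f g' n x y"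
proof -
  have "(\<Sum>m\<in>A. w m * kernel_of f g n x (z m)) = (\<Sum>k\<le>n. poly (f k) x * (\<Sum>m\<in>A. w m * poly (g k) (z m)) / fact k)"
    unfolding kernel_of_def sum_distrib_left sum_divide_distrib by (subst sum.swap) (simp add: mult_ac)
  also have "\<dots> = kernel_of f g' n x y"
    unfolding kernel_of_def by (intro sum.cong refl) (simp add: assms)
  finally show ?thesis .
qed

lemma kernel_of_commute: "kernel_of f g n x y = kernel_of g f n y x"
  unfolding kernel_of_def by (simp add: mult.commute)

definition second_moment_poly :: "'a::real_normed_field \<Rightarrow> nat \<Rightarrow> (nat \<Rightarrow> 'a) \<Rightarrow> 'a" where
  "second_moment_poly c N \<phi> = fact N * quartic_series c \<phi> N"

lemma second_moment_poly_lincomb: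
  "second_moment_poly c N (\<lambda>n. \<Sum>m\<in>A. w m * \<phi> m n) = (\<Sum>m\<in>A. w m * second_moment_poly c N (\<phi> m))"
  unfolding second_moment_poly_def quartic_series_lincomb by (simp add: sum_distrib_left mult_ac)

lemma second_moment_poly_linear:
  "second_moment_poly c N (\<lambda>n. \<phi> n + \<psi> n) = second_moment_poly c N \<phi> + second_moment_poly c N \<psi>"
  "second_moment_poly c N (\<lambda>n. \<phi> n - \<psi> n) = second_moment_poly c N \<phi> - second_moment_poly c N \<psi>"
  "second_moment_poly c N (\<lambda>n. a * \<phi> n) = a * second_moment_poly c N \<phi>"
  "second_moment_poly c N (\<lambda>n. \<phi> n / a) = second_moment_poly c N \<phi> / a"
  unfolding second_moment_poly_def quartic_series_def
  by (simp_all add: sum.distrib sum_subtractf sum_distrib_left sum_divide_distrib distrib_left right_diff_distrib mult_ac)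

lemma second_moment_poly_cong: "(\<And>n. n \<le> N \<Longrightarrow> \<phi> n = \<psi> n) \<Longrightarrow> second_moment_poly c N \<phi> = second_moment_poly c N \<psi>"
  unfolding second_moment_poly_def by (simp cong: quartic_series_cong)

context wigner_ensemble
begin

lemma degree_char_poly_X: "degree (char_poly (X N \<omega>)) = N"
  using degree_monic_char_poly[OF X_carrier] by simp

text \<open>
  \<open>P\<^sub>N\<close> is a random polynomial of degree \<open>N\<close>, so its derivative is a linear combination, with
  non-random weights, of its values at other points.
\<close>
lemma expectation_P_interpolate:
  assumes "tame N G"
  shows "expectation (\<lambda>\<omega>. G \<omega> * P N y \<omega>) =
      (\<Sum>m\<le>N. poly (lagrange_basis N m) 0 * expectation (\<lambda>\<omega>. G \<omega> * P N (y + of_nat (Suc m)) \<omega>))"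
    and "expectation (\<lambda>\<omega>. G \<omega> * P' N y \<omega>) =
      (\<Sum>m\<le>N. poly (pderiv (lagrange_basis N m)) 0 * expectation (\<lambda>\<omega>. G \<omega> * P N (y + of_nat (Suc m)) \<omega>))"
proof -
  have deg: "degree (char_poly (X N \<omega>)) \<le> N" for \<omega> by (simp add: degree_char_poly_X)
  have int: "integrable M (\<lambda>\<omega>. G \<omega> * P N z \<omega>)" for z
    by (rule tame_mult_integrable[OF assms tame_char_poly])
  have lin: "expectation (\<lambda>\<omega>. G \<omega> * (\<Sum>m\<le>N. w m * P N (z m) \<omega>)) = (\<Sum>m\<le>N. w m * expectation (\<lambda>\<omega>. G \<omega> * P N (z m) \<omega>))" for w z
  proof -
    have "(\<lambda>\<omega>. G \<omega> * (\<Sum>m\<le>N. w m * P N (z m) \<omega>)) = (\<lambda>\<omega>. \<Sum>m\<le>N. w m * (G \<omega> * P N (z m) \<omega>))"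
      by (simp add: sum_distrib_left mult_ac)
    thus ?thesis using int by simp
  qed
  show "expectation (\<lambda>\<omega>. G \<omega> * P N y \<omega>) =
      (\<Sum>m\<le>N. poly (lagrange_basis N m) 0 * expectation (\<lambda>\<omega>. G \<omega> * P N (y + of_nat (Suc m)) \<omega>))"
    unfolding lin[symmetric] lagrange_interpolation_shifted(1)[OF deg, where x = y, symmetric] ..
  show "expectation (\<lambda>\<omega>. G \<omega> * P' N y \<omega>) =
      (\<Sum>m\<le>N. poly (pderiv (lagrange_basis N m)) 0 * expectation (\<lambda>\<omega>. G \<omega> * P N (y + of_nat (Suc m)) \<omega>))"
    unfolding lin[symmetric] lagrange_interpolation_shifted(2)[OF deg, where x = y, symmetric] ..
qed

text \<open>
  The mean of \<open>P_Suc\<close> over the new row and column is \<open>x P\<^sub>N - P\<^sub>N'\<close>, the recursion of the Hermite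
  polynomials.
\<close>
lemma first_moment: "expectation (P N x) = poly (hermite N) x"
proof (induction N arbitrary: x)
  case 0
  have "P 0 x \<omega> = 1" for \<omega>
    unfolding det_charmat[OF X_carrier, symmetric] using charmat_carrier[OF X_carrier, of 0 \<omega> x] by simp
  thus ?case by (simp add: prob_space)
next
  case (Suc N)
  have deriv: "expectation (P' N x) = poly (dhermite N) x"
  proof -
    have "expectation (P' N x) = (\<Sum>m\<le>N. poly (pderiv (lagrange_basis N m)) 0 * expectation (P N (x + of_nat (Suc m))))"
      using expectation_P_interpolate(2)[OF tame_const[of N 1], of x] by simp
    also have "\<dots> = poly (dhermite N) x"
      unfolding Suc using lagrange_interpolation_shifted(2)[OF degree_hermite_le, of N x] by simp
    finally show ?thesis .
  qed
  have "has_bochner_integral M (\<lambda>\<omega>. (x - of_real (d N \<omega>)) * (P N x \<omega> * 1)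
      - (\<Sum>i<N. \<Sum>j<N. (entry i N \<omega> * cnj (entry j N \<omega>)) * (cof N x i j \<omega> * 1)))
     (x * expectation (\<lambda>\<omega>. P N x \<omega> * 1) - (\<Sum>i<N. \<Sum>j<N. (if i = j then 1 else 0) * expectation (\<lambda>\<omega>. cof N x i j \<omega> * 1)))"
    using diag_moment[of N]
    by (intro has_bochner_integral_diff has_bochner_integral_sum has_expectation_new_old column_moment4(3,4))
      (auto intro!: tame_char_poly tame_cofactor tame_const coord_fun_column2 coord_fun_diff coord_fun_const coord_fun_diag simp: prob_space)
  hence "has_bochner_integral M (P (Suc N) x) (x * expectation (P N x)
      - (\<Sum>i<N. \<Sum>j<N. (if i = j then 1 else 0) * expectation (cof N x i j)))"
    by (simp add: P_Suc[abs_def])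
  hence "expectation (P (Suc N) x) = x * expectation (P N x) - (\<Sum>i<N. \<Sum>j<N. (if i = j then 1 else 0) * expectation (cof N x i j))"
    by (rule has_bochner_integral_integral_eq)
  also have "(\<Sum>i<N. \<Sum>j<N. (if i = j then 1 else 0) * expectation (cof N x i j)) = (\<Sum>i<N. expectation (cof N x i i))"
    by (simp add: if_distrib[of "\<lambda>c. c * _"] cong: if_cong)
  also have "\<dots> = expectation (P' N x)"
    unfolding trace_cofactor_charmat[OF X_carrier, symmetric]
    by (rule Bochner_Integration.integral_sum[symmetric]) (auto intro!: tame_integrable tame_cofactor)
  finally show ?case unfolding deriv Suc by simp
qed

text \<open>
  Differentiating a known second moment: the weights for the random polynomial \<open>P\<^sub>N\<close> are also exact
  for the Hermite polynomials of degree at most \<open>N\<close>.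
\<close>
lemma derivative_moments:
  assumes f: "\<And>x y. expectation (\<lambda>\<omega>. P N x \<omega> * P N y \<omega>) = second_moment_poly c N (\<lambda>n. hermite_kernel n x y)"
  shows "expectation (\<lambda>\<omega>. P N x \<omega> * P' N y \<omega>) = second_moment_poly c N (\<lambda>n. kernel_of hermite dhermite n x y)"
    and "expectation (\<lambda>\<omega>. P' N x \<omega> * P N y \<omega>) = second_moment_poly c N (\<lambda>n. kernel_of dhermite hermite n x y)"
    and "expectation (\<lambda>\<omega>. P' N x \<omega> * P' N y \<omega>) = second_moment_poly c N (\<lambda>n. kernel_of dhermite dhermite n x y)"
proof -
  have w: "(\<Sum>m\<le>N. poly (pderiv (lagrange_basis N m)) 0 * poly (hermite k) (y + of_nat (Suc m))) = poly (dhermite k) y"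
    if "k \<le> N" for k and y :: complex
    using lagrange_interpolation_shifted(2)[OF order_trans[OF degree_hermite_le that], of y] ..
  show 1: "expectation (\<lambda>\<omega>. P N x \<omega> * P' N y \<omega>) = second_moment_poly c N (\<lambda>n. kernel_of hermite dhermite n x y)" for x y
    unfolding expectation_P_interpolate(2)[OF tame_char_poly] f second_moment_poly_lincomb[symmetric] kernel_of_hermite[symmetric]
    by (intro second_moment_poly_cong kernel_of_lincomb_right w) simp
  show "expectation (\<lambda>\<omega>. P' N x \<omega> * P N y \<omega>) = second_moment_poly c N (\<lambda>n. kernel_of dhermite hermite n x y)"
    using 1[of y x] by (simp only: mult.commute kernel_of_commute[of hermite])
  have 2: "expectation (\<lambda>\<omega>. P' N x \<omega> * P N y \<omega>) = second_moment_poly c N (\<lambda>n. kernel_of dhermite hermite n x y)" for y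
    using 1[of y x] by (simp only: mult.commute kernel_of_commute[of hermite])
  show "expectation (\<lambda>\<omega>. P' N x \<omega> * P' N y \<omega>) = second_moment_poly c N (\<lambda>n. kernel_of dhermite dhermite n x y)"
    unfolding expectation_P_interpolate(2)[OF tame_pderiv_char_poly] 2 second_moment_poly_lincomb[symmetric]
    by (intro second_moment_poly_cong kernel_of_lincomb_right w) simp
qed

text \<open>
  The recursion divides by \<open>x - y\<close>; the value on the diagonal follows by interpolation in \<open>y\<close> from
  points different from \<open>x\<close>.
\<close>
lemma second_moment_diag:
  assumes "\<And>x y. x \<noteq> y \<Longrightarrow> expectation (\<lambda>\<omega>. P N x \<omega> * P N y \<omega>) = second_moment_poly c N (\<lambda>n. hermite_kernel n x y)"
  shows "expectation (\<lambda>\<omega>. P N x \<omega> * P N x \<omega>) = second_moment_poly c N (\<lambda>n. hermite_kernel n x x)"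
proof -
  have w: "(\<Sum>m\<le>N. poly (lagrange_basis N m) 0 * poly (hermite k) (x + of_nat (Suc m))) = poly (hermite k) x"
    if "k \<le> N" for k
    using lagrange_interpolation_shifted(1)[OF order_trans[OF degree_hermite_le that], of x] ..
  have "expectation (\<lambda>\<omega>. P N x \<omega> * P N (x + of_nat (Suc m)) \<omega>) = second_moment_poly c N (\<lambda>n. hermite_kernel n x (x + of_nat (Suc m)))" for m
    by (rule assms) (simp del: of_nat_Suc)
  thus ?thesis
    unfolding expectation_P_interpolate(1)[OF tame_char_poly, of N x x]
    by (simp only: second_moment_poly_lincomb[symmetric] kernel_of_hermite[symmetric])
      (intro second_moment_poly_cong kernel_of_lincomb_right w, simp)
qed

end

text \<open>Passes from the recursion for \<open>f\<^sub>N / N!\<close> to the one for \<open>f\<^sub>N\<close>.\<close>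
lemma fact_convolution_step:
  fixes s b q r :: complex
  assumes "of_nat (Suc K) * r = s + (if K = 0 then 0 else b * q)"
  shows "fact K * s + b * (of_nat K * (fact (K - 1) * q)) = fact (Suc K) * r"
proof -
  have "fact (Suc K) * r = fact K * (of_nat (Suc K) * r)"
    by (simp only: fact_Suc of_nat_mult of_nat_fact mult_ac)
  also have "\<dots> = fact K * s + b * ((if K = 0 then 0 else fact K) * q)"
    unfolding assms by (simp add: distrib_left)
  also have "(if K = 0 then 0 else fact K) = (of_nat K * fact (K - 1) :: complex)"
    using fact_reduce[of K, where ?'a = complex] by simp
  finally show ?thesis by (simp only: mult.assoc)
qed

text \<open>
  Strong induction on \<open>N\<close>, over all ensembles with entry distribution \<open>Q\<close> on the same probability
  space: the principal minors in the recursion belong to the ensembles with one index deleted and size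
  \<open>N - 2\<close>.
\<close>
lemma second_moment:
  assumes "wigner_ensemble M Q d re im"
  shows "(\<integral>\<omega>. poly (char_poly (wigner_matrix d re im N \<omega>)) x * poly (char_poly (wigner_matrix d re im N \<omega>)) y \<partial>M)
     = second_moment_poly (of_real (wigner_ensemble.excess Q)) N (\<lambda>n. hermite_kernel n x y)"
  using assms
proof (induction N arbitrary: d re im x y rule: less_induct)
  case (less N)
  interpret wigner_ensemble M Q d re im by (rule less.prems)
  let ?c = "of_real excess :: complex"
  show ?case
  proof (cases N)
    case 0
    have "P 0 z \<omega> = 1" for z \<omega>
      unfolding det_charmat[OF X_carrier, symmetric] using charmat_carrier[OF X_carrier, of 0 \<omega> z] by simp
    thus ?thesis using 0 by (simp add: prob_space second_moment_poly_def quartic_series_def hermite_kernel_def)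
  next
    case (Suc K)
    note IH = less.IH[of K, OF _ less.prems, unfolded Suc, OF lessI]
    have step: "expectation (\<lambda>\<omega>. P (Suc K) x \<omega> * P (Suc K) y \<omega>) = second_moment_poly ?c (Suc K) (\<lambda>n. hermite_kernel n x y)"
      if ne: "x \<noteq> y" for x y
    proof -
      have div: "s = r / (x - y)" if "(x - y) * s = r" for s r
        using that ne by auto
      have tr: "(\<Sum>i<K. \<Sum>j<K. expectation (\<lambda>\<omega>. cof K x i j \<omega> * cof K y j i \<omega>))
          = (expectation (\<lambda>\<omega>. P K x \<omega> * P' K y \<omega>) - expectation (\<lambda>\<omega>. P' K x \<omega> * P K y \<omega>)) / (x - y)"
      proof -
        have int: "integrable M (\<lambda>\<omega>. cof K x i j \<omega> * cof K y j i \<omega>)" if "i < K" "j < K" for i j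
          using that by (intro tame_mult_integrable[where N = K] tame_cofactor)
        have "expectation (\<lambda>\<omega>. \<Sum>i<K. \<Sum>j<K. cof K x i j \<omega> * cof K y j i \<omega>)
            = (\<Sum>i<K. expectation (\<lambda>\<omega>. \<Sum>j<K. cof K x i j \<omega> * cof K y j i \<omega>))"
          by (rule Bochner_Integration.integral_sum) (use int in auto)
        also have "\<dots> = (\<Sum>i<K. \<Sum>j<K. expectation (\<lambda>\<omega>. cof K x i j \<omega> * cof K y j i \<omega>))"
          by (intro sum.cong refl Bochner_Integration.integral_sum) (use int in auto)
        finally have E: "expectation (\<lambda>\<omega>. \<Sum>i<K. \<Sum>j<K. cof K x i j \<omega> * cof K y j i \<omega>)
            = (\<Sum>i<K. \<Sum>j<K. expectation (\<lambda>\<omega>. cof K x i j \<omega> * cof K y j i \<omega>))" .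
        have "(x - y) * (\<Sum>i<K. \<Sum>j<K. expectation (\<lambda>\<omega>. cof K x i j \<omega> * cof K y j i \<omega>))
            = expectation (\<lambda>\<omega>. (x - y) * (\<Sum>i<K. \<Sum>j<K. cof K x i j \<omega> * cof K y j i \<omega>))"
          unfolding E[symmetric] by simp
        also have "\<dots> = expectation (\<lambda>\<omega>. P K x \<omega> * P' K y \<omega> - P' K x \<omega> * P K y \<omega>)"
          unfolding trace_adj_charmat[OF X_carrier] by (simp only: mult.commute)
        also have "\<dots> = expectation (\<lambda>\<omega>. P K x \<omega> * P' K y \<omega>) - expectation (\<lambda>\<omega>. P' K x \<omega> * P K y \<omega>)"
          by (intro Bochner_Integration.integral_diff tame_mult_integrable[where N = K] tame_char_poly tame_pderiv_char_poly)
        finally show ?thesis by (rule div)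
      qed
      have minors: "(\<Sum>i<K. expectation (\<lambda>\<omega>. cof K x i i \<omega> * cof K y i i \<omega>))
          = of_nat K * second_moment_poly ?c (K - 1) (\<lambda>n. hermite_kernel n x y)"
      proof -
        have "expectation (\<lambda>\<omega>. cof K x i i \<omega> * cof K y i i \<omega>) = second_moment_poly ?c (K - 1) (\<lambda>n. hermite_kernel n x y)"
          if i: "i < K" for i
        proof -
          have lt: "K - 1 < N" using Suc by simp
          show ?thesis
            unfolding cofactor_diag_charmat[OF X_carrier i] mat_delete_X[OF i]
            using less.IH[OF lt wigner_ensemble_skip[of i], of x y] .
        qed
        thus ?thesis by simp
      qed
      define \<phi> where "\<phi> = (\<lambda>n. hermite_kernel n x y)"
      define \<phi>y where "\<phi>y = (\<lambda>n. kernel_of hermite dhermite n x y)"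
      define \<phi>x where "\<phi>x = (\<lambda>n. kernel_of dhermite hermite n x y)"
      define \<phi>xy where "\<phi>xy = (\<lambda>n. kernel_of dhermite dhermite n x y)"
      define \<psi> where "\<psi> = (\<lambda>n. (1 + x * y) * \<phi> n - x * \<phi>y n - y * \<phi>x n + \<phi>xy n + (\<phi>y n - \<phi>x n) / (x - y))"
      have \<psi>: "of_nat (Suc n) * \<phi> (Suc n) = \<psi> n" for n
        using hermite_kernel_recursion[OF ne, of n] unfolding \<psi>_def \<phi>_def \<phi>x_def \<phi>y_def \<phi>xy_def .
      have lin: "second_moment_poly ?c K \<psi> = (1 + x * y) * second_moment_poly ?c K \<phi>
         - x * second_moment_poly ?c K \<phi>y - y * second_moment_poly ?c K \<phi>x
         + second_moment_poly ?c K \<phi>xy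
         + (second_moment_poly ?c K \<phi>y - second_moment_poly ?c K \<phi>x) / (x - y)"
        unfolding \<psi>_def second_moment_poly_linear ..
      define f where "f = quartic_series ?c \<phi>"
      have "expectation (\<lambda>\<omega>. P (Suc K) x \<omega> * P (Suc K) y \<omega>)
          = second_moment_poly ?c K \<psi> + 2 * ?c * (of_nat K * second_moment_poly ?c (K - 1) \<phi>)"
        unfolding second_moment_recursion tr minors IH derivative_moments[OF IH]
          lin \<phi>_def[symmetric] \<phi>x_def[symmetric] \<phi>y_def[symmetric] \<phi>xy_def[symmetric] ..
      hence e1: "expectation (\<lambda>\<omega>. P (Suc K) x \<omega> * P (Suc K) y \<omega>)
          = fact K * quartic_series ?c \<psi> K + 2 * ?c * (of_nat K * (fact (K - 1) * f (K - 1)))"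
        unfolding second_moment_poly_def f_def .
      have e2: "of_nat (Suc K) * f (Suc K) = quartic_series ?c \<psi> K + (if K = 0 then 0 else 2 * ?c * f (K - 1))"
        using quartic_series_Suc[of \<phi> \<psi>, OF \<psi>, of K ?c] unfolding f_def .
      show ?thesis
        using trans[OF e1 fact_convolution_step[OF e2]] unfolding second_moment_poly_def f_def \<phi>_def .
    qed
    show ?thesis
    proof (cases "x = y")
      case True
      show ?thesis unfolding Suc True by (rule second_moment_diag[OF step])
    next
      case False
      thus ?thesis unfolding Suc by (rule step)
    qed
  qed
qed

section \<open>The covariance of the determinants\<close>

lemma poly_hermite_of_real:
  "poly (hermite n) (of_real x :: 'a::{real_normed_field}) = of_real (poly (hermite n) x)"
proof (induction n rule: induct_nat_012)
  case (ge2 n)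
  have r: "poly (hermite (Suc (Suc n))) z = z * poly (hermite (Suc n)) z - of_nat (Suc n) * poly (hermite n) z" for z :: "'b::real_normed_field"
    by (simp only: poly_hermite_Suc[of "Suc n"] poly_pderiv_hermite_Suc)
  show ?case unfolding r ge2 by simp
next
case 0 then show ?case by simp
next case 1 then show ?case by (simp add: pderiv_1)
qed

lemma hermite_kernel_of_real:
  "hermite_kernel n (of_real x) (of_real y :: 'a::real_normed_field) = of_real (hermite_kernel n x y)"
  unfolding hermite_kernel_def poly_hermite_of_real of_real_sum of_real_divide of_real_mult of_real_fact ..

context wigner_ensemble
begin

lemma shifted_det_eq: "complex_of_real (shifted_det d re im N x \<omega>) = (-1) ^ N * P N (of_real x) \<omega>"
proof -
  have "X N \<omega> - complex_of_real x \<cdot>\<^sub>m 1\<^sub>m N = (-1) \<cdot>\<^sub>m charmat (X N \<omega>) (of_real x)"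
    by (intro eq_matI) (auto simp: charmat_def wigner_matrix_def)
  moreover have "dim_col (charmat (X N \<omega>) (of_real x)) = N" by (simp add: charmat_def wigner_matrix_def)
  ultimately show ?thesis
    unfolding of_real_shifted_det det_charmat[OF X_carrier, symmetric] by simp
qed

lemma shifted_det_moments:
  shows "integrable M (shifted_det d re im N x)"
    and "expectation (shifted_det d re im N x) = (-1) ^ N * poly (hermite N) x"
    and "integrable M (\<lambda>\<omega>. shifted_det d re im N x \<omega> * shifted_det d re im N y \<omega>)"
    and "expectation (\<lambda>\<omega>. shifted_det d re im N x \<omega> * shifted_det d re im N y \<omega>)
      = second_moment_poly excess N (\<lambda>n. hermite_kernel n x y)"
proof -
  have Re: "shifted_det d re im N x \<omega> = Re ((-1) ^ N * P N (of_real x) \<omega>)" for x \<omega>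
    using arg_cong[OF shifted_det_eq[of N x \<omega>], of Re] unfolding Re_complex_of_real .
  show int: "integrable M (shifted_det d re im N x)" for x
    unfolding Re[abs_def] by (intro integrable_Re integrable_mult_right tame_integrable[OF tame_char_poly])
  have "complex_of_real (expectation (shifted_det d re im N x)) = of_real ((-1) ^ N * poly (hermite N) x)"
    unfolding integral_complex_of_real[symmetric] shifted_det_eq
    by (simp add: first_moment poly_hermite_of_real)
  thus "expectation (shifted_det d re im N x) = (-1) ^ N * poly (hermite N) x"
    unfolding of_real_eq_iff .
  have prod: "complex_of_real (shifted_det d re im N x \<omega> * shifted_det d re im N y \<omega>) = P N (of_real x) \<omega> * P N (of_real y) \<omega>" for x y \<omega>
    unfolding of_real_mult shifted_det_eq by (simp add: mult_ac)
  have eq: "shifted_det d re im N x \<omega> * shifted_det d re im N y \<omega> = Re (P N (of_real x) \<omega> * P N (of_real y) \<omega>)" for \<omega>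
    unfolding prod[symmetric] Re_complex_of_real ..
  show "integrable M (\<lambda>\<omega>. shifted_det d re im N x \<omega> * shifted_det d re im N y \<omega>)"
    unfolding eq by (intro integrable_Re tame_mult_integrable[where N = N] tame_char_poly)
  have "complex_of_real (expectation (\<lambda>\<omega>. shifted_det d re im N x \<omega> * shifted_det d re im N y \<omega>))
      = of_real (second_moment_poly excess N (\<lambda>n. hermite_kernel n x y))"
    unfolding integral_complex_of_real[symmetric] prod second_moment[OF wigner_ensemble_axioms]
    by (simp add: second_moment_poly_def quartic_series_def hermite_kernel_of_real)
  thus "expectation (\<lambda>\<omega>. shifted_det d re im N x \<omega> * shifted_det d re im N y \<omega>)
      = second_moment_poly excess N (\<lambda>n. hermite_kernel n x y)"
    unfolding of_real_eq_iff .
qed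

lemma centered_det_covariance:
  "expectation (\<lambda>\<omega>. centered_det M d re im N \<xi> \<mu> \<omega> * centered_det M d re im N \<xi> \<nu> \<omega>)
     = fact N * cov_series excess N (bulk_point \<xi> \<mu> N) (bulk_point \<xi> \<nu> N)"
proof -
  let ?x = "bulk_point \<xi> \<mu> N" and ?y = "bulk_point \<xi> \<nu> N"
  let ?S = "shifted_det d re im N"
  have cd: "centered_det M d re im N \<xi> \<eta> \<omega> = ?S (bulk_point \<xi> \<eta> N) \<omega> - expectation (?S (bulk_point \<xi> \<eta> N))" for \<eta> \<omega>
    by (simp add: centered_det_def bulk_point_def Let_def)
  have "expectation (\<lambda>\<omega>. (?S ?x \<omega> - m) * (?S ?y \<omega> - m'))
      = expectation (\<lambda>\<omega>. ?S ?x \<omega> * ?S ?y \<omega>) - m * expectation (?S ?y) - m' * expectation (?S ?x) + m * m'" for m m'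
  proof -
    have "(\<lambda>\<omega>. (?S ?x \<omega> - m) * (?S ?y \<omega> - m')) = (\<lambda>\<omega>. ?S ?x \<omega> * ?S ?y \<omega> - m * ?S ?y \<omega> - m' * ?S ?x \<omega> + m * m')"
      by (simp add: algebra_simps)
    thus ?thesis using shifted_det_moments(1,3) by (simp add: prob_space)
  qed
  hence "expectation (\<lambda>\<omega>. centered_det M d re im N \<xi> \<mu> \<omega> * centered_det M d re im N \<xi> \<nu> \<omega>)
      = expectation (\<lambda>\<omega>. ?S ?x \<omega> * ?S ?y \<omega>) - expectation (?S ?x) * expectation (?S ?y)"
    unfolding cd by simp
  also have "\<dots> = fact N * cov_series excess N ?x ?y"
  proof -
    have "((-1) ^ N * u) * ((-1) ^ N * v) = u * v" for u v :: real
    proof -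
      have "((-1) ^ N * u) * ((-1) ^ N * v) = ((-1) ^ N * (-1) ^ N) * (u * v)" by (simp only: mult_ac)
      thus ?thesis by simp
    qed
    thus ?thesis
      unfolding shifted_det_moments(2,4) second_moment_poly_def quartic_series_def cov_series_def
      by (simp add: right_diff_distrib)
  qed
  finally show ?thesis .
qed

end

theorem corollary1p4:
  fixes M :: "'a measure" and Q :: "real measure"
    and d :: "nat \<Rightarrow> 'a \<Rightarrow> real" and re im :: "nat \<Rightarrow> nat \<Rightarrow> 'a \<Rightarrow> real"
    and \<xi> \<mu> \<nu> :: real
  assumes "real_distribution Q"
    and "integrable Q (\<lambda>x. x ^ 4)"
    and "(\<integral>x. x \<partial>Q) = 0"
    and "(\<integral>x. x\<^sup>2 \<partial>Q) = 1 / 2"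
    and "prob_space M"
    and "wigner_family M Q d re im"
    and "\<xi> \<in> {-2<..<2}"
  shows "(\<lambda>N. (\<integral>\<omega>. centered_det M d re im N \<xi> \<mu> \<omega> * centered_det M d re im N \<xi> \<nu> \<omega> \<partial>M) /
              (sqrt (\<integral>\<omega>. (centered_det M d re im N \<xi> \<mu> \<omega>)\<^sup>2 \<partial>M) *
               sqrt (\<integral>\<omega>. (centered_det M d re im N \<xi> \<nu> \<omega>)\<^sup>2 \<partial>M)))
         \<longlonglongrightarrow> sinc (pi * (\<mu> - \<nu>))"
proof -
  interpret prob_space M by (rule assms(5))
  interpret wigner_ensemble M Q d re im
    by (intro wigner_ensemble.intro wigner_ensemble_axioms.intro assms)
  have cancel: "f * u / (sqrt (f * v) * sqrt (f * w)) = u / (sqrt v * sqrt w)" if "f > 0" for f u v w :: real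
  proof -
    have "sqrt (f * v) * sqrt (f * w) = f * (sqrt v * sqrt w)"
      using that by (simp add: real_sqrt_mult mult_ac)
    thus ?thesis using that by simp
  qed
  show ?thesis
    unfolding power2_eq_square centered_det_covariance cancel[OF fact_gt_zero]
    by (rule cov_series_correlation_limit[OF assms(7)])
qed

end
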